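(* Let $C$ be a semiperfect coalgebra over a field $k$. Then the trivial coextension $C\oplus \mathrm{Rat}(C^* )$ is a symmetric coalgebra. In particular, any semiperfect coalgebra can be embedded in a symmetric coalgebra (i.e. is isomorphic to a subcoalgebra of a symmetric coalgebra).
   Context: For a coalgebra $C$ over $k$ with $\Delta(x)=\sum x_1\otimes x_2$ and counit $\varepsilon$, the dual $C^*$ is an algebra with the convolution product $(c^*d^* )(x)=\sum c^*(x_1)d^*(x_2)$. $C$ is a $(C^*,C^* )$-bimodule with $c^*\cdot x=\sum c^*(x_2)x_1$ and $x\cdot c^*=\sum c^*(x_1)x_2$; $C^*$ is a bimodule over itself by multiplication. $C$ is symmetric if there exists an injective morphism $C\to C^*$ of $(C^*,C^* )$-bimodules. Coalgebras are not assumed finite dimensional. $C$ is right (respectively left) semiperfect if the injective envelope of every simple left (respectively right) $C$-comodule is finite dimensional; semiperfect means left and right semiperfect. The rational part of a left (respectively right) $C^*$-module is its largest submodule whose module structure is induced by a right (respectively left) $C$-comodule structure. If $C$ is semiperfect, the rational parts of $C^*$ as a left and as a right $C^*$-module coincide, and this common subspace is denoted $\mathrm{Rat}(C^* )$. Trivial coextension: let $M$ be a $(C,C)$-bicomodule, with left coaction $m\mapsto\sum m_{(-1)}\otimes m_{(0)}\in C\otimes M$ and right coaction $m\mapsto\sum m_{[0]}\otimes m_{[1]}\in M\otimes C$. The trivial coextension of $C$ and $M$ is the space $C\oplus M$ with the coalgebra structure $$\Delta(c,m)=\sum (c_1,0)\otimes(c_2,0)+\sum(m_{(-1)},0)\otimes(0,m_{(0)})+\sum(0,m_{[0]})\otimes(m_{[1]},0),\qquad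 \varepsilon(c,m)=\varepsilon(c).$$ For $M=\mathrm{Rat}(C^* )$ the bicomodule structure is the one induced by its rational $(C^*,C^* )$-bimodule structure: $c^*m=\sum c^*(m_{[1]})m_{[0]}$ and $mc^*=\sum c^*(m_{(-1)})m_{(0)}$ for $c^*\in C^*$, $m\in M$. *)

theory Defs
  imports Complex_Main "HOL-Library.Multiset" "HOL-Library.Function_Algebras" "HOL-Library.Product_Plus"
begin

text \<open>
  The field \<open>k\<close> is the type \<open>'k\<close>.  A vector space is a subspace of a vector space structure on a
  type; the carrier is needed because \<open>Rat(C\<^sup>*)\<close> and the comodules below are not whole types.
\<close>

record ('k, 'v) vspace =
  carrier :: "'v set"
  smul :: "'k \<Rightarrow> 'v \<Rightarrow> 'v"

definition is_vspace :: "('k::field, 'v::ab_group_add, 'x) vspace_scheme \<Rightarrow> bool" where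
  "is_vspace V \<longleftrightarrow> vector_space (smul V) \<and> module.subspace (smul V) (carrier V)"

definition lin_map ::
  "('k::field, 'v::ab_group_add, 'x) vspace_scheme \<Rightarrow> ('k, 'w::ab_group_add, 'y) vspace_scheme
    \<Rightarrow> ('v \<Rightarrow> 'w) \<Rightarrow> bool" where
  "lin_map V W f \<longleftrightarrow>
     f ` carrier V \<subseteq> carrier W \<and>
     (\<forall>x\<in>carrier V. \<forall>y\<in>carrier V. f (x + y) = f x + f y) \<and>
     (\<forall>a. \<forall>x\<in>carrier V. f (smul V a x) = smul W a (f x))"

definition finite_dim :: "('k::field, 'v::ab_group_add, 'x) vspace_scheme \<Rightarrow> bool" where
  "finite_dim V \<longleftrightarrow> (\<exists>B. finite B \<and> carrier V = module.span (smul V) B)"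


subsection \<open>Tensor products\<close>

text \<open>
  The multiset \<open>{#(v\<^sub>1, w\<^sub>1), \<dots>, (v\<^sub>n, w\<^sub>n)#}\<close> with entries in \<open>V \<times> W\<close> stands for the tensor
  \<open>v\<^sub>1 \<otimes> w\<^sub>1 + \<dots> + v\<^sub>n \<otimes> w\<^sub>n\<close>.  So \<open>V \<otimes> W\<close> is the free commutative monoid on \<open>V \<times> W\<close>
  modulo the congruence \<open>tensor_eq V W\<close> generated by the bilinearity relations.  Maps into tensor
  products are given by representatives, as in Sweedler's notation, and tensors are always
  compared by this congruence, never by equality of multisets.  Maps out of tensor products are
  only ever applied in a bilinear way, e.g. \<open>\<Sum>(x\<^sub>1, x\<^sub>2)\<in>#\<Delta> x. f x\<^sub>1 * g x\<^sub>2\<close>.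
\<close>

inductive tensor_eq ::
  "('k::field, 'v::ab_group_add, 'x) vspace_scheme \<Rightarrow> ('k, 'w::ab_group_add, 'y) vspace_scheme
    \<Rightarrow> ('v \<times> 'w) multiset \<Rightarrow> ('v \<times> 'w) multiset \<Rightarrow> bool"
  for V W where
  refl: "tensor_eq V W s s"
| sym: "tensor_eq V W s t \<Longrightarrow> tensor_eq V W t s"
| trans: "tensor_eq V W r s \<Longrightarrow> tensor_eq V W s t \<Longrightarrow> tensor_eq V W r t"
| plus: "tensor_eq V W s t \<Longrightarrow> tensor_eq V W (s + r) (t + r)"
| zero: "w \<in> carrier W \<Longrightarrow> tensor_eq V W {#(0, w)#} {#}"
| add_left: "v \<in> carrier V \<Longrightarrow> v' \<in> carrier V \<Longrightarrow> w \<in> carrier W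
    \<Longrightarrow> tensor_eq V W {#(v + v', w)#} {#(v, w), (v', w)#}"
| add_right: "v \<in> carrier V \<Longrightarrow> w \<in> carrier W \<Longrightarrow> w' \<in> carrier W
    \<Longrightarrow> tensor_eq V W {#(v, w + w')#} {#(v, w), (v, w')#}"
| smul: "v \<in> carrier V \<Longrightarrow> w \<in> carrier W
    \<Longrightarrow> tensor_eq V W {#(smul V a v, w)#} {#(v, smul W a w)#}"

text \<open>Equality in the threefold tensor product \<open>U \<otimes> V \<otimes> W\<close>.\<close>

inductive tensor3_eq ::
  "('k::field, 'u::ab_group_add, 'x) vspace_scheme \<Rightarrow> ('k, 'v::ab_group_add, 'y) vspace_scheme
    \<Rightarrow> ('k, 'w::ab_group_add, 'z) vspace_scheme
    \<Rightarrow> ('u \<times> 'v \<times> 'w) multiset \<Rightarrow> ('u \<times> 'v \<times> 'w) multiset \<Rightarrow> bool"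
  for U V W where
  refl: "tensor3_eq U V W s s"
| sym: "tensor3_eq U V W s t \<Longrightarrow> tensor3_eq U V W t s"
| trans: "tensor3_eq U V W r s \<Longrightarrow> tensor3_eq U V W s t \<Longrightarrow> tensor3_eq U V W r t"
| plus: "tensor3_eq U V W s t \<Longrightarrow> tensor3_eq U V W (s + r) (t + r)"
| zero: "v \<in> carrier V \<Longrightarrow> w \<in> carrier W \<Longrightarrow> tensor3_eq U V W {#(0, v, w)#} {#}"
| add_1: "u \<in> carrier U \<Longrightarrow> u' \<in> carrier U \<Longrightarrow> v \<in> carrier V \<Longrightarrow> w \<in> carrier W
    \<Longrightarrow> tensor3_eq U V W {#(u + u', v, w)#} {#(u, v, w), (u', v, w)#}"
| add_2: "u \<in> carrier U \<Longrightarrow> v \<in> carrier V \<Longrightarrow> v' \<in> carrier V \<Longrightarrow> w \<in> carrier W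
    \<Longrightarrow> tensor3_eq U V W {#(u, v + v', w)#} {#(u, v, w), (u, v', w)#}"
| add_3: "u \<in> carrier U \<Longrightarrow> v \<in> carrier V \<Longrightarrow> w \<in> carrier W \<Longrightarrow> w' \<in> carrier W
    \<Longrightarrow> tensor3_eq U V W {#(u, v, w + w')#} {#(u, v, w), (u, v, w')#}"
| smul_12: "u \<in> carrier U \<Longrightarrow> v \<in> carrier V \<Longrightarrow> w \<in> carrier W
    \<Longrightarrow> tensor3_eq U V W {#(smul U a u, v, w)#} {#(u, smul V a v, w)#}"
| smul_23: "u \<in> carrier U \<Longrightarrow> v \<in> carrier V \<Longrightarrow> w \<in> carrier W
    \<Longrightarrow> tensor3_eq U V W {#(u, smul V a v, w)#} {#(u, v, smul W a w)#}"

text \<open>\<open>\<delta>\<close> represents a linear map \<open>X \<rightarrow> V \<otimes> W\<close>.\<close>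

definition tensor_lin_map ::
  "('k::field, 'a::ab_group_add, 'x) vspace_scheme \<Rightarrow> ('k, 'v::ab_group_add, 'y) vspace_scheme
    \<Rightarrow> ('k, 'w::ab_group_add, 'z) vspace_scheme \<Rightarrow> ('a \<Rightarrow> ('v \<times> 'w) multiset) \<Rightarrow> bool" where
  "tensor_lin_map X V W \<delta> \<longleftrightarrow>
     (\<forall>x\<in>carrier X. set_mset (\<delta> x) \<subseteq> carrier V \<times> carrier W) \<and>
     (\<forall>x\<in>carrier X. \<forall>y\<in>carrier X. tensor_eq V W (\<delta> (x + y)) (\<delta> x + \<delta> y)) \<and>
     (\<forall>a. \<forall>x\<in>carrier X.
        tensor_eq V W (\<delta> (smul X a x)) (image_mset (\<lambda>(v, w). (smul V a v, w)) (\<delta> x)))"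


subsection \<open>Coalgebras\<close>

record ('k, 'c) coalg = "('k, 'c) vspace" +
  comult :: "'c \<Rightarrow> ('c \<times> 'c) multiset"
  counit :: "'c \<Rightarrow> 'k"

definition coalgebra :: "('k::field, 'c::ab_group_add) coalg \<Rightarrow> bool" where
  "coalgebra C \<longleftrightarrow>
     is_vspace C \<and>
     tensor_lin_map C C C (comult C) \<and>
     (\<forall>x\<in>carrier C. \<forall>y\<in>carrier C. counit C (x + y) = counit C x + counit C y) \<and>
     (\<forall>a. \<forall>x\<in>carrier C. counit C (smul C a x) = a * counit C x) \<and>
     (\<forall>x\<in>carrier C. tensor3_eq C C C
        (\<Sum>(x\<^sub>1, x\<^sub>2)\<in>#comult C x. image_mset (\<lambda>(u, v). (u, v, x\<^sub>2)) (comult C x\<^sub>1))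
        (\<Sum>(x\<^sub>1, x\<^sub>2)\<in>#comult C x. image_mset (\<lambda>(u, v). (x\<^sub>1, u, v)) (comult C x\<^sub>2))) \<and>
     (\<forall>x\<in>carrier C. (\<Sum>(x\<^sub>1, x\<^sub>2)\<in>#comult C x. smul C (counit C x\<^sub>1) x\<^sub>2) = x) \<and>
     (\<forall>x\<in>carrier C. (\<Sum>(x\<^sub>1, x\<^sub>2)\<in>#comult C x. smul C (counit C x\<^sub>2) x\<^sub>1) = x)"

definition coalgebra_hom ::
  "('k::field, 'c::ab_group_add) coalg \<Rightarrow> ('k, 'd::ab_group_add) coalg \<Rightarrow> ('c \<Rightarrow> 'd) \<Rightarrow> bool" where
  "coalgebra_hom C D f \<longleftrightarrow>
     lin_map C D f \<and>
     (\<forall>x\<in>carrier C. tensor_eq D D (image_mset (map_prod f f) (comult C x)) (comult D (f x))) \<and>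
     (\<forall>x\<in>carrier C. counit D (f x) = counit C x)"

definition coalgebra_iso ::
  "('k::field, 'c::ab_group_add) coalg \<Rightarrow> ('k, 'd::ab_group_add) coalg \<Rightarrow> ('c \<Rightarrow> 'd) \<Rightarrow> bool" where
  "coalgebra_iso C D f \<longleftrightarrow> coalgebra_hom C D f \<and> bij_betw f (carrier C) (carrier D)"

text \<open>
  A subcoalgebra is a subspace \<open>B\<close> with \<open>\<Delta>(B) \<subseteq> B \<otimes> B\<close>, with the restricted structure; the
  representatives of \<open>\<Delta>\<close> with entries in \<open>B\<close> are part of the record \<open>B\<close>.
\<close>

definition subcoalgebra ::
  "('k::field, 'd::ab_group_add) coalg \<Rightarrow> ('k, 'd) coalg \<Rightarrow> bool" where
  "subcoalgebra B D \<longleftrightarrow>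
     coalgebra B \<and> coalgebra D \<and> carrier B \<subseteq> carrier D \<and> smul B = smul D \<and>
     (\<forall>x\<in>carrier B. tensor_eq D D (comult B x) (comult D x)) \<and>
     (\<forall>x\<in>carrier B. counit B x = counit D x)"


subsection \<open>The dual algebra and symmetric coalgebras\<close>

text \<open>
  Linear functionals on \<open>C\<close> are extended by \<open>0\<close> outside the carrier, so that they are determined
  by their values on \<open>C\<close>.
\<close>

definition dual :: "('k::field, 'v::ab_group_add, 'x) vspace_scheme \<Rightarrow> ('k, 'v \<Rightarrow> 'k) vspace" where
  "dual V = \<lparr>
     carrier = {f. (\<forall>x\<in>carrier V. \<forall>y\<in>carrier V. f (x + y) = f x + f y) \<and>
                   (\<forall>a. \<forall>x\<in>carrier V. f (smul V a x) = a * f x) \<and>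
                   (\<forall>x. x \<notin> carrier V \<longrightarrow> f x = 0)},
     smul = (\<lambda>a f x. a * f x)\<rparr>"

definition conv :: "('k::field, 'c::ab_group_add) coalg \<Rightarrow> ('c \<Rightarrow> 'k) \<Rightarrow> ('c \<Rightarrow> 'k) \<Rightarrow> 'c \<Rightarrow> 'k" where
  "conv C f g = (\<lambda>x. if x \<in> carrier C then \<Sum>(x\<^sub>1, x\<^sub>2)\<in>#comult C x. f x\<^sub>1 * g x\<^sub>2 else 0)"

definition dual_act_left :: "('k::field, 'c::ab_group_add) coalg \<Rightarrow> ('c \<Rightarrow> 'k) \<Rightarrow> 'c \<Rightarrow> 'c" where
  "dual_act_left C f x = (\<Sum>(x\<^sub>1, x\<^sub>2)\<in>#comult C x. smul C (f x\<^sub>2) x\<^sub>1)"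

definition dual_act_right :: "('k::field, 'c::ab_group_add) coalg \<Rightarrow> 'c \<Rightarrow> ('c \<Rightarrow> 'k) \<Rightarrow> 'c" where
  "dual_act_right C x f = (\<Sum>(x\<^sub>1, x\<^sub>2)\<in>#comult C x. smul C (f x\<^sub>1) x\<^sub>2)"

definition symmetric_coalgebra :: "('k::field, 'c::ab_group_add) coalg \<Rightarrow> bool" where
  "symmetric_coalgebra C \<longleftrightarrow>
     coalgebra C \<and>
     (\<exists>\<phi>. lin_map C (dual C) \<phi> \<and> inj_on \<phi> (carrier C) \<and>
        (\<forall>f\<in>carrier (dual C). \<forall>x\<in>carrier C.
           \<phi> (dual_act_left C f x) = conv C f (\<phi> x) \<and>
           \<phi> (dual_act_right C x f) = conv C (\<phi> x) f))"


subsection \<open>Comodules\<close>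

text \<open>
  The entries of \<open>coact M x\<close> lie in \<open>M \<times> C\<close> for right and in \<open>C \<times> M\<close> for left comodules.
\<close>

record ('k, 'm, 't) comod = "('k, 'm) vspace" +
  coact :: "'m \<Rightarrow> 't multiset"

definition right_comodule ::
  "('k::field, 'c::ab_group_add) coalg \<Rightarrow> ('k, 'm::ab_group_add, 'm \<times> 'c) comod \<Rightarrow> bool" where
  "right_comodule C M \<longleftrightarrow>
     is_vspace M \<and>
     tensor_lin_map M M C (coact M) \<and>
     (\<forall>m\<in>carrier M. tensor3_eq M C C
        (\<Sum>(m\<^sub>0, m\<^sub>1)\<in>#coact M m. image_mset (\<lambda>(u, v). (u, v, m\<^sub>1)) (coact M m\<^sub>0))
        (\<Sum>(m\<^sub>0, m\<^sub>1)\<in>#coact M m. image_mset (\<lambda>(u, v). (m\<^sub>0, u, v)) (comult C m\<^sub>1))) \<and>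
     (\<forall>m\<in>carrier M. (\<Sum>(m\<^sub>0, m\<^sub>1)\<in>#coact M m. smul M (counit C m\<^sub>1) m\<^sub>0) = m)"

definition left_comodule ::
  "('k::field, 'c::ab_group_add) coalg \<Rightarrow> ('k, 'm::ab_group_add, 'c \<times> 'm) comod \<Rightarrow> bool" where
  "left_comodule C M \<longleftrightarrow>
     is_vspace M \<and>
     tensor_lin_map M C M (coact M) \<and>
     (\<forall>m\<in>carrier M. tensor3_eq C C M
        (\<Sum>(m\<^sub>1, m\<^sub>0)\<in>#coact M m. image_mset (\<lambda>(u, v). (u, v, m\<^sub>0)) (comult C m\<^sub>1))
        (\<Sum>(m\<^sub>1, m\<^sub>0)\<in>#coact M m. image_mset (\<lambda>(u, v). (m\<^sub>1, u, v)) (coact M m\<^sub>0))) \<and>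
     (\<forall>m\<in>carrier M. (\<Sum>(m\<^sub>1, m\<^sub>0)\<in>#coact M m. smul M (counit C m\<^sub>1) m\<^sub>0) = m)"

definition right_comodule_hom ::
  "('k::field, 'c::ab_group_add) coalg \<Rightarrow> ('k, 'm::ab_group_add, 'm \<times> 'c) comod
    \<Rightarrow> ('k, 'n::ab_group_add, 'n \<times> 'c) comod \<Rightarrow> ('m \<Rightarrow> 'n) \<Rightarrow> bool" where
  "right_comodule_hom C M N f \<longleftrightarrow>
     lin_map M N f \<and>
     (\<forall>x\<in>carrier M. tensor_eq N C (image_mset (map_prod f id) (coact M x)) (coact N (f x)))"

definition left_comodule_hom ::
  "('k::field, 'c::ab_group_add) coalg \<Rightarrow> ('k, 'm::ab_group_add, 'c \<times> 'm) comod
    \<Rightarrow> ('k, 'n::ab_group_add, 'c \<times> 'n) comod \<Rightarrow> ('m \<Rightarrow> 'n) \<Rightarrow> bool" where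
  "left_comodule_hom C M N f \<longleftrightarrow>
     lin_map M N f \<and>
     (\<forall>x\<in>carrier M. tensor_eq C N (image_mset (map_prod id f) (coact M x)) (coact N (f x)))"

text \<open>
  The next notions serve left and right comodules alike: \<open>ob\<close> is the class of all left (right)
  comodules over a fixed coalgebra and \<open>hom\<close> are the corresponding morphisms.  A subcomodule is a
  comodule on a subset such that the inclusion is a morphism.
\<close>

definition subcomodule ::
  "(('k, 'm, 't) comod \<Rightarrow> bool) \<Rightarrow> (('k, 'm, 't) comod \<Rightarrow> ('k, 'm, 't) comod \<Rightarrow> ('m \<Rightarrow> 'm) \<Rightarrow> bool)
    \<Rightarrow> ('k, 'm, 't) comod \<Rightarrow> ('k, 'm, 't) comod \<Rightarrow> bool" where
  "subcomodule ob hom N M \<longleftrightarrow> ob N \<and> ob M \<and> carrier N \<subseteq> carrier M \<and> hom N M (\<lambda>x. x)"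

definition simple_comodule ::
  "(('k, 'm::zero, 't) comod \<Rightarrow> bool)
    \<Rightarrow> (('k, 'm, 't) comod \<Rightarrow> ('k, 'm, 't) comod \<Rightarrow> ('m \<Rightarrow> 'm) \<Rightarrow> bool)
    \<Rightarrow> ('k, 'm, 't) comod \<Rightarrow> bool" where
  "simple_comodule ob hom S \<longleftrightarrow>
     ob S \<and> carrier S \<noteq> {0} \<and>
     (\<forall>N. subcomodule ob hom N S \<longrightarrow> carrier N = {0} \<or> carrier N = carrier S)"

definition injective_comodule ::
  "(('k, 'm, 't) comod \<Rightarrow> bool) \<Rightarrow> (('k, 'm, 't) comod \<Rightarrow> ('k, 'm, 't) comod \<Rightarrow> ('m \<Rightarrow> 'm) \<Rightarrow> bool)
    \<Rightarrow> ('k, 'm, 't) comod \<Rightarrow> bool" where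
  "injective_comodule ob hom E \<longleftrightarrow>
     ob E \<and>
     (\<forall>X Y i f. ob X \<and> ob Y \<and> hom X Y i \<and> inj_on i (carrier X) \<and> hom X E f \<longrightarrow>
        (\<exists>g. hom Y E g \<and> (\<forall>x\<in>carrier X. g (i x) = f x)))"

definition injective_envelope ::
  "(('k, 'm::zero, 't) comod \<Rightarrow> bool)
    \<Rightarrow> (('k, 'm, 't) comod \<Rightarrow> ('k, 'm, 't) comod \<Rightarrow> ('m \<Rightarrow> 'm) \<Rightarrow> bool)
    \<Rightarrow> ('k, 'm, 't) comod \<Rightarrow> ('k, 'm, 't) comod \<Rightarrow> ('m \<Rightarrow> 'm) \<Rightarrow> bool" where
  "injective_envelope ob hom S E j \<longleftrightarrow>
     ob S \<and> injective_comodule ob hom E \<and> hom S E j \<and> inj_on j (carrier S) \<and>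
     (\<forall>N. subcomodule ob hom N E \<and> carrier N \<noteq> {0} \<longrightarrow> carrier N \<inter> j ` carrier S \<noteq> {0})"

text \<open>
  HOL cannot quantify over all types of carriers, so comodules are taken on subspaces of
  \<open>'c \<times> nat \<Rightarrow> 'k\<close>.  Up to isomorphism these include \<open>C\<close>, its subcomodules and
  all finite dimensional comodules.  This is no restriction: simple comodules are finite
  dimensional, their injective envelopes embed into \<open>C\<close>, and since comodules are locally finite,
  injectivity may be tested on finite dimensional comodules.
\<close>

definition left_semiperfect :: "('k::field, 'c::ab_group_add) coalg \<Rightarrow> bool" where
  "left_semiperfect C \<longleftrightarrow>
     (\<forall>S :: ('k, 'c \<times> nat \<Rightarrow> 'k, ('c \<times> nat \<Rightarrow> 'k) \<times> 'c) comod.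
        simple_comodule (right_comodule C) (right_comodule_hom C) S \<longrightarrow>
        (\<exists>E j. injective_envelope (right_comodule C) (right_comodule_hom C) S E j \<and> finite_dim E))"

definition right_semiperfect :: "('k::field, 'c::ab_group_add) coalg \<Rightarrow> bool" where
  "right_semiperfect C \<longleftrightarrow>
     (\<forall>S :: ('k, 'c \<times> nat \<Rightarrow> 'k, 'c \<times> ('c \<times> nat \<Rightarrow> 'k)) comod.
        simple_comodule (left_comodule C) (left_comodule_hom C) S \<longrightarrow>
        (\<exists>E j. injective_envelope (left_comodule C) (left_comodule_hom C) S E j \<and> finite_dim E))"

definition semiperfect :: "('k::field, 'c::ab_group_add) coalg \<Rightarrow> bool" where
  "semiperfect C \<longleftrightarrow> left_semiperfect C \<and> right_semiperfect C"


subsection \<open>Rational parts\<close>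

text \<open>
  In both definitions \<open>act f x\<close> is the action of \<open>f \<in> C\<^sup>*\<close> on \<open>x \<in> V\<close>, written \<open>f x\<close> for a left
  module and \<open>x f\<close> for a right module.
\<close>

definition rational_left_submodule ::
  "('k::field, 'c::ab_group_add) coalg \<Rightarrow> ('k, 'v::ab_group_add) vspace
    \<Rightarrow> (('c \<Rightarrow> 'k) \<Rightarrow> 'v \<Rightarrow> 'v) \<Rightarrow> 'v set \<Rightarrow> bool" where
  "rational_left_submodule C V act N \<longleftrightarrow>
     N \<subseteq> carrier V \<and> module.subspace (smul V) N \<and>
     (\<forall>f\<in>carrier (dual C). \<forall>x\<in>N. act f x \<in> N) \<and>
     (\<exists>\<rho>. right_comodule C \<lparr>carrier = N, smul = smul V, coact = \<rho>\<rparr> \<and>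
        (\<forall>f\<in>carrier (dual C). \<forall>x\<in>N. act f x = (\<Sum>(x\<^sub>0, x\<^sub>1)\<in>#\<rho> x. smul V (f x\<^sub>1) x\<^sub>0)))"

definition rational_right_submodule ::
  "('k::field, 'c::ab_group_add) coalg \<Rightarrow> ('k, 'v::ab_group_add) vspace
    \<Rightarrow> (('c \<Rightarrow> 'k) \<Rightarrow> 'v \<Rightarrow> 'v) \<Rightarrow> 'v set \<Rightarrow> bool" where
  "rational_right_submodule C V act N \<longleftrightarrow>
     N \<subseteq> carrier V \<and> module.subspace (smul V) N \<and>
     (\<forall>f\<in>carrier (dual C). \<forall>x\<in>N. act f x \<in> N) \<and>
     (\<exists>\<rho>. left_comodule C \<lparr>carrier = N, smul = smul V, coact = \<rho>\<rparr> \<and>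
        (\<forall>f\<in>carrier (dual C). \<forall>x\<in>N. act f x = (\<Sum>(x\<^sub>1, x\<^sub>0)\<in>#\<rho> x. smul V (f x\<^sub>1) x\<^sub>0)))"

definition left_rat_dual :: "('k::field, 'c::ab_group_add) coalg \<Rightarrow> ('c \<Rightarrow> 'k) set" where
  "left_rat_dual C = (GREATEST N. rational_left_submodule C (dual C) (\<lambda>f g. conv C f g) N)"

definition right_rat_dual :: "('k::field, 'c::ab_group_add) coalg \<Rightarrow> ('c \<Rightarrow> 'k) set" where
  "right_rat_dual C = (GREATEST N. rational_right_submodule C (dual C) (\<lambda>f g. conv C g f) N)"


subsection \<open>Bicomodules and trivial coextensions\<close>

record ('k, 'm, 'c) bicomod = "('k, 'm) vspace" +
  lcoact :: "'m \<Rightarrow> ('c \<times> 'm) multiset"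
  rcoact :: "'m \<Rightarrow> ('m \<times> 'c) multiset"

definition bicomodule ::
  "('k::field, 'c::ab_group_add) coalg \<Rightarrow> ('k, 'm::ab_group_add, 'c) bicomod \<Rightarrow> bool" where
  "bicomodule C M \<longleftrightarrow>
     left_comodule C \<lparr>carrier = carrier M, smul = smul M, coact = lcoact M\<rparr> \<and>
     right_comodule C \<lparr>carrier = carrier M, smul = smul M, coact = rcoact M\<rparr> \<and>
     (\<forall>m\<in>carrier M. tensor3_eq C M C
        (\<Sum>(m\<^sub>1, m\<^sub>0)\<in>#lcoact M m. image_mset (\<lambda>(u, v). (m\<^sub>1, u, v)) (rcoact M m\<^sub>0))
        (\<Sum>(m\<^sub>0, m\<^sub>1)\<in>#rcoact M m. image_mset (\<lambda>(u, v). (u, v, m\<^sub>1)) (lcoact M m\<^sub>0)))"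

text \<open>
  \<open>M\<close> is \<open>Rat(C\<^sup>*)\<close> with the induced bicomodule structure.  The coactions are determined as maps
  into the tensor products, but not their representatives.
\<close>

definition rat_bicomodule ::
  "('k::field, 'c::ab_group_add) coalg \<Rightarrow> ('k, 'c \<Rightarrow> 'k, 'c) bicomod \<Rightarrow> bool" where
  "rat_bicomodule C M \<longleftrightarrow>
     bicomodule C M \<and>
     carrier M = left_rat_dual C \<and> carrier M = right_rat_dual C \<and> smul M = smul (dual C) \<and>
     (\<forall>f\<in>carrier (dual C). \<forall>m\<in>carrier M.
        conv C f m = (\<Sum>(m\<^sub>0, m\<^sub>1)\<in>#rcoact M m. smul M (f m\<^sub>1) m\<^sub>0) \<and>
        conv C m f = (\<Sum>(m\<^sub>1, m\<^sub>0)\<in>#lcoact M m. smul M (f m\<^sub>1) m\<^sub>0))"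

definition trivial_coextension ::
  "('k::field, 'c::ab_group_add) coalg \<Rightarrow> ('k, 'm::ab_group_add, 'c) bicomod
    \<Rightarrow> ('k, 'c \<times> 'm) coalg" where
  "trivial_coextension C M = \<lparr>
     carrier = carrier C \<times> carrier M,
     smul = (\<lambda>a (c, m). (smul C a c, smul M a m)),
     comult = (\<lambda>(c, m).
       image_mset (\<lambda>(c\<^sub>1, c\<^sub>2). ((c\<^sub>1, 0), (c\<^sub>2, 0))) (comult C c) +
       image_mset (\<lambda>(m\<^sub>1, m\<^sub>0). ((m\<^sub>1, 0), (0, m\<^sub>0))) (lcoact M m) +
       image_mset (\<lambda>(m\<^sub>0, m\<^sub>1). ((0, m\<^sub>0), (m\<^sub>1, 0))) (rcoact M m)),
     counit = (\<lambda>(c, m). counit C c)\<rparr>"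

end

theory Submission
  imports Defs
begin

text \<open>
  On \<open>D = C \<oplus> Rat(C\<^sup>*)\<close> there is an obvious symmetric bilinear form,
  \<open>(c, m), (c', m') \<mapsto> m'(c) + m(c')\<close>, and the corresponding map \<open>D \<rightarrow> D\<^sup>*\<close> is a morphism of bimodules by a
  direct computation (\<open>symmetric_trivial_coextension\<close>).  It is injective exactly when only \<open>0\<close> is
  killed by all rational functionals.  So the theorem rests on two properties of a semiperfect
  coalgebra: its rational functionals separate points, and the left and the right rational part of
  \<open>C\<^sup>*\<close> coincide, so that \<open>Rat(C\<^sup>*)\<close> is a bicomodule.

  Write \<open>f\<rightharpoonup>x = \<Sum> f(x\<^sub>2) x\<^sub>1\<close>.  A functional \<open>f\<close> is in the left rational part iff \<open>f\<rightharpoonup>C\<close> is finite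
  dimensional, and then \<open>g * f\<close> only depends on the values of \<open>g\<close> on \<open>f\<rightharpoonup>C\<close> (\<open>left_rat_dual_eq\<close>,
  \<open>left_rat_expand\<close>); the right rational part is described symmetrically.

  Separation (\<open>left_semiperfect_separates\<close>): the points that all functionals of the right rational
  part kill form a right subcomodule \<open>J\<close> of \<open>C\<close>.  If \<open>J\<close> were nonzero, it would contain a simple
  comodule \<open>S\<close>.  Its injective envelope \<open>S \<rightarrow> E\<close> extends to a morphism \<open>g : C \<rightarrow> E\<close>.  As \<open>E\<close> is finite
  dimensional, the functionals \<open>p \<circ> g\<close> with \<open>p \<in> E\<^sup>*\<close> are rational, and one of them does not vanish
  on \<open>S\<close>, a contradiction.

  Coincidence (\<open>left_rat_subset_cop\<close>): let \<open>f\<close> be in the left rational part.  By separation some \<open>g\<close> in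
  the right rational part agrees with the counit on the finite dimensional space \<open>f\<rightharpoonup>C\<close>.  Then
  \<open>f = \<epsilon> * f = g * f\<close>, and this is in the right rational part, which is a right ideal of \<open>C\<^sup>*\<close>.

  Two devices keep the computations short.  Over a field, tensors are equal iff all functionals agree
  on them, so each identity between coactions becomes an identity between actions of \<open>C\<^sup>*\<close>.  The
  co-opposite coalgebra exchanges left and right, so each argument is made on one side only.
\<close>

section \<open>Linear functionals and coordinates\<close>

lemma vspace_vector_space: "is_vspace V \<Longrightarrow> vector_space (smul V)"
  by (simp add: is_vspace_def)

lemma vspace_module: "is_vspace V \<Longrightarrow> module (smul V)"
  by (simp add: is_vspace_def module_iff_vector_space)

lemma vspace_subspace: "is_vspace V \<Longrightarrow> module.subspace (smul V) (carrier V)"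
  by (simp add: is_vspace_def)

lemmas smul_simps =
  module.scale_zero_left[OF vspace_module] module.scale_zero_right[OF vspace_module]
  module.scale_right_distrib[OF vspace_module] module.scale_left_distrib[OF vspace_module]
  module.scale_scale[OF vspace_module] module.scale_one[OF vspace_module]

lemma carrier_zero: "is_vspace V \<Longrightarrow> 0 \<in> carrier V"
  and carrier_add: "is_vspace V \<Longrightarrow> x \<in> carrier V \<Longrightarrow> y \<in> carrier V \<Longrightarrow> x + y \<in> carrier V"
  and carrier_smul: "is_vspace V \<Longrightarrow> x \<in> carrier V \<Longrightarrow> smul V a x \<in> carrier V"
  by (simp_all add: module.subspace_0[OF vspace_module vspace_subspace]
      module.subspace_add[OF vspace_module vspace_subspace]
      module.subspace_scale[OF vspace_module vspace_subspace])

lemma carrier_diff: "is_vspace V \<Longrightarrow> x \<in> carrier V \<Longrightarrow> y \<in> carrier V \<Longrightarrow> x - y \<in> carrier V"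
  by (rule module.subspace_diff[OF vspace_module vspace_subspace])

lemma carrier_sum:
  "is_vspace V \<Longrightarrow> (\<And>i. i \<in> I \<Longrightarrow> f i \<in> carrier V) \<Longrightarrow> sum f I \<in> carrier V"
  by (rule module.subspace_sum[OF vspace_module vspace_subspace])

lemma carrier_sum_mset:
  "is_vspace V \<Longrightarrow> (\<And>i. i \<in># A \<Longrightarrow> f i \<in> carrier V) \<Longrightarrow> (\<Sum>i\<in>#A. f i) \<in> carrier V"
  by (induction A) (auto simp: carrier_zero carrier_add)

text \<open>
  In contrast to the elements of \<open>dual V\<close>, a functional is arbitrary outside the carrier, as the
  counit of a coalgebra is.
\<close>

definition functional ::
  "('k::field, 'v::ab_group_add, 'x) vspace_scheme \<Rightarrow> ('v \<Rightarrow> 'k) \<Rightarrow> bool" where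
  "functional V f \<longleftrightarrow>
     (\<forall>x\<in>carrier V. \<forall>y\<in>carrier V. f (x + y) = f x + f y) \<and>
     (\<forall>a. \<forall>x\<in>carrier V. f (smul V a x) = a * f x)"

lemma dual_iff: "f \<in> carrier (dual V) \<longleftrightarrow> functional V f \<and> (\<forall>x. x \<notin> carrier V \<longrightarrow> f x = 0)"
  by (auto simp: dual_def functional_def)

lemma dual_functional: "f \<in> carrier (dual V) \<Longrightarrow> functional V f"
  by (simp add: dual_iff)

lemma functional_restrict:
  "is_vspace V \<Longrightarrow> functional V f \<Longrightarrow> (\<lambda>x. if x \<in> carrier V then f x else 0) \<in> carrier (dual V)"
  by (simp add: dual_iff functional_def carrier_add carrier_smul)

lemma functional_add:
    "functional V f \<Longrightarrow> x \<in> carrier V \<Longrightarrow> y \<in> carrier V \<Longrightarrow> f (x + y) = f x + f y"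
  and functional_smul: "functional V f \<Longrightarrow> x \<in> carrier V \<Longrightarrow> f (smul V a x) = a * f x"
  by (auto simp: functional_def)

lemma functional_zero: "is_vspace V \<Longrightarrow> functional V f \<Longrightarrow> f 0 = 0"
  using functional_smul[of V f 0 0] by (simp add: smul_simps carrier_zero)

lemma functional_diff:
  assumes "is_vspace V" "functional V f" "x \<in> carrier V" "y \<in> carrier V"
  shows "f (x - y) = f x - f y"
  using functional_add[OF assms(2), of "x - y" y] assms by (simp add: carrier_diff)

lemma functional_sum:
  assumes "is_vspace V" "functional V f" "\<And>i. i \<in> I \<Longrightarrow> g i \<in> carrier V"
  shows "f (sum g I) = (\<Sum>i\<in>I. f (g i))"
  using assms(3)
  by (induction I rule: infinite_finite_induct)
     (auto simp: functional_zero[OF assms(1,2)] functional_add[OF assms(2)] carrier_sum[OF assms(1)])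

lemma dual_vspace:
  assumes "is_vspace V"
  shows "is_vspace (dual V)"
proof -
  have vs: "vector_space (smul (dual V))"
    by unfold_locales (auto simp: dual_def algebra_simps)
  then have "module (smul (dual V))"
    by (simp add: module_iff_vector_space)
  then show ?thesis
    using vs by (auto simp: is_vspace_def module.subspace_def dual_def algebra_simps)
qed

lemma smul_dual: "smul (dual V) a f x = a * f x"
  by (simp add: dual_def)

definition basis :: "('k::field, 'v::ab_group_add, 'x) vspace_scheme \<Rightarrow> 'v set" where
  "basis V = (SOME B. B \<subseteq> carrier V \<and> \<not> module.dependent (smul V) B \<and>
                      module.span (smul V) B = carrier V)"

lemma
  assumes "is_vspace V"
  shows basis_carrier: "basis V \<subseteq> carrier V"
    and basis_independent: "\<not> module.dependent (smul V) (basis V)"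
    and basis_span: "module.span (smul V) (basis V) = carrier V"
proof -
  interpret vector_space "smul V" by (rule vspace_vector_space[OF assms])
  obtain B where "B \<subseteq> carrier V" "independent B" "carrier V \<subseteq> span B"
    by (rule maximal_independent_subset)
  then have "B \<subseteq> carrier V \<and> independent B \<and> span B = carrier V"
    using span_minimal[OF _ vspace_subspace[OF assms]] by auto
  then have *: "basis V \<subseteq> carrier V \<and> independent (basis V) \<and> span (basis V) = carrier V"
    unfolding basis_def by (rule someI)
  then show "basis V \<subseteq> carrier V" "\<not> dependent (basis V)" "span (basis V) = carrier V"
    by auto
qed

text \<open>
  Coordinates vanish outside the carrier because they are to be elements of the dual space.
\<close>

definition coord ::
  "('k::field, 'v::ab_group_add, 'x) vspace_scheme \<Rightarrow> 'v \<Rightarrow> 'v \<Rightarrow> 'k" where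
  "coord V b x = (if x \<in> carrier V then module.representation (smul V) (basis V) x b else 0)"

context
  fixes V :: "('k::field, 'v::ab_group_add, 'x) vspace_scheme"
  assumes V: "is_vspace V"
begin

interpretation vector_space "smul V" by (rule vspace_vector_space[OF V])

lemma coord_dual: "coord V b \<in> carrier (dual V)"
  by (auto simp: dual_iff functional_def coord_def basis_independent[OF V] basis_span[OF V]
      representation_add representation_scale carrier_add[OF V] carrier_smul[OF V])

lemma coord_functional: "functional V (coord V b)"
  by (rule dual_functional[OF coord_dual])

lemma coord_nonzero: "coord V b x \<noteq> 0 \<Longrightarrow> b \<in> basis V"
  using representation_ne_zero by (auto simp: coord_def split: if_splits)

lemma coord_finite: "finite {b. coord V b x \<noteq> 0}"
  using finite_representation by (auto simp: coord_def)

lemma coord_sum: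
  assumes "x \<in> carrier V" "finite F" "{b. coord V b x \<noteq> 0} \<subseteq> F"
  shows "(\<Sum>b\<in>F. smul V (coord V b x) b) = x"
proof -
  have "x = (\<Sum>b | coord V b x \<noteq> 0. smul V (coord V b x) b)"
    using assms(1) sum_nonzero_representation_eq[OF basis_independent[OF V], of x]
    by (simp add: coord_def basis_span[OF V])
  also have "\<dots> = (\<Sum>b\<in>F. smul V (coord V b x) b)"
    using assms(2,3) by (intro sum.mono_neutral_left) auto
  finally show ?thesis by simp
qed

lemma coord_separates:
  assumes "x \<in> carrier V" "y \<in> carrier V" "\<And>f. f \<in> carrier (dual V) \<Longrightarrow> f x = f y"
  shows "x = y"
proof -
  have eq: "coord V b x = coord V b y" for b
    by (rule assms(3)[OF coord_dual])
  have "x = (\<Sum>b | coord V b x \<noteq> 0. smul V (coord V b x) b)"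
    by (rule coord_sum[OF assms(1) coord_finite order_refl, symmetric])
  also have "\<dots> = (\<Sum>b | coord V b y \<noteq> 0. smul V (coord V b y) b)"
    unfolding eq ..
  also have "\<dots> = y"
    by (rule coord_sum[OF assms(2) coord_finite order_refl])
  finally show ?thesis .
qed

lemma functional_coord_sum:
  assumes "functional V f" "x \<in> carrier V" "finite F" "{b. coord V b x \<noteq> 0} \<subseteq> F" "F \<subseteq> carrier V"
  shows "f x = (\<Sum>b\<in>F. coord V b x * f b)"
proof -
  have "f x = f (\<Sum>b\<in>F. smul V (coord V b x) b)"
    using coord_sum[OF assms(2-4)] by simp
  also have "\<dots> = (\<Sum>b\<in>F. coord V b x * f b)"
    using assms(1,5)
    by (subst functional_sum[OF V assms(1)]) (auto simp: functional_smul carrier_smul[OF V] subset_iff)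
  finally show ?thesis .
qed

end

section \<open>Equality of tensors by functionals\<close>

text \<open>
  The contraction \<open>V \<otimes> W \<rightarrow> V\<close> by a functional on \<open>W\<close>.  The actions of \<open>C\<^sup>*\<close> on coalgebras and on
  comodules are contractions of \<open>\<Delta> x\<close> and of coactions.
\<close>

definition contr ::
  "('k, 'v::ab_group_add, 'x) vspace_scheme \<Rightarrow> ('w \<Rightarrow> 'k) \<Rightarrow> ('v \<times> 'w) multiset \<Rightarrow> 'v" where
  "contr V f s = (\<Sum>(v, w)\<in>#s. smul V (f w) v)"

lemma contr_empty [simp]: "contr V f {#} = 0"
  and contr_add_mset [simp]: "contr V f (add_mset (v, w) s) = smul V (f w) v + contr V f s"
  and contr_plus [simp]: "contr V f (s + t) = contr V f s + contr V f t"
  by (simp_all add: contr_def)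

lemma contr_carrier: "is_vspace V \<Longrightarrow> set_mset s \<subseteq> carrier V \<times> X \<Longrightarrow> contr V f s \<in> carrier V"
  unfolding contr_def by (intro carrier_sum_mset) (auto simp: carrier_smul)

lemma contr_cong:
  "(\<And>v w. (v, w) \<in># s \<Longrightarrow> f w = g w) \<Longrightarrow> contr V f s = contr V g s"
  unfolding contr_def by (intro arg_cong[where f = sum_mset] image_mset_cong) auto

lemma tensor_eq_contr:
  assumes V: "is_vspace V" and f: "functional W f" and "tensor_eq V W s t"
  shows "contr V f s = contr V f t"
  using assms(3)
  by induction (auto simp: smul_simps[OF V] functional_add[OF f] functional_smul[OF f] mult.commute)

definition pair2 :: "('v \<Rightarrow> 'k::comm_ring_1) \<Rightarrow> ('w \<Rightarrow> 'k) \<Rightarrow> ('v \<times> 'w) multiset \<Rightarrow> 'k" where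
  "pair2 f g s = (\<Sum>(v, w)\<in>#s. f v * g w)"

lemma pair2_plus [simp]: "pair2 f g (s + t) = pair2 f g s + pair2 f g t"
  by (simp add: pair2_def)

lemma pair2_swap: "pair2 f g (image_mset prod.swap s) = pair2 g f s"
  by (induction s) (auto simp: pair2_def mult.commute)

lemma functional_contr:
  assumes "is_vspace V" "functional V e" "set_mset s \<subseteq> carrier V \<times> X"
  shows "e (contr V f s) = pair2 e f s"
  using assms(3)
  by (induction s) (auto simp: pair2_def functional_zero[OF assms(1,2)] functional_add[OF assms(2)]
      functional_smul[OF assms(2)] carrier_smul[OF assms(1)] contr_carrier[OF assms(1)] mult.commute)

lemma tensor_eq_add:
  assumes "tensor_eq V W s t" "tensor_eq V W s' t'"
  shows "tensor_eq V W (s + s') (t + t')"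
proof -
  have "tensor_eq V W (s + s') (t + s')" "tensor_eq V W (s' + t) (t' + t)"
    using assms by (auto intro: tensor_eq.plus)
  then show ?thesis
    by (metis tensor_eq.trans add.commute)
qed

lemma tensor_eq_sum_mset:
  assumes "\<And>x. x \<in># A \<Longrightarrow> tensor_eq V W (f x) (g x)"
  shows "tensor_eq V W (\<Sum>x\<in>#A. f x) (\<Sum>x\<in>#A. g x)"
  using assms by (induction A) (auto intro: tensor_eq.refl tensor_eq_add)

lemma tensor3_eq_add:
  assumes "tensor3_eq U V W s t" "tensor3_eq U V W s' t'"
  shows "tensor3_eq U V W (s + s') (t + t')"
proof -
  have "tensor3_eq U V W (s + s') (t + s')" "tensor3_eq U V W (s' + t) (t' + t)"
    using assms by (auto intro: tensor3_eq.plus)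
  then show ?thesis
    by (metis tensor3_eq.trans add.commute)
qed

lemma tensor3_eq_sum_mset:
  assumes "\<And>x. x \<in># A \<Longrightarrow> tensor3_eq U V W (f x) (g x)"
  shows "tensor3_eq U V W (\<Sum>x\<in>#A. f x) (\<Sum>x\<in>#A. g x)"
  using assms by (induction A) (auto intro: tensor3_eq.refl tensor3_eq_add)

lemma tensor_eq_sum_right:
  assumes "is_vspace V" "is_vspace W" "v \<in> carrier V" "finite F" "F \<subseteq> carrier W"
  shows "tensor_eq V W {#(v, \<Sum>b\<in>F. smul W (c b) b)#}
           (image_mset (\<lambda>b. (smul V (c b) v, b)) (mset_set F))"
  using assms(4,5)
proof (induction F)
  case empty
  have "tensor_eq V W {#(smul V 0 v, 0)#} {#(v, smul W 0 0)#}"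
    by (intro tensor_eq.smul carrier_zero assms)
  from tensor_eq.trans[OF tensor_eq.sym[OF this]] tensor_eq.zero[of 0 W V] assms
  show ?case
    by (simp add: smul_simps carrier_zero)
next
  case (insert b F)
  have "tensor_eq V W {#(v, smul W (c b) b + (\<Sum>b\<in>F. smul W (c b) b))#}
          {#(v, smul W (c b) b), (v, \<Sum>b\<in>F. smul W (c b) b)#}"
    using insert.prems assms by (intro tensor_eq.add_right carrier_sum carrier_smul) auto
  moreover have "tensor_eq V W ({#(v, smul W (c b) b)#} + {#(v, \<Sum>b\<in>F. smul W (c b) b)#})
     ({#(smul V (c b) v, b)#} + image_mset (\<lambda>b. (smul V (c b) v, b)) (mset_set F))"
    using insert assms by (intro tensor_eq_add tensor_eq.smul[THEN tensor_eq.sym]) auto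
  ultimately show ?case
    using insert.hyps by (auto intro: tensor_eq.trans simp: add_mset_commute)
qed

lemma tensor_eq_merge:
  assumes "finite F" "F \<subseteq> carrier W" "\<And>b. b \<in> F \<Longrightarrow> p b \<in> carrier V" "\<And>b. b \<in> F \<Longrightarrow> q b \<in> carrier V"
  shows "tensor_eq V W (image_mset (\<lambda>b. (p b, b)) (mset_set F) + image_mset (\<lambda>b. (q b, b)) (mset_set F))
           (image_mset (\<lambda>b. (p b + q b, b)) (mset_set F))"
proof -
  have "tensor_eq V W (\<Sum>b\<in>#mset_set F. {#(p b, b), (q b, b)#}) (\<Sum>b\<in>#mset_set F. {#(p b + q b, b)#})"
    using assms by (intro tensor_eq_sum_mset tensor_eq.add_left[THEN tensor_eq.sym]) auto
  moreover have "(\<Sum>b\<in>#mset_set F. {#(p b, b), (q b, b)#}) =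
     image_mset (\<lambda>b. (p b, b)) (mset_set F) + image_mset (\<lambda>b. (q b, b)) (mset_set F)"
    by (induction F rule: infinite_finite_induct) auto
  moreover have "(\<Sum>b\<in>#mset_set F. {#(p b + q b, b)#}) = image_mset (\<lambda>b. (p b + q b, b)) (mset_set F)"
    by simp
  ultimately show ?thesis by simp
qed

text \<open>
  Expanding the second components in a basis of \<open>W\<close> brings a tensor into the form
  \<open>\<Sum>\<^sub>b v\<^sub>b \<otimes> b\<close>, whose coefficients are contractions.
\<close>

lemma tensor_eq_normal_form:
  assumes V: "is_vspace V" and W: "is_vspace W" and s: "set_mset s \<subseteq> carrier V \<times> carrier W"
    and F: "finite F" "F \<subseteq> carrier W" "\<And>v w b. (v, w) \<in># s \<Longrightarrow> coord W b w \<noteq> 0 \<Longrightarrow> b \<in> F"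
  shows "tensor_eq V W s (image_mset (\<lambda>b. (contr V (coord W b) s, b)) (mset_set F))"
  using s F(3)
proof (induction s)
  case empty
  have "tensor_eq V W (\<Sum>b\<in>#mset_set F. {#(0, b)#}) (\<Sum>b\<in>#mset_set F. {#})"
    using F by (intro tensor_eq_sum_mset tensor_eq.zero) auto
  then show ?case by (auto intro: tensor_eq.sym)
next
  case (add x s)
  obtain v w where x: "x = (v, w)" by force
  have vw: "v \<in> carrier V" "w \<in> carrier W" using add.prems x by auto
  have sF: "set_mset s \<subseteq> carrier V \<times> carrier W" using add.prems by auto
  have "w = (\<Sum>b\<in>F. smul W (coord W b w) b)"
    using F(1) vw(2) add.prems(2) x by (intro coord_sum[OF W, symmetric]) auto
  then have "tensor_eq V W {#(v, w)#} (image_mset (\<lambda>b. (smul V (coord W b w) v, b)) (mset_set F))"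
    using tensor_eq_sum_right[OF V W vw(1) F(1,2), of "\<lambda>b. coord W b w"] by simp
  moreover have "tensor_eq V W s (image_mset (\<lambda>b. (contr V (coord W b) s, b)) (mset_set F))"
    using add.prems by (intro add.IH) auto
  ultimately have "tensor_eq V W ({#(v, w)#} + s)
      (image_mset (\<lambda>b. (smul V (coord W b w) v, b)) (mset_set F) +
       image_mset (\<lambda>b. (contr V (coord W b) s, b)) (mset_set F))"
    by (rule tensor_eq_add)
  moreover have "tensor_eq V W \<dots>
      (image_mset (\<lambda>b. (smul V (coord W b w) v + contr V (coord W b) s, b)) (mset_set F))"
    using vw sF by (intro tensor_eq_merge F carrier_smul[OF V] contr_carrier[OF V])
  ultimately show ?case
    by (auto simp: x intro: tensor_eq.trans)
qed

text \<open>
  Equal contractions give equal normal forms, taken over a common finite set of basis elements.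
\<close>

lemma tensor_eqI:
  assumes V: "is_vspace V" and W: "is_vspace W"
    and s: "set_mset s \<subseteq> carrier V \<times> carrier W" and t: "set_mset t \<subseteq> carrier V \<times> carrier W"
    and eq: "\<And>f. f \<in> carrier (dual W) \<Longrightarrow> contr V f s = contr V f t"
  shows "tensor_eq V W s t"
proof -
  define F where "F = (\<Union>x\<in>set_mset (s + t). {b. coord W b (snd x) \<noteq> 0})"
  have F: "finite F" "F \<subseteq> carrier W"
    using coord_finite[OF W] coord_nonzero[OF W] basis_carrier[OF W] by (auto simp: F_def)
  have "tensor_eq V W s (image_mset (\<lambda>b. (contr V (coord W b) s, b)) (mset_set F))"
    by (intro tensor_eq_normal_form V W s F) (force simp: F_def)
  moreover have "tensor_eq V W t (image_mset (\<lambda>b. (contr V (coord W b) t, b)) (mset_set F))"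
    by (intro tensor_eq_normal_form V W t F) (force simp: F_def)
  ultimately show ?thesis
    using eq[OF coord_dual[OF W]] by (auto intro: tensor_eq.trans tensor_eq.sym)
qed

lemma tensor_eq_pair2:
  assumes "is_vspace V" "functional V f" "functional W g" "tensor_eq V W s t"
  shows "pair2 f g s = pair2 f g t"
  using assms(4)
  by induction (auto simp: pair2_def functional_zero[OF assms(1,2)] functional_add[OF assms(2)]
      functional_add[OF assms(3)] functional_smul[OF assms(2)] functional_smul[OF assms(3)] algebra_simps)

lemma tensor_eqI_pair2:
  assumes V: "is_vspace V" and W: "is_vspace W"
    and s: "set_mset s \<subseteq> carrier V \<times> carrier W" and t: "set_mset t \<subseteq> carrier V \<times> carrier W"
    and eq: "\<And>f g. f \<in> carrier (dual V) \<Longrightarrow> g \<in> carrier (dual W) \<Longrightarrow> pair2 f g s = pair2 f g t"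
  shows "tensor_eq V W s t"
proof (rule tensor_eqI[OF V W s t])
  fix g assume "g \<in> carrier (dual W)"
  then show "contr V g s = contr V g t"
    using eq functional_contr[OF V dual_functional s] functional_contr[OF V dual_functional t]
    by (intro coord_separates[OF V] contr_carrier[OF V s] contr_carrier[OF V t]) simp
qed

definition pair3 ::
  "('u \<Rightarrow> 'k::comm_ring_1) \<Rightarrow> ('v \<Rightarrow> 'k) \<Rightarrow> ('w \<Rightarrow> 'k) \<Rightarrow> ('u \<times> 'v \<times> 'w) multiset \<Rightarrow> 'k" where
  "pair3 e f g s = (\<Sum>(u, v, w)\<in>#s. e u * f v * g w)"

lemma pair3_plus [simp]: "pair3 e f g (s + t) = pair3 e f g s + pair3 e f g t"
  by (simp add: pair3_def)

lemma tensor3_eq_pair3: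
  assumes "is_vspace U" "functional U e" "functional V f" "functional W g" "tensor3_eq U V W s t"
  shows "pair3 e f g s = pair3 e f g t"
  using assms(5)
  by induction (auto simp: pair3_def functional_zero[OF assms(1,2)] functional_add[OF assms(2)]
      functional_add[OF assms(3)] functional_add[OF assms(4)] functional_smul[OF assms(2)]
      functional_smul[OF assms(3)] functional_smul[OF assms(4)] algebra_simps)

lemma tensor3_eq_insert_left:
  assumes "is_vspace U" "is_vspace V" "u \<in> carrier U" "tensor_eq V W s t"
  shows "tensor3_eq U V W (image_mset (\<lambda>(v, w). (u, v, w)) s) (image_mset (\<lambda>(v, w). (u, v, w)) t)"
  using assms(4)
proof induction
  case (zero w)
  have "tensor3_eq U V W {#(smul U 0 u, 0, w)#} {#(u, smul V 0 0, w)#}"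
    using zero assms by (intro tensor3_eq.smul_12) (auto simp: carrier_zero)
  then show ?case
    using tensor3_eq.trans[OF tensor3_eq.sym tensor3_eq.zero[of 0 V w W U]] zero assms
    by (simp add: smul_simps carrier_zero)
qed (auto intro: tensor3_eq.intros assms(3))

lemma tensor3_eq_insert_right:
  assumes "w \<in> carrier W" "tensor_eq U V s t"
  shows "tensor3_eq U V W (image_mset (\<lambda>(u, v). (u, v, w)) s) (image_mset (\<lambda>(u, v). (u, v, w)) t)"
  using assms(2) by induction (auto intro: tensor3_eq.intros assms(1))

text \<open>
  The third components are expanded in a basis, and the resulting scalars are moved to the first
  components, so that each summand is a tensor in \<open>U \<otimes> V\<close> with a fixed basis element appended.
\<close>

lemma tensor3_eq_normal_form:
  assumes U: "is_vspace U" and V: "is_vspace V" and W: "is_vspace W"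
    and s: "set_mset s \<subseteq> carrier U \<times> carrier V \<times> carrier W"
    and F: "finite F" "F \<subseteq> carrier W" "\<And>u v w b. (u, v, w) \<in># s \<Longrightarrow> coord W b w \<noteq> 0 \<Longrightarrow> b \<in> F"
  shows "tensor3_eq U V W s (\<Sum>b\<in>#mset_set F. image_mset (\<lambda>(u, v). (u, v, b))
           (image_mset (\<lambda>(u, v, w). (smul U (coord W b w) u, v)) s))"
proof -
  have single: "tensor3_eq U V W {#x#}
      (case x of (u, v, w) \<Rightarrow> image_mset (\<lambda>b. (smul U (coord W b w) u, v, b)) (mset_set F))"
    if x: "x \<in># s" for x
  proof -
    obtain u v w where [simp]: "x = (u, v, w)" by (cases x)
    have uvw: "u \<in> carrier U" "v \<in> carrier V" "w \<in> carrier W" using s x by auto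
    have "w = (\<Sum>b\<in>F. smul W (coord W b w) b)"
      using F(1) uvw(3) F(3) x by (intro coord_sum[OF W, symmetric]) auto
    then have "tensor_eq V W {#(v, w)#} (image_mset (\<lambda>b. (smul V (coord W b w) v, b)) (mset_set F))"
      using tensor_eq_sum_right[OF V W uvw(2) F(1,2), of "\<lambda>b. coord W b w"] by simp
    from tensor3_eq_insert_left[OF U V uvw(1) this]
    have "tensor3_eq U V W {#(u, v, w)#} (\<Sum>b\<in>#mset_set F. {#(u, smul V (coord W b w) v, b)#})"
      by (simp add: image_mset.compositionality comp_def)
    moreover have "tensor3_eq U V W (\<Sum>b\<in>#mset_set F. {#(u, smul V (coord W b w) v, b)#})
        (\<Sum>b\<in>#mset_set F. {#(smul U (coord W b w) u, v, b)#})"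
      using uvw F(1,2) by (intro tensor3_eq_sum_mset tensor3_eq.smul_12[THEN tensor3_eq.sym]) auto
    ultimately show ?thesis
      by (auto intro: tensor3_eq.trans)
  qed
  have "tensor3_eq U V W (\<Sum>x\<in>#s. {#x#})
     (\<Sum>(u, v, w)\<in>#s. image_mset (\<lambda>b. (smul U (coord W b w) u, v, b)) (mset_set F))"
    by (rule tensor3_eq_sum_mset[OF single])
  moreover have "(\<Sum>(u, v, w)\<in>#s. image_mset (\<lambda>b. (smul U (coord W b w) u, v, b)) (mset_set F)) =
     (\<Sum>b\<in>#mset_set F. image_mset (\<lambda>(u, v). (u, v, b))
           (image_mset (\<lambda>(u, v, w). (smul U (coord W b w) u, v)) s))"
  proof (induction s)
    case (add x s)
    have "image_mset h A + (\<Sum>b\<in>#A. k b) = (\<Sum>b\<in>#A. add_mset (h b) (k b))"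
      for h :: "'f \<Rightarrow> 'b \<times> 'd \<times> 'f" and k and A
      by (induction A) auto
    with add show ?case
      by (cases x) simp
  qed simp
  ultimately show ?thesis by simp
qed

text \<open>
  By the normal form it suffices to compare, for each basis element \<open>b\<close> of \<open>W\<close>, the two coefficients
  of \<open>b\<close> in \<open>U \<otimes> V\<close>, and these are determined by pairings with two functionals.
\<close>

lemma tensor3_eqI:
  assumes U: "is_vspace U" and V: "is_vspace V" and W: "is_vspace W"
    and s: "set_mset s \<subseteq> carrier U \<times> carrier V \<times> carrier W"
    and t: "set_mset t \<subseteq> carrier U \<times> carrier V \<times> carrier W"
    and eq: "\<And>e f g. e \<in> carrier (dual U) \<Longrightarrow> f \<in> carrier (dual V) \<Longrightarrow> g \<in> carrier (dual W) \<Longrightarrow>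
               pair3 e f g s = pair3 e f g t"
  shows "tensor3_eq U V W s t"
proof -
  define F where "F = (\<Union>x\<in>set_mset (s + t). {b. coord W b (snd (snd x)) \<noteq> 0})"
  have F: "finite F" "F \<subseteq> carrier W"
    using coord_finite[OF W] coord_nonzero[OF W] basis_carrier[OF W] by (auto simp: F_def)
  define slice where "slice r b = image_mset (\<lambda>(u, v, w). (smul U (coord W b w) u, v)) r"
    for r :: "('b \<times> 'd \<times> 'f) multiset" and b
  have pair_slice: "pair2 e f (slice r b) = pair3 e f (coord W b) r"
    if "functional U e" "set_mset r \<subseteq> carrier U \<times> carrier V \<times> carrier W" for e f r b
    using that(2)
    by (induction r) (auto simp: slice_def pair2_def pair3_def functional_smul[OF that(1)] algebra_simps)
  have slice_carrier: "set_mset (slice r b) \<subseteq> carrier U \<times> carrier V"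
    if "set_mset r \<subseteq> carrier U \<times> carrier V \<times> carrier W" for r b
    using that by (auto simp: slice_def carrier_smul[OF U])
  have "tensor_eq U V (slice s b) (slice t b)" for b
    using eq coord_dual[OF W] pair_slice[OF dual_functional] s t
    by (intro tensor_eqI_pair2 U V slice_carrier) auto
  then have "tensor3_eq U V W (\<Sum>b\<in>#mset_set F. image_mset (\<lambda>(u, v). (u, v, b)) (slice s b))
      (\<Sum>b\<in>#mset_set F. image_mset (\<lambda>(u, v). (u, v, b)) (slice t b))"
    using F by (intro tensor3_eq_sum_mset tensor3_eq_insert_right) auto
  moreover have "tensor3_eq U V W s (\<Sum>b\<in>#mset_set F. image_mset (\<lambda>(u, v). (u, v, b)) (slice s b))"
    unfolding slice_def by (intro tensor3_eq_normal_form U V W s F) (force simp: F_def)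
  moreover have "tensor3_eq U V W t (\<Sum>b\<in>#mset_set F. image_mset (\<lambda>(u, v). (u, v, b)) (slice t b))"
    unfolding slice_def by (intro tensor3_eq_normal_form U V W t F) (force simp: F_def)
  ultimately show ?thesis
    by (meson tensor3_eq.trans tensor3_eq.sym)
qed

lemma pair3_left:
  "pair3 e f g (\<Sum>(x, y)\<in>#s. image_mset (\<lambda>(u, v). (u, v, y)) (\<delta> x)) =
   (\<Sum>(x, y)\<in>#s. pair2 e f (\<delta> x) * g y)"
proof -
  have "pair3 e f g (image_mset (\<lambda>(u, v). (u, v, y)) t) = pair2 e f t * g y" for y t
    by (induction t) (auto simp: pair3_def pair2_def algebra_simps)
  then show ?thesis
    by (induction s) (auto simp: pair3_def[of e f g "{#}"])
qed

lemma pair3_right: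
  "pair3 e f g (\<Sum>(x, y)\<in>#s. image_mset (\<lambda>(u, v). (x, u, v)) (\<delta> y)) =
   (\<Sum>(x, y)\<in>#s. e x * pair2 f g (\<delta> y))"
proof -
  have "pair3 e f g (image_mset (\<lambda>(u, v). (x, u, v)) t) = e x * pair2 f g t" for x t
    by (induction t) (auto simp: pair3_def pair2_def algebra_simps)
  then show ?thesis
    by (induction s) (auto simp: pair3_def[of e f g "{#}"])
qed

text \<open>
  In this form linearity is visibly invariant under exchanging the two factors.
\<close>

lemma tensor_lin_map_iff:
  assumes X: "is_vspace X" and V: "is_vspace V" and W: "is_vspace W"
  shows "tensor_lin_map X V W \<delta> \<longleftrightarrow>
    (\<forall>x\<in>carrier X. set_mset (\<delta> x) \<subseteq> carrier V \<times> carrier W) \<and>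
    (\<forall>f\<in>carrier (dual V). \<forall>g\<in>carrier (dual W). functional X (\<lambda>x. pair2 f g (\<delta> x)))"
    (is "?L \<longleftrightarrow> ?R1 \<and> ?R2")
proof -
  have scale: "pair2 f g (image_mset (\<lambda>(v, w). (smul V a v, w)) s) = a * pair2 f g s"
    if "functional V f" "set_mset s \<subseteq> carrier V \<times> carrier W" for f g a s
    using that(2) by (induction s) (auto simp: pair2_def functional_smul[OF that(1)] algebra_simps)
  show ?thesis
  proof (intro iffI conjI)
    assume L: ?L
    then show R1: ?R1 by (simp add: tensor_lin_map_def)
    show ?R2
      unfolding functional_def
    proof (intro ballI allI conjI)
      fix f g x y a assume fg: "f \<in> carrier (dual V)" "g \<in> carrier (dual W)" and x: "x \<in> carrier X"
      note eq = tensor_eq_pair2[OF V dual_functional[OF fg(1)] dual_functional[OF fg(2)]]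
      show "pair2 f g (\<delta> (x + y)) = pair2 f g (\<delta> x) + pair2 f g (\<delta> y)" if "y \<in> carrier X"
        using eq[of "\<delta> (x + y)" "\<delta> x + \<delta> y"] L x that by (simp add: tensor_lin_map_def)
      show "pair2 f g (\<delta> (smul X a x)) = a * pair2 f g (\<delta> x)"
        using eq[of "\<delta> (smul X a x)" "image_mset (\<lambda>(v, w). (smul V a v, w)) (\<delta> x)"] L x R1
          scale[OF dual_functional[OF fg(1)]]
        by (simp add: tensor_lin_map_def)
    qed
  next
    assume R: "?R1 \<and> ?R2"
    then have entries: "\<And>x. x \<in> carrier X \<Longrightarrow> set_mset (\<delta> x) \<subseteq> carrier V \<times> carrier W"
      by blast
    have lin: "functional X (\<lambda>x. pair2 f g (\<delta> x))"
      if "f \<in> carrier (dual V)" "g \<in> carrier (dual W)" for f g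
      using R that by blast
    have "tensor_eq V W (\<delta> (x + y)) (\<delta> x + \<delta> y)" if "x \<in> carrier X" "y \<in> carrier X" for x y
      using that entries[of x] entries[of y] entries[of "x + y"] functional_add[OF lin]
      by (intro tensor_eqI_pair2 V W) (auto simp: carrier_add[OF X])
    moreover have "tensor_eq V W (\<delta> (smul X a x)) (image_mset (\<lambda>(v, w). (smul V a v, w)) (\<delta> x))"
      if x: "x \<in> carrier X" for x a
    proof (rule tensor_eqI_pair2[OF V W entries[OF carrier_smul[OF X x]]])
      show "set_mset (image_mset (\<lambda>(v, w). (smul V a v, w)) (\<delta> x)) \<subseteq> carrier V \<times> carrier W"
        using entries[OF x] by (auto simp: carrier_smul[OF V])
    next
      fix f g assume "f \<in> carrier (dual V)" "g \<in> carrier (dual W)"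
      then show "pair2 f g (\<delta> (smul X a x)) =
          pair2 f g (image_mset (\<lambda>(v, w). (smul V a v, w)) (\<delta> x))"
        using functional_smul[OF lin x] scale[OF dual_functional entries[OF x]] by simp
    qed
    ultimately show ?L
      using entries by (simp add: tensor_lin_map_def)
  qed
qed

lemma tensor_lin_map_carrier:
    "tensor_lin_map X V W \<delta> \<Longrightarrow> x \<in> carrier X \<Longrightarrow> set_mset (\<delta> x) \<subseteq> carrier V \<times> carrier W"
  by (simp add: tensor_lin_map_def)

lemma tensor_lin_map_swap:
  assumes "is_vspace X" "is_vspace V" "is_vspace W"
  shows "tensor_lin_map X W V (\<lambda>x. image_mset prod.swap (\<delta> x)) \<longleftrightarrow> tensor_lin_map X V W \<delta>"
proof -
  have *: "prod.swap ` A \<subseteq> P \<times> Q \<longleftrightarrow> A \<subseteq> Q \<times> P" for A :: "('x \<times> 'y) set" and P Q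
    by force
  show ?thesis
    by (auto simp: tensor_lin_map_iff assms pair2_swap * )
qed

lemma
  assumes X: "is_vspace X" and V: "is_vspace V" and f: "functional W f"
    and \<delta>: "tensor_lin_map X V W \<delta>"
  shows contr_add: "x \<in> carrier X \<Longrightarrow> y \<in> carrier X \<Longrightarrow>
            contr V f (\<delta> (x + y)) = contr V f (\<delta> x) + contr V f (\<delta> y)"
    and contr_smul: "x \<in> carrier X \<Longrightarrow> contr V f (\<delta> (smul X a x)) = smul V a (contr V f (\<delta> x))"
proof -
  show "contr V f (\<delta> (x + y)) = contr V f (\<delta> x) + contr V f (\<delta> y)"
    if "x \<in> carrier X" "y \<in> carrier X" for x y
    using tensor_eq_contr[OF V f, of "\<delta> (x + y)" "\<delta> x + \<delta> y"] that \<delta>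
    by (simp add: tensor_lin_map_def)
  have "contr V f (image_mset (\<lambda>(v, w). (smul V a v, w)) s) = smul V a (contr V f s)" for a s
    by (induction s) (auto simp: smul_simps[OF V] mult.commute)
  then show "contr V f (\<delta> (smul X a x)) = smul V a (contr V f (\<delta> x))"
    if "x \<in> carrier X" for x a
    using tensor_eq_contr[OF V f, of "\<delta> (smul X a x)" "image_mset (\<lambda>(v, w). (smul V a v, w)) (\<delta> x)"]
      that \<delta> by (simp add: tensor_lin_map_def)
qed

section \<open>Coalgebras and comodules by their dual actions\<close>

lemma contr_swap: "contr V f (image_mset prod.swap s) = (\<Sum>(w, v)\<in>#s. smul V (f w) v)"
  by (induction s) auto

lemma conv_pair2: "x \<in> carrier C \<Longrightarrow> conv C f g x = pair2 f g (comult C x)"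
  by (simp add: conv_def pair2_def)

lemma conv_outside: "x \<notin> carrier C \<Longrightarrow> conv C f g x = 0"
  by (simp add: conv_def)

lemma conv_dual:
  assumes "is_vspace C" "tensor_lin_map C C C (comult C)" "f \<in> carrier (dual C)" "g \<in> carrier (dual C)"
  shows "conv C f g \<in> carrier (dual C)"
proof -
  have "functional C (\<lambda>x. pair2 f g (comult C x))"
    using assms by (simp add: tensor_lin_map_iff)
  moreover have "conv C f g = (\<lambda>x. if x \<in> carrier C then pair2 f g (comult C x) else 0)"
    by (auto simp: conv_def pair2_def)
  ultimately show ?thesis
    using functional_restrict[OF assms(1)] by simp
qed

lemma sum_mset_pair2:
  assumes "\<And>x y. (x, y) \<in># s \<Longrightarrow> h x y = f x * g y"
  shows "(\<Sum>(x, y)\<in>#s. h x y) = pair2 f g s"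
  unfolding pair2_def using assms by (intro arg_cong[where f = sum_mset] image_mset_cong) auto

lemma iterate_left_carrier:
  assumes "set_mset s \<subseteq> A \<times> B" "\<And>x. x \<in> A \<Longrightarrow> set_mset (\<delta> x) \<subseteq> D \<times> E"
  shows "set_mset (\<Sum>(x, y)\<in>#s. image_mset (\<lambda>(u, v). (u, v, y)) (\<delta> x)) \<subseteq> D \<times> E \<times> B"
  using assms(1)
proof (induction s)
  case (add xy s)
  then show ?case using assms(2)[of "fst xy"] by (cases xy) auto
qed simp

lemma iterate_right_carrier:
  assumes "set_mset s \<subseteq> A \<times> B" "\<And>y. y \<in> B \<Longrightarrow> set_mset (\<delta> y) \<subseteq> D \<times> E"
  shows "set_mset (\<Sum>(x, y)\<in>#s. image_mset (\<lambda>(u, v). (x, u, v)) (\<delta> y)) \<subseteq> A \<times> D \<times> E"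
  using assms(1)
proof (induction s)
  case (add xy s)
  then show ?case using assms(2)[of "snd xy"] by (cases xy) auto
qed simp

context
  fixes C :: "('k::field, 'c::ab_group_add) coalg"
  assumes C: "is_vspace C" and comult: "tensor_lin_map C C C (comult C)"
begin

text \<open>
  Pairing both sides of coassociativity with \<open>e \<otimes> f \<otimes> g\<close> gives \<open>e(f \<cdot> (g \<cdot> m))\<close> and
  \<open>e((f * g) \<cdot> m)\<close>, so coassociativity says that contraction is an action of the algebra \<open>C\<^sup>*\<close>.
\<close>

lemma coassoc_right_iff:
  fixes M :: "('k, 'm::ab_group_add, 'y) vspace_scheme"
  assumes M: "is_vspace M" and \<delta>: "tensor_lin_map M M C \<delta>"
  shows "(\<forall>m\<in>carrier M. tensor3_eq M C C
           (\<Sum>(m\<^sub>0, m\<^sub>1)\<in>#\<delta> m. image_mset (\<lambda>(u, v). (u, v, m\<^sub>1)) (\<delta> m\<^sub>0))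
           (\<Sum>(m\<^sub>0, m\<^sub>1)\<in>#\<delta> m. image_mset (\<lambda>(u, v). (m\<^sub>0, u, v)) (comult C m\<^sub>1))) \<longleftrightarrow>
         (\<forall>f\<in>carrier (dual C). \<forall>g\<in>carrier (dual C). \<forall>m\<in>carrier M.
           contr M (conv C f g) (\<delta> m) = contr M f (\<delta> (contr M g (\<delta> m))))"
    (is "(\<forall>m\<in>_. tensor3_eq M C C (?s m) (?t m)) \<longleftrightarrow> (\<forall>f\<in>_. \<forall>g\<in>_. \<forall>m\<in>_. ?p f g m = ?q f g m)")
proof -
  note \<delta>_carrier = tensor_lin_map_carrier[OF \<delta>]
  note comult_carrier = tensor_lin_map_carrier[OF comult]
  note contr_M = contr_carrier[OF M \<delta>_carrier]
  have s: "pair3 e f g (?s m) = e (?q f g m)"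
    if "e \<in> carrier (dual M)" "f \<in> carrier (dual C)" "g \<in> carrier (dual C)" "m \<in> carrier M" for e f g m
  proof -
    have lin: "functional M (\<lambda>m. pair2 e f (\<delta> m))"
      using \<delta> that by (simp add: tensor_lin_map_iff M C)
    have "pair3 e f g (?s m) = pair2 (\<lambda>m. pair2 e f (\<delta> m)) g (\<delta> m)"
      unfolding pair3_left by (rule sum_mset_pair2) simp
    also have "\<dots> = pair2 e f (\<delta> (contr M g (\<delta> m)))"
      by (rule functional_contr[OF M lin \<delta>_carrier[OF that(4)], symmetric])
    also have "\<dots> = e (?q f g m)"
      by (rule functional_contr[OF M dual_functional[OF that(1)] \<delta>_carrier, symmetric])
         (rule contr_M[OF that(4)])
    finally show ?thesis .
  qed
  have t: "pair3 e f g (?t m) = e (?p f g m)"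
    if "e \<in> carrier (dual M)" "m \<in> carrier M" for e f g m
  proof -
    have "pair3 e f g (?t m) = pair2 e (conv C f g) (\<delta> m)"
      unfolding pair3_right using \<delta>_carrier[OF that(2)]
      by (intro sum_mset_pair2) (auto simp: conv_pair2)
    also have "\<dots> = e (?p f g m)"
      by (rule functional_contr[OF M dual_functional[OF that(1)] \<delta>_carrier[OF that(2)], symmetric])
    finally show ?thesis .
  qed
  have carrier: "set_mset (?s m) \<subseteq> carrier M \<times> carrier C \<times> carrier C"
    "set_mset (?t m) \<subseteq> carrier M \<times> carrier C \<times> carrier C" if "m \<in> carrier M" for m
    by - (rule iterate_left_carrier iterate_right_carrier, (rule \<delta>_carrier comult_carrier, (rule that | assumption))+)+
  show ?thesis
  proof (intro iffI ballI)
    fix f g m assume *: "\<forall>m\<in>carrier M. tensor3_eq M C C (?s m) (?t m)"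
      "f \<in> carrier (dual C)" "g \<in> carrier (dual C)" "m \<in> carrier M"
    show "?p f g m = ?q f g m"
    proof (rule coord_separates[OF M])
      fix e assume e: "e \<in> carrier (dual M)"
      have "pair3 e f g (?s m) = pair3 e f g (?t m)"
        using * e by (intro tensor3_eq_pair3[OF M]) (auto intro: dual_functional)
      then show "e (?p f g m) = e (?q f g m)"
        using s t * e by simp
    qed (use * contr_M in auto)
  next
    fix m assume *: "\<forall>f\<in>carrier (dual C). \<forall>g\<in>carrier (dual C). \<forall>m\<in>carrier M. ?p f g m = ?q f g m"
      "m \<in> carrier M"
    show "tensor3_eq M C C (?s m) (?t m)"
      using * s t by (intro tensor3_eqI[OF M C C] carrier) auto
  qed
qed

text \<open>
  The mirror image of the preceding lemma: a left coaction gives a right action of \<open>C\<^sup>*\<close>, hence the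
  reversed order of \<open>f\<close> and \<open>g\<close>.
\<close>

lemma coassoc_left_iff:
  fixes M :: "('k, 'm::ab_group_add, 'y) vspace_scheme"
  assumes M: "is_vspace M" and \<delta>: "tensor_lin_map M C M \<delta>"
  defines "\<delta>' \<equiv> \<lambda>m. image_mset prod.swap (\<delta> m)"
  shows "(\<forall>m\<in>carrier M. tensor3_eq C C M
           (\<Sum>(m\<^sub>1, m\<^sub>0)\<in>#\<delta> m. image_mset (\<lambda>(u, v). (u, v, m\<^sub>0)) (comult C m\<^sub>1))
           (\<Sum>(m\<^sub>1, m\<^sub>0)\<in>#\<delta> m. image_mset (\<lambda>(u, v). (m\<^sub>1, u, v)) (\<delta> m\<^sub>0))) \<longleftrightarrow>
         (\<forall>f\<in>carrier (dual C). \<forall>g\<in>carrier (dual C). \<forall>m\<in>carrier M.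
           contr M (conv C f g) (\<delta>' m) = contr M g (\<delta>' (contr M f (\<delta>' m))))"
    (is "(\<forall>m\<in>_. tensor3_eq C C M (?s m) (?t m)) \<longleftrightarrow> (\<forall>f\<in>_. \<forall>g\<in>_. \<forall>m\<in>_. ?p f g m = ?q f g m)")
proof -
  have \<delta>': "tensor_lin_map M M C \<delta>'"
    unfolding \<delta>'_def using \<delta> by (simp add: tensor_lin_map_swap M C)
  note \<delta>_carrier = tensor_lin_map_carrier[OF \<delta>]
  note \<delta>'_carrier = tensor_lin_map_carrier[OF \<delta>']
  note comult_carrier = tensor_lin_map_carrier[OF comult]
  note contr_M = contr_carrier[OF M \<delta>'_carrier]
  have swap: "pair2 f e (\<delta> m) = pair2 e f (\<delta>' m)" for e f m
    by (simp add: \<delta>'_def pair2_swap)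
  have s: "pair3 f g e (?s m) = e (?p f g m)"
    if "e \<in> carrier (dual M)" "m \<in> carrier M" for e f g m
  proof -
    have "pair3 f g e (?s m) = pair2 (conv C f g) e (\<delta> m)"
      unfolding pair3_left using \<delta>_carrier[OF that(2)]
      by (intro sum_mset_pair2) (auto simp: conv_pair2)
    also have "\<dots> = e (?p f g m)"
      unfolding swap
      by (rule functional_contr[OF M dual_functional[OF that(1)] \<delta>'_carrier[OF that(2)], symmetric])
    finally show ?thesis .
  qed
  have t: "pair3 f g e (?t m) = e (?q f g m)"
    if "e \<in> carrier (dual M)" "f \<in> carrier (dual C)" "g \<in> carrier (dual C)" "m \<in> carrier M" for e f g m
  proof -
    have lin: "functional M (\<lambda>m. pair2 e g (\<delta>' m))"
      using \<delta>' that by (simp add: tensor_lin_map_iff M C)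
    have "pair3 f g e (?t m) = pair2 f (\<lambda>m. pair2 e g (\<delta>' m)) (\<delta> m)"
      unfolding pair3_right by (rule sum_mset_pair2) (simp add: swap)
    also have "\<dots> = pair2 e g (\<delta>' (contr M f (\<delta>' m)))"
      unfolding swap by (rule functional_contr[OF M lin \<delta>'_carrier[OF that(4)], symmetric])
    also have "\<dots> = e (?q f g m)"
      by (rule functional_contr[OF M dual_functional[OF that(1)] \<delta>'_carrier, symmetric])
         (rule contr_M[OF that(4)])
    finally show ?thesis .
  qed
  have carrier: "set_mset (?s m) \<subseteq> carrier C \<times> carrier C \<times> carrier M"
    "set_mset (?t m) \<subseteq> carrier C \<times> carrier C \<times> carrier M" if "m \<in> carrier M" for m
    by - (rule iterate_left_carrier iterate_right_carrier, (rule \<delta>_carrier comult_carrier, (rule that | assumption))+)+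
  show ?thesis
  proof (intro iffI ballI)
    fix f g m assume *: "\<forall>m\<in>carrier M. tensor3_eq C C M (?s m) (?t m)"
      "f \<in> carrier (dual C)" "g \<in> carrier (dual C)" "m \<in> carrier M"
    show "?p f g m = ?q f g m"
    proof (rule coord_separates[OF M])
      fix e assume e: "e \<in> carrier (dual M)"
      have "pair3 f g e (?s m) = pair3 f g e (?t m)"
        using * e by (intro tensor3_eq_pair3[OF C]) (auto intro: dual_functional)
      then show "e (?p f g m) = e (?q f g m)"
        using s t * e by simp
    qed (use * contr_M in auto)
  next
    fix m assume *: "\<forall>f\<in>carrier (dual C). \<forall>g\<in>carrier (dual C). \<forall>m\<in>carrier M. ?p f g m = ?q f g m"
      "m \<in> carrier M"
    show "tensor3_eq C C M (?s m) (?t m)"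
      using * s t by (intro tensor3_eqI[OF C C M] carrier) auto
  qed
qed

lemma conv_left_act:
  "f \<in> carrier (dual C) \<Longrightarrow> x \<in> carrier C \<Longrightarrow> conv C f g x = f (contr C g (comult C x))"
  using functional_contr[OF C dual_functional tensor_lin_map_carrier[OF comult]]
  by (simp add: conv_pair2)

text \<open>
  Since \<open>(f * g)(x) = f(g\<rightharpoonup>x)\<close>, associativity of the dual algebra is the action law for \<open>\<rightharpoonup>\<close>, tested by
  functionals.
\<close>

lemma conv_assoc_iff:
  "(\<forall>f\<in>carrier (dual C). \<forall>g\<in>carrier (dual C). \<forall>x\<in>carrier C.
      contr C (conv C f g) (comult C x) = contr C f (comult C (contr C g (comult C x)))) \<longleftrightarrow>
   (\<forall>f\<in>carrier (dual C). \<forall>g\<in>carrier (dual C). \<forall>h\<in>carrier (dual C).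
      conv C (conv C f g) h = conv C f (conv C g h))"
   (is "?L \<longleftrightarrow> ?R")
proof -
  note carrier = contr_carrier[OF C tensor_lin_map_carrier[OF comult]]
  have l: "conv C f (conv C g h) x = f (contr C (conv C g h) (comult C x))"
    if "f \<in> carrier (dual C)" "x \<in> carrier C" for f g h x
    using that by (simp add: conv_left_act)
  have r: "conv C (conv C f g) h x = f (contr C g (comult C (contr C h (comult C x))))"
    if "f \<in> carrier (dual C)" "g \<in> carrier (dual C)" "x \<in> carrier C" for f g h x
    using that conv_dual[OF C comult] carrier by (simp add: conv_left_act)
  show ?thesis
  proof (intro iffI ballI)
    fix f g h assume ?L "f \<in> carrier (dual C)" "g \<in> carrier (dual C)" "h \<in> carrier (dual C)"
    then have "conv C (conv C f g) h x = conv C f (conv C g h) x" for x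
      using l r by (cases "x \<in> carrier C") (auto simp: conv_outside)
    then show "conv C (conv C f g) h = conv C f (conv C g h)" by blast
  next
    fix g h x assume *: ?R "g \<in> carrier (dual C)" "h \<in> carrier (dual C)" "x \<in> carrier C"
    show "contr C (conv C g h) (comult C x) = contr C g (comult C (contr C h (comult C x)))"
    proof (rule coord_separates[OF C])
      fix f assume "f \<in> carrier (dual C)"
      then show "f (contr C (conv C g h) (comult C x)) = f (contr C g (comult C (contr C h (comult C x))))"
        using l[of f x g h] r[of f g x h] * by simp
    qed (use * carrier in auto)
  qed
qed

end

lemma coalgebra_iff:
  "coalgebra C \<longleftrightarrow> is_vspace C \<and> tensor_lin_map C C C (comult C) \<and> functional C (counit C) \<and>
     (\<forall>f\<in>carrier (dual C). \<forall>g\<in>carrier (dual C). \<forall>h\<in>carrier (dual C).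
        conv C (conv C f g) h = conv C f (conv C g h)) \<and>
     (\<forall>x\<in>carrier C. contr C (counit C) (image_mset prod.swap (comult C x)) = x) \<and>
     (\<forall>x\<in>carrier C. contr C (counit C) (comult C x) = x)"
  unfolding coalgebra_def functional_def contr_swap
  using coassoc_right_iff[of C C "comult C"] conv_assoc_iff[of C]
  by (simp add: contr_def cong: conj_cong)

lemma right_comodule_iff:
  assumes "coalgebra C"
  shows "right_comodule C M \<longleftrightarrow> is_vspace M \<and> tensor_lin_map M M C (coact M) \<and>
     (\<forall>f\<in>carrier (dual C). \<forall>g\<in>carrier (dual C). \<forall>m\<in>carrier M.
        contr M (conv C f g) (coact M m) = contr M f (coact M (contr M g (coact M m)))) \<and>
     (\<forall>m\<in>carrier M. contr M (counit C) (coact M m) = m)"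
  using assms coassoc_right_iff[of C M "coact M"]
  by (simp add: right_comodule_def coalgebra_iff contr_def cong: conj_cong)

lemma left_comodule_iff:
  assumes "coalgebra C"
  shows "left_comodule C M \<longleftrightarrow> is_vspace M \<and> tensor_lin_map M C M (coact M) \<and>
     (\<forall>f\<in>carrier (dual C). \<forall>g\<in>carrier (dual C). \<forall>m\<in>carrier M.
        contr M (conv C f g) (image_mset prod.swap (coact M m)) =
        contr M g (image_mset prod.swap (coact M (contr M f (image_mset prod.swap (coact M m)))))) \<and>
     (\<forall>m\<in>carrier M. contr M (counit C) (image_mset prod.swap (coact M m)) = m)"
  using assms coassoc_left_iff[of C M "coact M"]
  by (simp add: left_comodule_def coalgebra_iff contr_swap cong: conj_cong)

section \<open>The co-opposite coalgebra\<close>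

definition cop :: "('k, 'c) coalg \<Rightarrow> ('k, 'c) coalg" where
  "cop C = \<lparr>carrier = carrier C, smul = smul C,
            comult = (\<lambda>x. image_mset prod.swap (comult C x)), counit = counit C\<rparr>"

text \<open>
  This exchanges left comodules over \<open>C\<close> and right comodules over \<open>cop C\<close>.
\<close>

definition comod_swap :: "('k, 'm, 'a \<times> 'b) comod \<Rightarrow> ('k, 'm, 'b \<times> 'a) comod" where
  "comod_swap M = \<lparr>carrier = carrier M, smul = smul M, coact = (\<lambda>x. image_mset prod.swap (coact M x))\<rparr>"

lemma cop_simps [simp]:
  "carrier (cop C) = carrier C" "smul (cop C) = smul C" "counit (cop C) = counit C"
  "comult (cop C) x = image_mset prod.swap (comult C x)"
  by (simp_all add: cop_def)

lemma comod_swap_simps [simp]: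
  "carrier (comod_swap M) = carrier M" "smul (comod_swap M) = smul M"
  "coact (comod_swap M) x = image_mset prod.swap (coact M x)"
  by (simp_all add: comod_swap_def)

lemma cop_cop [simp]: "cop (cop C) = C"
  by (simp add: cop_def image_mset.compositionality)

lemma comod_swap_swap [simp]: "comod_swap (comod_swap M) = M"
  by (simp add: comod_swap_def image_mset.compositionality)

lemma is_vspace_cong: "carrier V = carrier W \<Longrightarrow> smul V = smul W \<Longrightarrow> is_vspace V = is_vspace W"
  by (simp add: is_vspace_def)

lemma dual_cop [simp]: "dual (cop C) = dual C"
  by (simp add: dual_def)

lemma functional_cop [simp]: "functional (cop C) = functional C"
  by (simp add: functional_def fun_eq_iff)

lemma contr_cop [simp]: "contr (cop C) = contr C"
  by (simp add: contr_def fun_eq_iff)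

lemma coord_cop [simp]: "coord (cop C) = coord C"
  by (simp add: coord_def basis_def fun_eq_iff)

lemma basis_cop [simp]: "basis (cop C) = basis C"
  by (simp add: basis_def)

lemma is_vspace_cop [simp]: "is_vspace (cop C) = is_vspace C"
  by (simp add: is_vspace_def)

lemma is_vspace_comod_swap [simp]: "is_vspace (comod_swap M) = is_vspace M"
  by (simp add: is_vspace_def)

lemma contr_comod_swap [simp]: "contr (comod_swap M) = contr M"
  by (simp add: contr_def fun_eq_iff)

lemma conv_cop: "conv (cop C) f g = conv C g f"
  using pair2_swap[of f g] by (auto simp: conv_def pair2_def)

text \<open>
  The predicate only refers to carriers and scalar multiplications; the other fields of the records
  may differ.
\<close>

lemma tensor_lin_map_cong:
  assumes "is_vspace X" "is_vspace V" "is_vspace W"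
    and "carrier X' = carrier X" "smul X' = smul X" "carrier V' = carrier V" "smul V' = smul V"
      "carrier W' = carrier W" "smul W' = smul W"
  shows "tensor_lin_map X' V' W' \<delta> = tensor_lin_map X V W \<delta>"
proof -
  have "is_vspace X'" "is_vspace V'" "is_vspace W'"
    using assms by (auto simp: is_vspace_def)
  then show ?thesis
    using assms by (simp add: tensor_lin_map_iff functional_def dual_def)
qed

lemma coalgebra_cop:
  assumes "coalgebra C"
  shows "coalgebra (cop C)"
proof -
  have C: "is_vspace C" and "tensor_lin_map C C C (comult C)"
    using assms by (auto simp: coalgebra_iff)
  then have "tensor_lin_map C C C (\<lambda>x. image_mset prod.swap (comult C x))"
    by (simp add: tensor_lin_map_swap)
  moreover have "comult (cop C) = (\<lambda>x. image_mset prod.swap (comult C x))"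
    by (simp add: fun_eq_iff)
  ultimately have "tensor_lin_map (cop C) (cop C) (cop C) (comult (cop C))"
    using C by (subst tensor_lin_map_cong[of C C C]) auto
  then show ?thesis
    using assms by (simp add: coalgebra_iff conv_cop image_mset.compositionality)
qed

lemma left_comodule_cop:
  assumes C: "coalgebra C"
  shows "left_comodule C M \<longleftrightarrow> right_comodule (cop C) (comod_swap M)"
proof (cases "is_vspace M")
  case M: True
  have vC: "is_vspace C" using C by (simp add: coalgebra_iff)
  have "tensor_lin_map (comod_swap M) (comod_swap M) (cop C) (coact (comod_swap M)) \<longleftrightarrow>
        tensor_lin_map M M C (\<lambda>x. image_mset prod.swap (coact M x))"
    using M vC by (subst tensor_lin_map_cong[of M M C]) (auto simp: comod_swap_def)
  then have *: "tensor_lin_map (comod_swap M) (comod_swap M) (cop C) (coact (comod_swap M)) \<longleftrightarrow>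
        tensor_lin_map M C M (coact M)"
    using M vC by (simp add: tensor_lin_map_swap)
  show ?thesis
    unfolding left_comodule_iff[OF C] right_comodule_iff[OF coalgebra_cop[OF C]] *
    by (auto simp: conv_cop)
qed (auto simp: left_comodule_def right_comodule_def)

lemma image_mset_swap_swap [simp]: "image_mset prod.swap (image_mset prod.swap s) = s"
  by (simp add: image_mset.compositionality)

lemma tensor_eq_swap:
  assumes "is_vspace V" "is_vspace W" and V': "carrier V' = carrier V" "smul V' = smul V"
    and W': "carrier W' = carrier W" "smul W' = smul W" and "tensor_eq V W s t"
  shows "tensor_eq W' V' (image_mset prod.swap s) (image_mset prod.swap t)"
  using assms(7)
proof induction
  case (zero w)
  have "tensor_eq W' V' {#(smul W' 0 w, 0)#} {#(w, smul V' 0 0)#}"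
    using zero assms by (intro tensor_eq.smul) (auto simp: carrier_zero)
  then have "tensor_eq W' V' {#(w, 0)#} {#(0, 0)#}"
    using assms by (auto simp: smul_simps intro: tensor_eq.sym)
  also have "tensor_eq W' V' {#(0, 0)#} {#}"
    using assms by (intro tensor_eq.zero) (simp add: carrier_zero)
  finally (tensor_eq.trans) show ?case by simp
next
  case (smul v w a)
  then show ?case
    using tensor_eq.smul[of w W' v V' a] by (auto simp: V' W' intro: tensor_eq.sym)
next
  case (plus s t r)
  then show ?case by (simp add: tensor_eq.plus)
next
  case (trans r s t)
  from trans.IH show ?case by (rule tensor_eq.trans)
qed (auto intro: tensor_eq.intros simp: V' W')

lemma left_comodule_hom_cop:
  assumes C: "is_vspace C" and N: "is_vspace N"
  shows "left_comodule_hom C M N f \<longleftrightarrow> right_comodule_hom (cop C) (comod_swap M) (comod_swap N) f"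
proof -
  have "tensor_eq C N (image_mset (map_prod id f) s) t \<longleftrightarrow>
        tensor_eq (comod_swap N) (cop C) (image_mset (map_prod f id) (image_mset prod.swap s))
          (image_mset prod.swap t)" (is "?L \<longleftrightarrow> ?R") for s t
  proof
    have *: "image_mset (map_prod f id) (image_mset prod.swap s) =
        image_mset prod.swap (image_mset (map_prod id f) s)"
      by (simp add: image_mset.compositionality comp_def case_prod_beta' map_prod_def)
    show ?R if ?L
      unfolding * by (rule tensor_eq_swap[OF C N _ _ _ _ that]) simp_all
    show ?L if ?R
    proof -
      have "tensor_eq C N (image_mset prod.swap (image_mset prod.swap (image_mset (map_prod id f) s)))
              (image_mset prod.swap (image_mset prod.swap t))"
        using that[unfolded *] by (intro tensor_eq_swap[of "comod_swap N" "cop C"]) (simp_all add: C N)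
      then show ?thesis by simp
    qed
  qed
  then show ?thesis
    by (simp add: left_comodule_hom_def right_comodule_hom_def lin_map_def)
qed

section \<open>The dual algebra and rational functionals\<close>

lemma conv_right_act:
  assumes "is_vspace C" "tensor_lin_map C C C (comult C)" "g \<in> carrier (dual C)" "x \<in> carrier C"
  shows "conv C f g x = g (contr C f (image_mset prod.swap (comult C x)))"
proof -
  have "set_mset (image_mset prod.swap (comult C x)) \<subseteq> carrier C \<times> carrier C"
    using tensor_lin_map_carrier[OF assms(2,4)] by auto
  then show ?thesis
    using functional_contr[OF assms(1) dual_functional[OF assms(3)], of "image_mset prod.swap (comult C x)" _ f] assms(4)
    by (simp add: conv_pair2 pair2_swap)
qed

text \<open>
  The counit as an element of the dual space; it is the unit of the dual algebra.
\<close>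

definition eps :: "('k::field, 'c::ab_group_add) coalg \<Rightarrow> 'c \<Rightarrow> 'k" where
  "eps C x = (if x \<in> carrier C then counit C x else 0)"

text \<open>
  A coaction with \<open>f m = \<Sum> f(m\<^sub>1) m\<^sub>0\<close> must be \<open>m \<mapsto> \<Sum>\<^sub>b b\<^sup>*m \<otimes> b\<close>, where \<open>b\<close> runs through a basis of \<open>C\<close>
  with coordinate functionals \<open>b\<^sup>*\<close>.
\<close>

definition rational_coact ::
  "('k::field, 'c::ab_group_add) coalg \<Rightarrow> (('c \<Rightarrow> 'k) \<Rightarrow> 'm::zero \<Rightarrow> 'm) \<Rightarrow> 'm \<Rightarrow> ('m \<times> 'c) multiset" where
  "rational_coact C act m =
     image_mset (\<lambda>b. (act (coord C b) m, b)) (mset_set {b \<in> basis C. act (coord C b) m \<noteq> 0})"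

text \<open>
  As \<open>(b\<^sup>* * f)(x) = b\<^sup>*(f\<rightharpoonup>x)\<close>, the condition says that \<open>f\<rightharpoonup>C\<close> is contained in the span of finitely
  many basis elements, i.e. that it is finite dimensional.
\<close>

definition left_rat :: "('k::field, 'c::ab_group_add) coalg \<Rightarrow> ('c \<Rightarrow> 'k) set" where
  "left_rat C = {f \<in> carrier (dual C). finite {b \<in> basis C. conv C (coord C b) f \<noteq> 0}}"

lemma sum_mset_pair_zero [simp]: "(\<Sum>(x, y)\<in>#s. 0) = 0"
  by (induction s) auto

lemma sum_fun_apply: "(\<Sum>i\<in>I. f i) x = (\<Sum>i\<in>I. f i x)" for f :: "'i \<Rightarrow> 'a \<Rightarrow> 'b::comm_monoid_add"
  by (induction I rule: infinite_finite_induct) auto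

context
  fixes C :: "('k::field, 'c::ab_group_add) coalg"
  assumes coalgebra: "coalgebra C"
begin

lemma coalgebra_vspace: "is_vspace C"
  and coalgebra_comult: "tensor_lin_map C C C (comult C)"
  and coalgebra_counit: "functional C (counit C)"
  and conv_assoc: "f \<in> carrier (dual C) \<Longrightarrow> g \<in> carrier (dual C) \<Longrightarrow> h \<in> carrier (dual C) \<Longrightarrow>
        conv C (conv C f g) h = conv C f (conv C g h)"
  using coalgebra by (simp_all add: coalgebra_iff)

lemma conv_closed: "f \<in> carrier (dual C) \<Longrightarrow> g \<in> carrier (dual C) \<Longrightarrow> conv C f g \<in> carrier (dual C)"
  by (rule conv_dual[OF coalgebra_vspace coalgebra_comult])

lemma eps_dual: "eps C \<in> carrier (dual C)"
  using functional_restrict[OF coalgebra_vspace coalgebra_counit] by (simp add: eps_def[abs_def])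

lemma contr_eps:
  assumes "set_mset s \<subseteq> X \<times> carrier C"
  shows "contr V (eps C) s = contr V (counit C) s"
  using assms by (intro contr_cong) (auto simp: eps_def)

lemma conv_eps_right:
  assumes f: "f \<in> carrier (dual C)"
  shows "conv C f (eps C) = f"
proof
  fix x show "conv C f (eps C) x = f x"
    using f contr_eps[OF tensor_lin_map_carrier[OF coalgebra_comult], of x C] coalgebra
    by (cases "x \<in> carrier C")
       (auto simp: conv_left_act[OF coalgebra_vspace coalgebra_comult] conv_outside dual_iff coalgebra_iff)
qed

lemma conv_eps_left:
  assumes f: "f \<in> carrier (dual C)"
  shows "conv C (eps C) f = f"
proof
  fix x show "conv C (eps C) f x = f x"
  proof (cases "x \<in> carrier C")
    case True
    then have "set_mset (image_mset prod.swap (comult C x)) \<subseteq> carrier C \<times> carrier C"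
      using tensor_lin_map_carrier[OF coalgebra_comult] by force
    from contr_eps[OF this, of C] show ?thesis
      using f True coalgebra
      by (simp add: conv_right_act[OF coalgebra_vspace coalgebra_comult] coalgebra_iff)
  qed (use f in \<open>auto simp: conv_outside dual_iff\<close>)
qed

lemma conv_add_right:
  "conv C f (g + h) = conv C f g + conv C f h"
  "conv C f (smul (dual C) a g) = smul (dual C) a (conv C f g)"
  "conv C f 0 = 0"
  by (auto simp: conv_def fun_eq_iff smul_dual sum_mset.distrib[symmetric] sum_mset_distrib_left
      algebra_simps intro!: arg_cong[where f = sum_mset] image_mset_cong)

lemma conv_add_left:
  "conv C (g + h) f = conv C g f + conv C h f"
  "conv C (smul (dual C) a g) f = smul (dual C) a (conv C g f)"
  "conv C 0 f = 0"
  by (auto simp: conv_def fun_eq_iff smul_dual sum_mset.distrib[symmetric] sum_mset_distrib_left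
      algebra_simps intro!: arg_cong[where f = sum_mset] image_mset_cong)

lemma contr_rational_coact:
  "contr V f (rational_coact C act m) =
     (\<Sum>b | b \<in> basis C \<and> act (coord C b) m \<noteq> 0. smul V (f b) (act (coord C b) m))"
  by (simp add: contr_def rational_coact_def image_mset.compositionality comp_def sum_unfold_sum_mset)

text \<open>
  The converse of passing from a comodule to its module: an action comes from a coaction if
  each \<open>m\<close> is killed by almost all coordinate functionals \<open>b\<^sup>*\<close> and \<open>f m = \<Sum>\<^sub>b f(b) b\<^sup>*m\<close> for all
  \<open>f\<close>.
\<close>

lemma rational_comodule:
  fixes M :: "('k, 'm::ab_group_add, 'm \<times> 'c) comod"
  assumes M: "is_vspace M" and coact: "coact M = rational_coact C act"
    and closed: "\<And>f m. f \<in> carrier (dual C) \<Longrightarrow> m \<in> carrier M \<Longrightarrow> act f m \<in> carrier M"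
    and add: "\<And>f m n. f \<in> carrier (dual C) \<Longrightarrow> m \<in> carrier M \<Longrightarrow> n \<in> carrier M \<Longrightarrow>
                act f (m + n) = act f m + act f n"
    and smul: "\<And>f a m. f \<in> carrier (dual C) \<Longrightarrow> m \<in> carrier M \<Longrightarrow>
                act f (smul M a m) = smul M a (act f m)"
    and assoc: "\<And>f g m. f \<in> carrier (dual C) \<Longrightarrow> g \<in> carrier (dual C) \<Longrightarrow> m \<in> carrier M \<Longrightarrow>
                act (conv C f g) m = act f (act g m)"
    and unit: "\<And>m. m \<in> carrier M \<Longrightarrow> act (eps C) m = m"
    and fin: "\<And>m. m \<in> carrier M \<Longrightarrow> finite {b \<in> basis C. act (coord C b) m \<noteq> 0}"
    and rational: "\<And>f m. f \<in> carrier (dual C) \<Longrightarrow> m \<in> carrier M \<Longrightarrow>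
      act f m = (\<Sum>b | b \<in> basis C \<and> act (coord C b) m \<noteq> 0. smul M (f b) (act (coord C b) m))"
  shows "right_comodule C M"
    and "f \<in> carrier (dual C) \<Longrightarrow> m \<in> carrier M \<Longrightarrow> contr M f (coact M m) = act f m"
proof -
  show act: "contr M f (coact M m) = act f m" if "f \<in> carrier (dual C)" "m \<in> carrier M" for f m
    using rational[OF that] by (simp add: coact contr_rational_coact)
  have entries: "set_mset (coact M m) \<subseteq> carrier M \<times> carrier C" if "m \<in> carrier M" for m
    using fin[OF that] closed[OF coord_dual[OF coalgebra_vspace] that] basis_carrier[OF coalgebra_vspace]
    by (auto simp: coact rational_coact_def)
  have pair: "pair2 e f (coact M m) = e (act f m)"
    if "e \<in> carrier (dual M)" "f \<in> carrier (dual C)" "m \<in> carrier M" for e f m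
    using functional_contr[OF M dual_functional[OF that(1)] entries[OF that(3)], of f] act that by simp
  have "tensor_lin_map M M C (coact M)"
    unfolding tensor_lin_map_iff[OF M M coalgebra_vspace]
  proof (intro conjI ballI entries)
    fix e f assume "e \<in> carrier (dual M)" "f \<in> carrier (dual C)"
    then show "functional M (\<lambda>m. pair2 e f (coact M m))"
      unfolding functional_def
      by (auto simp: pair carrier_add[OF M] carrier_smul[OF M] add smul closed
          functional_add[OF dual_functional] functional_smul[OF dual_functional])
  qed
  moreover have "contr M (counit C) (coact M m) = m" if "m \<in> carrier M" for m
    using act[OF eps_dual that] unit[OF that] unfolding contr_eps[OF entries[OF that]] by simp
  ultimately show "right_comodule C M"
    using M assoc by (simp add: right_comodule_iff[OF coalgebra] act conv_closed closed)
qed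

lemma left_act_support_finite:
  "finite {b. \<exists>f. coord C b (contr C f s) \<noteq> 0}" if "set_mset s \<subseteq> carrier C \<times> X"
proof (rule finite_subset)
  show "{b. \<exists>f. coord C b (contr C f s) \<noteq> 0} \<subseteq> (\<Union>(v, w)\<in>set_mset s. {b. coord C b v \<noteq> 0})"
  proof (rule subsetI, rule ccontr)
    fix b assume b: "b \<in> {b. \<exists>f. coord C b (contr C f s) \<noteq> 0}"
      and "b \<notin> (\<Union>(v, w)\<in>set_mset s. {b. coord C b v \<noteq> 0})"
    then have "\<And>v w. (v, w) \<in># s \<Longrightarrow> coord C b v = 0" by blast
    then have "coord C b (contr C f s) = 0" for f
      unfolding functional_contr[OF coalgebra_vspace coord_functional[OF coalgebra_vspace] that]
      by (subst sum_mset_pair2[of _ "\<lambda>_ _. 0", symmetric]) (auto simp del: sum_mset_constant)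
    with b show False by simp
  qed
  show "finite (\<Union>(v, w)\<in>set_mset s. {b. coord C b v \<noteq> 0})"
    using coord_finite[OF coalgebra_vspace] by auto
qed

lemma left_rat_dual_carrier: "f \<in> left_rat C \<Longrightarrow> f \<in> carrier (dual C)"
  by (simp add: left_rat_def)

text \<open>
  Write \<open>(g * f)(x) = g(f\<rightharpoonup>x)\<close> and expand \<open>f\<rightharpoonup>x\<close> in the basis: its coordinates are \<open>(b\<^sup>* * f)(x)\<close>.
\<close>

lemma left_rat_expand:
  assumes f: "f \<in> left_rat C" and g: "g \<in> carrier (dual C)"
  shows "conv C g f =
    (\<Sum>b | b \<in> basis C \<and> conv C (coord C b) f \<noteq> 0. smul (dual C) (g b) (conv C (coord C b) f))"
proof
  fix x
  let ?S = "{b \<in> basis C. conv C (coord C b) f \<noteq> 0}"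
  note act = conv_left_act[OF coalgebra_vspace coalgebra_comult]
  have S: "finite ?S" "?S \<subseteq> carrier C"
    using f basis_carrier[OF coalgebra_vspace] by (auto simp: left_rat_def)
  show "conv C g f x = (\<Sum>b\<in>?S. smul (dual C) (g b) (conv C (coord C b) f)) x"
  proof (cases "x \<in> carrier C")
    case True
    let ?y = "contr C f (comult C x)"
    have y: "?y \<in> carrier C"
      by (rule contr_carrier[OF coalgebra_vspace tensor_lin_map_carrier[OF coalgebra_comult True]])
    have coord: "coord C b ?y = conv C (coord C b) f x" for b
      using act[OF coord_dual[OF coalgebra_vspace] True] by simp
    have "{b. coord C b ?y \<noteq> 0} \<subseteq> ?S"
    proof
      fix b assume "b \<in> {b. coord C b ?y \<noteq> 0}"
      then have b: "coord C b ?y \<noteq> 0" by simp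
      then have "conv C (coord C b) f \<noteq> 0" by (auto simp: coord)
      with coord_nonzero[OF coalgebra_vspace b] show "b \<in> ?S" by simp
    qed
    then have "g ?y = (\<Sum>b\<in>?S. coord C b ?y * g b)"
      using S y by (intro functional_coord_sum[OF coalgebra_vspace dual_functional[OF g]])
    then show ?thesis
      by (simp add: act[OF g True] sum_fun_apply smul_dual coord mult.commute)
  qed (simp add: sum_fun_apply smul_dual conv_outside)
qed

text \<open>
  Expand \<open>b\<^sup>* * (h * f) = (b\<^sup>* * h) * f\<close> in the finitely many \<open>b'\<close> belonging to \<open>f\<close>.  The
  coefficient \<open>(b\<^sup>* * h)(b')\<close> is the \<open>b\<close>-coordinate of \<open>h\<rightharpoonup>b'\<close>, hence zero for almost all \<open>b\<close>.
\<close>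

lemma left_rat_conv_left:
  assumes f: "f \<in> left_rat C" and h: "h \<in> carrier (dual C)"
  shows "conv C h f \<in> left_rat C"
proof -
  let ?S = "{b \<in> basis C. conv C (coord C b) f \<noteq> 0}"
  have S: "finite ?S" "?S \<subseteq> carrier C"
    using f basis_carrier[OF coalgebra_vspace] by (auto simp: left_rat_def)
  have "{b \<in> basis C. conv C (coord C b) (conv C h f) \<noteq> 0} \<subseteq>
        (\<Union>b'\<in>?S. {b. \<exists>h. coord C b (contr C h (comult C b')) \<noteq> 0})"
  proof (rule subsetI, rule ccontr)
    fix b assume b: "b \<in> {b \<in> basis C. conv C (coord C b) (conv C h f) \<noteq> 0}"
      and "b \<notin> (\<Union>b'\<in>?S. {b. \<exists>h. coord C b (contr C h (comult C b')) \<noteq> 0})"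
    then have "conv C (coord C b) h b' = 0" if "b' \<in> ?S" for b'
    proof -
      have "b' \<in> carrier C" using S that by blast
      moreover have "coord C b (contr C h (comult C b')) = 0"
        using \<open>b \<notin> _\<close> that by blast
      ultimately show ?thesis
        by (simp add: conv_left_act[OF coalgebra_vspace coalgebra_comult coord_dual[OF coalgebra_vspace]])
    qed
    then have "conv C (conv C (coord C b) h) f = 0"
      unfolding left_rat_expand[OF f conv_closed[OF coord_dual[OF coalgebra_vspace] h]]
      by (simp add: smul_dual fun_eq_iff sum_fun_apply)
    with b show False
      using conv_assoc[OF coord_dual[OF coalgebra_vspace] h left_rat_dual_carrier[OF f]] by simp
  qed
  moreover have "finite (\<Union>b'\<in>?S. {b. \<exists>h. coord C b (contr C h (comult C b')) \<noteq> 0})"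
    using S left_act_support_finite[OF tensor_lin_map_carrier[OF coalgebra_comult]] by auto
  ultimately show ?thesis
    using conv_closed[OF h left_rat_dual_carrier[OF f]] by (auto simp: left_rat_def intro: finite_subset)
qed

lemma left_rat_subspace: "module.subspace (smul (dual C)) (left_rat C)"
proof -
  note D = dual_vspace[OF coalgebra_vspace]
  have sub: "{b \<in> basis C. conv C (coord C b) (f + g) \<noteq> 0} \<subseteq>
    {b \<in> basis C. conv C (coord C b) f \<noteq> 0} \<union> {b \<in> basis C. conv C (coord C b) g \<noteq> 0}"
    "{b \<in> basis C. conv C (coord C b) (smul (dual C) a f) \<noteq> 0} \<subseteq> {b \<in> basis C. conv C (coord C b) f \<noteq> 0}"
    for f g a
    by (auto simp: conv_add_right smul_simps[OF D])
  show ?thesis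
    unfolding module.subspace_def[OF vspace_module[OF D]]
    using carrier_zero[OF D] carrier_add[OF D] carrier_smul[OF D]
      finite_subset[OF sub(1)] finite_subset[OF sub(2)]
    by (auto simp: left_rat_def conv_add_right(3))
qed

lemma left_rat_vspace: "is_vspace \<lparr>carrier = left_rat C, smul = smul (dual C), coact = \<rho>\<rparr>"
  using dual_vspace[OF coalgebra_vspace] left_rat_subspace by (simp add: is_vspace_def)

lemma
  shows left_rat_comodule:
    "right_comodule C \<lparr>carrier = left_rat C, smul = smul (dual C), coact = rational_coact C (conv C)\<rparr>"
    and left_rat_coact: "f \<in> carrier (dual C) \<Longrightarrow> m \<in> left_rat C \<Longrightarrow>
      contr (dual C) f (rational_coact C (conv C) m) = conv C f m"
proof -
  let ?M = "\<lparr>carrier = left_rat C, smul = smul (dual C), coact = rational_coact C (conv C)\<rparr>"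
  have fin: "finite {b \<in> basis C. conv C (coord C b) m \<noteq> 0}" if "m \<in> left_rat C" for m
    using that by (simp add: left_rat_def)
  note * = rational_comodule[of ?M "conv C"]
  show "right_comodule C ?M"
    by (rule *(1)) (simp_all add: left_rat_vspace left_rat_conv_left conv_add_right conv_assoc
      conv_eps_left left_rat_dual_carrier fin flip: left_rat_expand)
  have "contr ?M f (coact ?M m) = conv C f m" if "f \<in> carrier (dual C)" "m \<in> left_rat C"
    by (rule *(2)) (simp_all add: that left_rat_vspace left_rat_conv_left conv_add_right conv_assoc
      conv_eps_left left_rat_dual_carrier fin flip: left_rat_expand)
  then show "contr (dual C) f (rational_coact C (conv C) m) = conv C f m"
    if "f \<in> carrier (dual C)" "m \<in> left_rat C"
    using that by (simp add: contr_def)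
qed

text \<open>
  If \<open>x\<close> is in a rational submodule with coaction \<open>\<rho>\<close>, then \<open>b\<^sup>* * x = \<Sum> b\<^sup>*(x\<^sub>1) x\<^sub>0\<close> can only be
  nonzero if \<open>b\<close> occurs in one of the finitely many \<open>x\<^sub>1\<close>.
\<close>

lemma left_rat_dual_eq: "left_rat_dual C = left_rat C"
  unfolding left_rat_dual_def
proof (rule Greatest_equality)
  show "rational_left_submodule C (dual C) (conv C) (left_rat C)"
    unfolding rational_left_submodule_def
    using left_rat_comodule left_rat_subspace left_rat_conv_left left_rat_coact
    by (auto intro: left_rat_dual_carrier simp flip: contr_def)
next
  fix N assume N: "rational_left_submodule C (dual C) (conv C) N"
  then obtain \<rho> where \<rho>: "right_comodule C \<lparr>carrier = N, smul = smul (dual C), coact = \<rho>\<rparr>"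
    "\<And>f x. f \<in> carrier (dual C) \<Longrightarrow> x \<in> N \<Longrightarrow> conv C f x = contr (dual C) f (\<rho> x)"
    unfolding rational_left_submodule_def contr_def by blast
  show "N \<subseteq> left_rat C"
  proof
    fix x assume x: "x \<in> N"
    have "{b \<in> basis C. conv C (coord C b) x \<noteq> 0} \<subseteq> (\<Union>(v, w)\<in>set_mset (\<rho> x). {b. coord C b w \<noteq> 0})"
    proof (rule subsetI, rule ccontr)
      fix b assume b: "b \<in> {b \<in> basis C. conv C (coord C b) x \<noteq> 0}"
        and "b \<notin> (\<Union>(v, w)\<in>set_mset (\<rho> x). {b. coord C b w \<noteq> 0})"
      then have "contr (dual C) (coord C b) (\<rho> x) = contr (dual C) (\<lambda>_. 0) (\<rho> x)"
        by (intro contr_cong) auto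
      also have "\<dots> = 0"
        by (simp add: contr_def smul_simps[OF dual_vspace[OF coalgebra_vspace]])
      finally show False
        using b \<rho>(2)[OF coord_dual[OF coalgebra_vspace] x] by simp
    qed
    moreover have "finite (\<Union>(v, w)\<in>set_mset (\<rho> x). {b. coord C b w \<noteq> 0})"
      using coord_finite[OF coalgebra_vspace] by auto
    moreover have "x \<in> carrier (dual C)"
      using N x by (auto simp: rational_left_submodule_def)
    ultimately show "x \<in> left_rat C"
      by (auto simp: left_rat_def intro: finite_subset)
  qed
qed

end

lemma right_rat_dual_eq:
  assumes C: "coalgebra C"
  shows "right_rat_dual C = left_rat (cop C)"
proof -
  have "rational_right_submodule C (dual C) act N = rational_left_submodule (cop C) (dual C) act N"
    for act N
  proof -
    have swap: "comod_swap \<lparr>carrier = N, smul = smul (dual C), coact = \<rho>\<rparr> =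
        \<lparr>carrier = N, smul = smul (dual C), coact = (\<lambda>x. image_mset prod.swap (\<rho> x))\<rparr>"
      for \<rho> :: "('b \<Rightarrow> 'a) \<Rightarrow> ('x \<times> 'y) multiset"
      by (simp add: comod_swap_def)
    have "(\<exists>\<rho>. left_comodule C \<lparr>carrier = N, smul = smul (dual C), coact = \<rho>\<rparr> \<and>
            (\<forall>f\<in>carrier (dual C). \<forall>x\<in>N. act f x = contr (dual C) f (image_mset prod.swap (\<rho> x)))) \<longleftrightarrow>
          (\<exists>\<rho>. right_comodule (cop C) \<lparr>carrier = N, smul = smul (dual C), coact = \<rho>\<rparr> \<and>
            (\<forall>f\<in>carrier (dual C). \<forall>x\<in>N. act f x = contr (dual C) f (\<rho> x)))" (is "?L \<longleftrightarrow> ?R")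
    proof
      assume ?L then show ?R
        unfolding left_comodule_cop[OF C] swap by blast
    next
      assume ?R
      then obtain \<rho> where "right_comodule (cop C) \<lparr>carrier = N, smul = smul (dual C), coact = \<rho>\<rparr>"
        "\<forall>f\<in>carrier (dual C). \<forall>x\<in>N. act f x = contr (dual C) f (\<rho> x)" by blast
      then show ?L
        unfolding left_comodule_cop[OF C] swap
        by (intro exI[of _ "\<lambda>x. image_mset prod.swap (\<rho> x)"])
           (simp add: image_mset.compositionality)
    qed
    then show ?thesis
      unfolding contr_swap unfolding contr_def by (simp add: rational_right_submodule_def rational_left_submodule_def)
  qed
  then have "right_rat_dual C = left_rat_dual (cop C)"
    by (simp add: right_rat_dual_def left_rat_dual_def conv_cop)
  then show ?thesis
    using left_rat_dual_eq[OF coalgebra_cop[OF C]] by simp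
qed

section \<open>Dense spaces of functionals\<close>

text \<open>
  If some functional \<open>r\<^sub>0\<close> kills \<open>E\<close> but not a further vector \<open>a\<close>, then each functional that kills
  \<open>E\<close> can be corrected by a multiple of \<open>r\<^sub>0\<close> to kill \<open>a\<close> as well, and dually \<open>e\<close> can be corrected by
  a multiple of \<open>a\<close>.
\<close>

lemma separating_functionals_span:
  assumes V: "is_vspace V" and R: "R \<subseteq> carrier (dual V)" "module.subspace (smul (dual V)) R"
    and sep: "\<And>x. x \<in> carrier V \<Longrightarrow> (\<And>r. r \<in> R \<Longrightarrow> r x = 0) \<Longrightarrow> x = 0"
    and E: "finite E" "E \<subseteq> carrier V"
    and e: "e \<in> carrier V" "\<And>r. r \<in> R \<Longrightarrow> (\<And>x. x \<in> E \<Longrightarrow> r x = 0) \<Longrightarrow> r e = 0"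
  shows "e \<in> module.span (smul V) E"
proof -
  interpret V: vector_space "smul V" by (rule vspace_vector_space[OF V])
  interpret D: vector_space "smul (dual V)" by (rule vspace_vector_space[OF dual_vspace[OF V]])
  have lin: "functional V r" if "r \<in> R" for r
    using that R(1) dual_functional by auto
  show ?thesis
    using E e
  proof (induction E arbitrary: e)
    case empty
    then show ?case using sep[of e] by (simp add: V.span_zero)
  next
    case (insert a E)
    have a: "a \<in> carrier V" and E: "E \<subseteq> carrier V" using insert.prems by auto
    show ?case
    proof (cases "\<exists>r\<in>R. (\<forall>x\<in>E. r x = 0) \<and> r a \<noteq> 0")
      case False
      then have "e \<in> V.span E"
        using insert.prems by (intro insert.IH E) auto
      then show ?thesis
        by (meson V.span_mono subsetD subset_insertI)
    next
      case True
      then obtain r0 where r0: "r0 \<in> R" "\<forall>x\<in>E. r0 x = 0" "r0 a \<noteq> 0" by blast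
      define c where "c = r0 e / r0 a"
      have "e - smul V c a \<in> V.span E"
      proof (rule insert.IH[OF E carrier_diff[OF V insert.prems(2) carrier_smul[OF V a]]])
        fix r assume r: "r \<in> R" "\<And>x. x \<in> E \<Longrightarrow> r x = 0"
        let ?r = "r - smul (dual V) (r a / r0 a) r0"
        have "?r \<in> R"
          using r r0 by (intro D.subspace_diff[OF R(2)] D.subspace_scale[OF R(2)])
        moreover have "?r x = 0" if "x \<in> insert a E" for x
          using that r r0 by (auto simp: smul_dual)
        ultimately have "?r e = 0" by (rule insert.prems(3))
        then show "r (e - smul V c a) = 0"
          using r0 insert.prems a
          by (simp add: functional_diff[OF V lin[OF r(1)]] functional_smul[OF lin[OF r(1)]]
              carrier_smul[OF V] smul_dual c_def field_simps)
      qed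
      then have "e - smul V c a + smul V c a \<in> V.span (insert a E)"
        by (meson V.span_add V.span_base V.span_mono V.span_scale insertI1 subsetD subset_insertI)
      then show ?thesis by simp
    qed
  qed
qed

text \<open>
  Interpolation at the points of \<open>E\<close> one at a time; a point outside the span of the earlier ones is
  detected by a functional in \<open>R\<close> that kills all of them.
\<close>

lemma separating_functionals_dense:
  assumes V: "is_vspace V" and R: "R \<subseteq> carrier (dual V)" "module.subspace (smul (dual V)) R"
    and sep: "\<And>x. x \<in> carrier V \<Longrightarrow> (\<And>r. r \<in> R \<Longrightarrow> r x = 0) \<Longrightarrow> x = 0"
    and E: "finite E" "E \<subseteq> carrier V" and f: "functional V f"
  obtains r where "r \<in> R" "\<And>x. x \<in> E \<Longrightarrow> r x = f x"
proof -
  interpret V: vector_space "smul V" by (rule vspace_vector_space[OF V])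
  interpret D: vector_space "smul (dual V)" by (rule vspace_vector_space[OF dual_vspace[OF V]])
  have lin: "functional V r" if "r \<in> R" for r
    using that R(1) dual_functional by auto
  have "\<exists>r\<in>R. \<forall>x\<in>E. r x = f x"
    using E
  proof (induction E)
    case empty
    then show ?case using D.subspace_0[OF R(2)] by auto
  next
    case (insert a E)
    then obtain r where r: "r \<in> R" "\<forall>x\<in>E. r x = f x" by auto
    have a: "a \<in> carrier V" and E: "E \<subseteq> carrier V" using insert.prems by auto
    show ?case
    proof (cases "a \<in> V.span E")
      case True
      have "V.subspace {x \<in> carrier V. r x = f x}"
        unfolding V.subspace_def
        by (auto simp: carrier_zero[OF V] carrier_add[OF V] carrier_smul[OF V]
            functional_zero[OF V] f lin[OF r(1)]
            functional_add[OF f] functional_smul[OF f]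
            functional_add[OF lin[OF r(1)]] functional_smul[OF lin[OF r(1)]])
      then have "V.span E \<subseteq> {x \<in> carrier V. r x = f x}"
        using r E by (intro V.span_minimal) auto
      then show ?thesis using True r by auto
    next
      case False
      then obtain r0 where r0: "r0 \<in> R" "\<And>x. x \<in> E \<Longrightarrow> r0 x = 0" "r0 a \<noteq> 0"
        using separating_functionals_span[OF V R sep insert.hyps(1) E a] by blast
      let ?r = "r + smul (dual V) ((f a - r a) / r0 a) r0"
      have "?r \<in> R"
        using r r0 by (intro D.subspace_add[OF R(2)] D.subspace_scale[OF R(2)])
      moreover have "\<forall>x\<in>insert a E. ?r x = f x"
        using r r0 by (auto simp: smul_dual)
      ultimately show ?thesis by blast
    qed
  qed
  then show ?thesis using that by blast
qed

definition separates :: "('v \<Rightarrow> 'k::zero) set \<Rightarrow> 'v::zero set \<Rightarrow> bool" where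
  "separates R X \<longleftrightarrow> (\<forall>x\<in>X. (\<forall>r\<in>R. r x = 0) \<longrightarrow> x = 0)"

text \<open>
  Elements of the other rational part serve as local units: some \<open>g\<close> there agrees with the
  counit on the finitely many basis elements that belong to \<open>f\<close>, hence \<open>g * f = \<epsilon> * f = f\<close>.
\<close>

lemma left_rat_subset_cop:
  assumes C: "coalgebra C" and sep: "separates (left_rat (cop C)) (carrier C)"
  shows "left_rat C \<subseteq> left_rat (cop C)"
proof
  fix f assume f: "f \<in> left_rat C"
  let ?S = "{b \<in> basis C. conv C (coord C b) f \<noteq> 0}"
  note V = coalgebra_vspace[OF C] and cop = coalgebra_cop[OF C]
  have S: "finite ?S" "?S \<subseteq> carrier C"
    using f basis_carrier[OF V] by (auto simp: left_rat_def)
  have f': "f \<in> carrier (dual C)" using f by (simp add: left_rat_def)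
  obtain g where g: "g \<in> left_rat (cop C)" "\<And>b. b \<in> ?S \<Longrightarrow> g b = eps C b"
    using separating_functionals_dense[OF V _ _ _ S dual_functional[OF eps_dual[OF C]], of "left_rat (cop C)"]
      left_rat_subspace[OF cop] sep
    by (auto simp: left_rat_def separates_def)
  then have g': "g \<in> carrier (dual C)" by (simp add: left_rat_def)
  \<comment> \<open>Both products have the same expansion, as \<open>g\<close> and the counit agree on \<open>?S\<close>.\<close>
  have "conv C g f = conv C (eps C) f"
    unfolding left_rat_expand[OF C f g'] left_rat_expand[OF C f eps_dual[OF C]]
    using g(2) by (intro sum.cong) auto
  then have "f = conv (cop C) f g"
    using conv_eps_left[OF C f'] by (simp add: conv_cop)
  then show "f \<in> left_rat (cop C)"
    using left_rat_conv_left[OF cop g(1), of f] f' by simp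
qed

section \<open>Semiperfect coalgebras\<close>

lemma lin_map_contr:
  assumes V: "is_vspace V" and W: "is_vspace W" and h: "lin_map V W h"
    and s: "set_mset s \<subseteq> carrier V \<times> X"
  shows "h (contr V f s) = contr W f (image_mset (map_prod h id) s)"
proof -
  have add: "x \<in> carrier V \<Longrightarrow> y \<in> carrier V \<Longrightarrow> h (x + y) = h x + h y" 
    and smul: "x \<in> carrier V \<Longrightarrow> h (smul V a x) = smul W a (h x)" for x y a
    using h by (auto simp: lin_map_def)
  have "h 0 = 0"
    using smul[OF carrier_zero[OF V], of 0] by (simp add: smul_simps V W)
  then show ?thesis
    using s by (induction s) (auto simp: add smul carrier_smul[OF V] contr_carrier[OF V])
qed

lemma right_comodule_hom_contr:
  assumes "is_vspace C" "right_comodule C M" "right_comodule C N" "right_comodule_hom C M N h"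
    and "functional C f" "x \<in> carrier M"
  shows "h (contr M f (coact M x)) = contr N f (coact N (h x))"
proof -
  have M: "is_vspace M" "tensor_lin_map M M C (coact M)" and N: "is_vspace N"
    using assms by (auto simp: right_comodule_def)
  have h: "lin_map M N h" "tensor_eq N C (image_mset (map_prod h id) (coact M x)) (coact N (h x))"
    using assms by (auto simp: right_comodule_hom_def)
  show ?thesis
    using lin_map_contr[OF M(1) N h(1) tensor_lin_map_carrier[OF M(2) assms(6)]]
      tensor_eq_contr[OF N assms(5) h(2)] by simp
qed

text \<open>
  The submodules of \<open>C\<close> under \<open>f\<rightharpoonup>x\<close>; they are the right subcomodules of \<open>C\<close>.
\<close>

definition dual_submodule :: "('k::field, 'c::ab_group_add) coalg \<Rightarrow> 'c set \<Rightarrow> bool" where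
  "dual_submodule C S \<longleftrightarrow> S \<subseteq> carrier C \<and> module.subspace (smul C) S \<and>
     (\<forall>f\<in>carrier (dual C). \<forall>x\<in>S. contr C f (comult C x) \<in> S)"

text \<open>
  Semiperfectness speaks of comodules on functions \<open>'c \<times> nat \<Rightarrow> 'k\<close>, so \<open>C\<close> and its subcomodules have
  to be transported there by means of coordinates.
\<close>

definition emb :: "('k::field, 'c::ab_group_add) coalg \<Rightarrow> 'c \<Rightarrow> 'c \<times> nat \<Rightarrow> 'k" where
  "emb C x = (\<lambda>(b, n). if n = 0 then coord C b x else 0)"

definition emb_act ::
  "('k::field, 'c::ab_group_add) coalg \<Rightarrow> ('c \<Rightarrow> 'k) \<Rightarrow> ('c \<times> nat \<Rightarrow> 'k) \<Rightarrow> 'c \<times> nat \<Rightarrow> 'k" where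
  "emb_act C f y = emb C (contr C f (comult C (inv_into (carrier C) (emb C) y)))"

text \<open>
  The representatives of the coaction do not depend on \<open>S\<close>, hence inclusions between the
  comodules \<open>emb_comodule C S\<close> are morphisms by reflexivity of \<open>tensor_eq\<close>.
\<close>

definition emb_comodule ::
  "('k::field, 'c::ab_group_add) coalg \<Rightarrow> 'c set
    \<Rightarrow> ('k, 'c \<times> nat \<Rightarrow> 'k, ('c \<times> nat \<Rightarrow> 'k) \<times> 'c) comod" where
  "emb_comodule C S =
     \<lparr>carrier = emb C ` S, smul = (\<lambda>a y i. a * y i), coact = rational_coact C (emb_act C)\<rparr>"

lemma emb_comodule_simps [simp]:
  "carrier (emb_comodule C S) = emb C ` S" "smul (emb_comodule C S) = (\<lambda>a y i. a * y i)"
  "coact (emb_comodule C S) = rational_coact C (emb_act C)"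
  by (simp_all add: emb_comodule_def)

lemma contr_add_functional:
  assumes "is_vspace V"
  shows "contr V (f + g) s = contr V f s + contr V g s"
    and "contr V (smul (dual W) a f) s = smul V a (contr V f s)"
  by (induction s) (auto simp: smul_simps[OF assms] smul_dual)

context
  fixes C :: "('k::field, 'c::ab_group_add) coalg"
  assumes coalgebra: "coalgebra C"
begin

lemmas vspace_C = coalgebra_vspace[OF coalgebra]
lemmas comult_C = coalgebra_comult[OF coalgebra]

abbreviation (input) act :: "('c \<Rightarrow> 'k) \<Rightarrow> 'c \<Rightarrow> 'c" where
  "act f x \<equiv> contr C f (comult C x)"

lemma act_carrier: "x \<in> carrier C \<Longrightarrow> act f x \<in> carrier C"
  by (rule contr_carrier[OF vspace_C tensor_lin_map_carrier[OF comult_C]])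

lemma act_add: "f \<in> carrier (dual C) \<Longrightarrow> x \<in> carrier C \<Longrightarrow> y \<in> carrier C \<Longrightarrow> act f (x + y) = act f x + act f y"
  by (rule contr_add[OF vspace_C vspace_C dual_functional comult_C])

lemma act_smul: "f \<in> carrier (dual C) \<Longrightarrow> x \<in> carrier C \<Longrightarrow> act f (smul C a x) = smul C a (act f x)"
  by (rule contr_smul[OF vspace_C vspace_C dual_functional comult_C])

lemma act_conv: "f \<in> carrier (dual C) \<Longrightarrow> g \<in> carrier (dual C) \<Longrightarrow> x \<in> carrier C \<Longrightarrow>
    act (conv C f g) x = act f (act g x)"
  using conv_assoc_iff[OF vspace_C comult_C] conv_assoc[OF coalgebra] by blast

lemma act_eps: "x \<in> carrier C \<Longrightarrow> act (eps C) x = x"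
  using contr_eps[OF coalgebra tensor_lin_map_carrier[OF comult_C], of x C] coalgebra by (simp add: coalgebra_iff)

lemma act_coord_finite:
  assumes x: "x \<in> carrier C"
  shows "finite {b. act (coord C b) x \<noteq> 0}"
proof (rule finite_subset)
  show "{b. act (coord C b) x \<noteq> 0} \<subseteq> (\<Union>(v, w)\<in>set_mset (comult C x). {b. coord C b w \<noteq> 0})"
  proof (rule subsetI, rule ccontr)
    fix b assume b: "b \<in> {b. act (coord C b) x \<noteq> 0}"
      and "b \<notin> (\<Union>(v, w)\<in>set_mset (comult C x). {b. coord C b w \<noteq> 0})"
    then have "act (coord C b) x = act (\<lambda>_. 0) x"
      by (intro contr_cong) auto
    with b show False by (simp add: contr_def smul_simps[OF vspace_C])
  qed
  show "finite (\<Union>(v, w)\<in>set_mset (comult C x). {b. coord C b w \<noteq> 0})"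
    using coord_finite[OF vspace_C] by auto
qed

text \<open>
  For \<open>e \<in> C\<^sup>*\<close> put \<open>y = \<Sum> e(x\<^sub>1) x\<^sub>2\<close>.  Then \<open>e(f\<rightharpoonup>x) = f(y)\<close> for all \<open>f\<close>, and the claim, tested by
  \<open>e\<close>, is the expansion of \<open>y\<close> in the basis.
\<close>

lemma act_expand:
  assumes f: "f \<in> carrier (dual C)" and x: "x \<in> carrier C"
  shows "act f x = (\<Sum>b | b \<in> basis C \<and> act (coord C b) x \<noteq> 0. smul C (f b) (act (coord C b) x))"
    (is "_ = (\<Sum>b\<in>?S. _)")
proof (rule coord_separates[OF vspace_C act_carrier[OF x]])
  have S: "finite ?S" "?S \<subseteq> carrier C"
    using act_coord_finite[OF x] basis_carrier[OF vspace_C] by auto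
  show "(\<Sum>b\<in>?S. smul C (f b) (act (coord C b) x)) \<in> carrier C"
    by (intro carrier_sum[OF vspace_C] carrier_smul[OF vspace_C] act_carrier x)
  fix e assume e: "e \<in> carrier (dual C)"
  let ?y = "contr C e (image_mset prod.swap (comult C x))"
  have "set_mset (image_mset prod.swap (comult C x)) \<subseteq> carrier C \<times> carrier C"
    using tensor_lin_map_carrier[OF comult_C x] by auto
  then have y: "?y \<in> carrier C"
    by (rule contr_carrier[OF vspace_C])
  have ey: "h ?y = e (act h x)" if "h \<in> carrier (dual C)" for h
    using conv_left_act[OF vspace_C comult_C e x, of h] conv_right_act[OF vspace_C comult_C that x, of e] by simp
  have "{b. coord C b ?y \<noteq> 0} \<subseteq> ?S"
    using ey[OF coord_dual[OF vspace_C]] coord_nonzero[OF vspace_C] functional_zero[OF vspace_C dual_functional[OF e]] by fastforce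
  then have "f ?y = (\<Sum>b\<in>?S. coord C b ?y * f b)"
    using S y by (intro functional_coord_sum[OF vspace_C dual_functional[OF f]])
  also have "\<dots> = (\<Sum>b\<in>?S. e (smul C (f b) (act (coord C b) x)))"
    by (simp add: ey[OF coord_dual[OF vspace_C]] functional_smul[OF dual_functional[OF e]] act_carrier[OF x] mult.commute)
  also have "\<dots> = e (\<Sum>b\<in>?S. smul C (f b) (act (coord C b) x))"
    by (intro functional_sum[OF vspace_C dual_functional[OF e], symmetric] carrier_smul[OF vspace_C] act_carrier x)
  finally show "e (act f x) = e (\<Sum>b\<in>?S. smul C (f b) (act (coord C b) x))"
    by (simp add: ey[OF f])
qed

lemma emb_add: "x \<in> carrier C \<Longrightarrow> y \<in> carrier C \<Longrightarrow> emb C (x + y) = emb C x + emb C y"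
  by (auto simp: emb_def fun_eq_iff functional_add[OF coord_functional[OF vspace_C]])

lemma emb_smul: "x \<in> carrier C \<Longrightarrow> emb C (smul C a x) = (\<lambda>i. a * emb C x i)"
  by (auto simp: emb_def fun_eq_iff functional_smul[OF coord_functional[OF vspace_C]])

lemma emb_zero: "emb C 0 = 0"
  by (auto simp: emb_def fun_eq_iff functional_zero[OF vspace_C coord_functional[OF vspace_C]])

lemma emb_inj: "inj_on (emb C) (carrier C)"
proof (rule inj_onI)
  fix x y assume xy: "x \<in> carrier C" "y \<in> carrier C" and "emb C x = emb C y"
  then have eq: "coord C b x = coord C b y" for b
    by (auto simp: emb_def fun_eq_iff split: if_splits dest: spec[of _ "(b, 0)" for b])
  have "x = (\<Sum>b | coord C b x \<noteq> 0. smul C (coord C b x) b)"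
    by (rule coord_sum[OF vspace_C xy(1) coord_finite[OF vspace_C] order_refl, symmetric])
  also have "\<dots> = y"
    unfolding eq by (rule coord_sum[OF vspace_C xy(2) coord_finite[OF vspace_C] order_refl])
  finally show "x = y" .
qed

lemma emb_eq_zero: "x \<in> carrier C \<Longrightarrow> emb C x = 0 \<longleftrightarrow> x = 0"
  using inj_onD[OF emb_inj, of x 0] by (auto simp: emb_zero carrier_zero[OF vspace_C])

lemma emb_sum: "(\<And>i. i \<in> I \<Longrightarrow> g i \<in> carrier C) \<Longrightarrow> emb C (\<Sum>i\<in>I. g i) = (\<Sum>i\<in>I. emb C (g i))"
  by (induction I rule: infinite_finite_induct) (auto simp: emb_zero emb_add carrier_sum[OF vspace_C])

lemma emb_act: "x \<in> carrier C \<Longrightarrow> emb_act C f (emb C x) = emb C (act f x)"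
  by (simp add: emb_act_def inv_into_f_f[OF emb_inj])

lemma
  assumes S: "dual_submodule C S"
  shows emb_right_comodule: "right_comodule C (emb_comodule C S)"
    and contr_emb_coact: "f \<in> carrier (dual C) \<Longrightarrow> x \<in> S \<Longrightarrow>
           contr (emb_comodule C S) f (rational_coact C (emb_act C) (emb C x)) = emb C (act f x)"
proof -
  let ?M = "emb_comodule C S"
  have SC: "x \<in> carrier C" if "x \<in> S" for x using S that by (auto simp: dual_submodule_def)
  have Sact: "act f x \<in> S" if "f \<in> carrier (dual C)" "x \<in> S" for f x
    using S that by (auto simp: dual_submodule_def)
  have sub: "0 \<in> S" "x \<in> S \<Longrightarrow> y \<in> S \<Longrightarrow> x + y \<in> S" "x \<in> S \<Longrightarrow> smul C a x \<in> S" for x y a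
    using S by (auto simp: dual_submodule_def module.subspace_def[OF vspace_module[OF vspace_C]])
  have vs: "vector_space (\<lambda>a (y::'c \<times> nat \<Rightarrow> 'k) i. a * y i)"
    by unfold_locales (auto simp: algebra_simps)
  have "module.subspace (\<lambda>a (y::'c \<times> nat \<Rightarrow> 'k) i. a * y i) (emb C ` S)"
    unfolding module.subspace_def[OF vs[folded module_iff_vector_space]]
    using sub(1) sub(2)[THEN imageI[of _ _ "emb C"]] sub(3)[THEN imageI[of _ _ "emb C"]] emb_zero
    by (auto simp: emb_add SC emb_smul simp del: imageI intro!: rev_image_eqI[where f = "emb C", OF sub(1)])
  then have M: "is_vspace ?M"
    using vs by (simp add: is_vspace_def)
  have nz: "emb_act C f (emb C x) \<noteq> 0 \<longleftrightarrow> act f x \<noteq> 0" if "x \<in> S" for f x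
    using SC[OF that] by (simp add: emb_act emb_eq_zero act_carrier)
  note * = rational_comodule[OF coalgebra M, of "emb_act C"]
  have closed: "emb_act C f m \<in> carrier ?M" if "f \<in> carrier (dual C)" "m \<in> carrier ?M" for f m
    using that Sact by (auto simp: emb_act SC)
  have add: "emb_act C f (m + n) = emb_act C f m + emb_act C f n"
    if "f \<in> carrier (dual C)" "m \<in> carrier ?M" "n \<in> carrier ?M" for f m n
    using that by (auto simp: emb_act SC act_add act_carrier emb_act[OF carrier_add[OF vspace_C]] simp flip: emb_add)
  have smul: "emb_act C f (smul ?M a m) = smul ?M a (emb_act C f m)"
    if "f \<in> carrier (dual C)" "m \<in> carrier ?M" for f a m
    using that by (auto simp: emb_act SC act_smul act_carrier emb_act[OF carrier_smul[OF vspace_C]] simp flip: emb_smul)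
  have assoc: "emb_act C (conv C f g) m = emb_act C f (emb_act C g m)"
    if "f \<in> carrier (dual C)" "g \<in> carrier (dual C)" "m \<in> carrier ?M" for f g m
    using that by (auto simp: emb_act SC act_conv act_carrier)
  have unit: "emb_act C (eps C) m = m" if "m \<in> carrier ?M" for m
    using that by (auto simp: emb_act SC act_eps)
  have fin: "finite {b \<in> basis C. emb_act C (coord C b) m \<noteq> 0}" if "m \<in> carrier ?M" for m
    using that act_coord_finite SC by (auto simp: nz)
  have rational: "emb_act C f m = (\<Sum>b | b \<in> basis C \<and> emb_act C (coord C b) m \<noteq> 0.
      smul ?M (f b) (emb_act C (coord C b) m))" if "f \<in> carrier (dual C)" "m \<in> carrier ?M" for f m
  proof -
    obtain x where x: "x \<in> S" "m = emb C x" using \<open>m \<in> carrier ?M\<close> by auto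
    note xC = SC[OF x(1)]
    have "emb_act C f m = emb C (\<Sum>b | b \<in> basis C \<and> act (coord C b) x \<noteq> 0. smul C (f b) (act (coord C b) x))"
      using act_expand[OF that(1) xC] by (simp add: x(2) emb_act[OF xC])
    also have "\<dots> = (\<Sum>b | b \<in> basis C \<and> act (coord C b) x \<noteq> 0. smul ?M (f b) (emb_act C (coord C b) m))"
      by (subst emb_sum) (auto simp: emb_smul x(2) emb_act xC act_carrier carrier_smul[OF vspace_C])
    finally show ?thesis
      using x by (simp add: nz)
  qed
  show "right_comodule C ?M"
    by (rule *(1)[OF _ closed add smul assoc unit fin rational]) auto
  show "contr ?M f (rational_coact C (emb_act C) (emb C x)) = emb C (act f x)"
    if "f \<in> carrier (dual C)" "x \<in> S"
    using *(2)[OF _ closed add smul assoc unit fin rational that(1), of "emb C x"] that SC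
    by (simp add: emb_act)
qed

lemma dual_submodule_orbit:
  assumes x: "x \<in> carrier C"
  shows "dual_submodule C ((\<lambda>f. act f x) ` carrier (dual C))"
proof -
  note D = dual_vspace[OF vspace_C]
  have "module.subspace (smul C) ((\<lambda>f. act f x) ` carrier (dual C))"
    unfolding module.subspace_def[OF vspace_module[OF vspace_C]]
  proof (intro conjI ballI allI)
    show "0 \<in> (\<lambda>f. act f x) ` carrier (dual C)"
      using contr_add_functional(2)[OF vspace_C, of C 0 0 "comult C x"] carrier_zero[OF D]
      by (intro image_eqI[of _ _ 0]) (auto simp: smul_simps[OF vspace_C] smul_simps[OF D])
  next
    fix y z assume "y \<in> (\<lambda>f. act f x) ` carrier (dual C)" "z \<in> (\<lambda>f. act f x) ` carrier (dual C)"
    then show "y + z \<in> (\<lambda>f. act f x) ` carrier (dual C)"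
      using carrier_add[OF D] by (auto simp flip: contr_add_functional(1)[OF vspace_C])
  next
    fix a y assume "y \<in> (\<lambda>f. act f x) ` carrier (dual C)"
    then show "smul C a y \<in> (\<lambda>f. act f x) ` carrier (dual C)"
      using carrier_smul[OF D] by (auto simp flip: contr_add_functional(2)[OF vspace_C, of C])
  qed
  then show ?thesis
    using x act_carrier conv_closed[OF coalgebra] by (auto simp: dual_submodule_def simp flip: act_conv)
qed

text \<open>
  The orbit of a nonzero \<open>x \<in> J\<close> under the dual algebra contains \<open>x\<close> and lies in the span of the
  first components of \<open>\<Delta> x\<close>, so \<open>J\<close> has finite dimensional nonzero submodules.  One of minimal
  dimension is simple.
\<close>

lemma exists_simple_submodule:
  assumes J: "dual_submodule C J" "J \<noteq> {0}"
  obtains S where "dual_submodule C S" "S \<subseteq> J" "S \<noteq> {0}"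
    "\<And>N. dual_submodule C N \<Longrightarrow> N \<subseteq> S \<Longrightarrow> N = {0} \<or> N = S"
proof -
  interpret vector_space "smul C" by (rule vspace_vector_space[OF vspace_C])
  \<comment> \<open>\<open>N\<close> is a candidate with finite basis \<open>B\<close>.\<close>
  define P where "P N B \<longleftrightarrow> dual_submodule C N \<and> N \<subseteq> J \<and> N \<noteq> {0} \<and> finite B \<and> independent B \<and> span B = N"
    for N B
  have "0 \<in> J" using J(1) by (auto simp: dual_submodule_def subspace_0)
  then obtain x where x: "x \<in> J" "x \<noteq> 0" using J(2) by auto
  then have xC: "x \<in> carrier C" using J(1) by (auto simp: dual_submodule_def)
  let ?O = "(\<lambda>f. act f x) ` carrier (dual C)"
  have "act f x \<in> span (fst ` set_mset (comult C x))" for f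
  proof -
    have "contr C f s \<in> span (fst ` set_mset (s + t))" for s t
    proof (induction s arbitrary: t)
      case (add p s)
      then show ?case
        using add[of "add_mset p t"] by (cases p) (auto intro!: span_add span_scale intro: span_base)
    qed (simp add: span_zero)
    from this[of "comult C x" "{#}"] show ?thesis by simp
  qed
  then have sub: "?O \<subseteq> span (fst ` set_mset (comult C x))" by auto
  have "x \<in> ?O" using act_eps[OF xC] eps_dual[OF coalgebra] by (intro image_eqI[of _ _ "eps C"]) auto
  moreover obtain B where B: "B \<subseteq> ?O" "independent B" "?O \<subseteq> span B"
    by (rule maximal_independent_subset)
  moreover have "span B = ?O"
    using B span_minimal[of B ?O] dual_submodule_orbit[OF xC] by (auto simp: dual_submodule_def)
  moreover have "finite B"
    using independent_span_bound[of "fst ` set_mset (comult C x)" B] B sub by auto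
  ultimately have "P ?O B"
    using dual_submodule_orbit[OF xC] J(1) x by (auto simp: P_def dual_submodule_def)
  then have "\<exists>n N B. P N B \<and> card B = n" by blast
  then obtain n where "\<exists>N B. P N B \<and> card B = n" and min: "\<And>m. m < n \<Longrightarrow> \<not> (\<exists>N B. P N B \<and> card B = m)"
    using exists_least_iff[of "\<lambda>n. \<exists>N B. P N B \<and> card B = n"] by blast
  then obtain S B where S: "P S B" "card B = n" by blast
  show ?thesis
  proof (rule that)
    show "dual_submodule C S" "S \<subseteq> J" "S \<noteq> {0}" using S by (auto simp: P_def)
    fix N assume N: "dual_submodule C N" "N \<subseteq> S"
    show "N = {0} \<or> N = S"
    proof (rule disjCI)
      assume "N \<noteq> S"
      show "N = {0}"
      proof (rule ccontr)
        assume "N \<noteq> {0}"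
        obtain B' where B': "B' \<subseteq> N" "independent B'" "N \<subseteq> span B'"
          by (rule maximal_independent_subset)
        have spanB': "span B' = N"
          using B' span_minimal[of B' N] N(1) by (auto simp: dual_submodule_def)
        obtain B'' where B'': "B' \<subseteq> B''" "B'' \<subseteq> S" "independent B''" "S \<subseteq> span B''"
          using maximal_independent_subset_extend[of B' S] B' N(2) by blast
        have "finite B''"
          using independent_span_bound[of B B''] S(1) B'' by (auto simp: P_def)
        moreover have "B' \<noteq> B''"
          using spanB' B'' \<open>N \<noteq> S\<close> N(2) by auto
        ultimately have "card B' < card B''"
          using B'' by (intro psubset_card_mono) auto
        also have "card B'' = card B"
          using basis_card_eq_dim[OF B''(2,4,3)] basis_card_eq_dim[of B S] S(1) span_superset[of B]
          by (auto simp: P_def)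
        finally have "card B' < n" using S(2) by simp
        moreover have "P N B'"
          using N S(1) \<open>N \<noteq> {0}\<close> B' spanB' B''(1) \<open>finite B''\<close> by (auto simp: P_def intro: finite_subset)
        ultimately show False using min by blast
      qed
    qed
  qed
qed

text \<open>
  A subcomodule of \<open>emb_comodule C S\<close> is stable under the dual action, hence it is the image of a
  submodule of \<open>S\<close>.
\<close>

lemma emb_simple_comodule:
  assumes S: "dual_submodule C S" "S \<noteq> {0}"
    and min: "\<And>N. dual_submodule C N \<Longrightarrow> N \<subseteq> S \<Longrightarrow> N = {0} \<or> N = S"
  shows "simple_comodule (right_comodule C) (right_comodule_hom C) (emb_comodule C S)"
proof -
  let ?M = "emb_comodule C S"
  note M = emb_right_comodule[OF S(1)]
  have SC: "S \<subseteq> carrier C" using S(1) by (simp add: dual_submodule_def)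
  have zero: "emb C ` N = {0} \<longleftrightarrow> N = {0}" if "N \<subseteq> S" for N
  proof
    assume N: "emb C ` N = {0}"
    then have "x = 0" if "x \<in> N" for x using that emb_eq_zero[of x] \<open>N \<subseteq> S\<close> SC by blast
    moreover have "N \<noteq> {}" using N by auto
    ultimately show "N = {0}" by blast
  qed (simp add: emb_zero)
  have "carrier N = {0} \<or> carrier N = emb C ` S"
    if N: "subcomodule (right_comodule C) (right_comodule_hom C) N ?M" for N
  proof -
    have N': "right_comodule C N" "carrier N \<subseteq> emb C ` S" "right_comodule_hom C N ?M (\<lambda>x. x)"
      using N by (auto simp: subcomodule_def)
    then have vN: "is_vspace N" and entries: "tensor_lin_map N N C (coact N)"
      and smulN: "\<And>a y. y \<in> carrier N \<Longrightarrow> smul N a y = (\<lambda>i. a * y i)"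
      by (auto simp: right_comodule_def right_comodule_hom_def lin_map_def)
    define T where "T = {x \<in> S. emb C x \<in> carrier N}"
    have T: "carrier N = emb C ` T" using N'(2) by (auto simp: T_def)
    have "dual_submodule C T"
      unfolding dual_submodule_def module.subspace_def[OF vspace_module[OF vspace_C]]
    proof (intro conjI ballI allI)
      show "T \<subseteq> carrier C" using SC by (auto simp: T_def)
      note sub = S(1)[unfolded dual_submodule_def module.subspace_def[OF vspace_module[OF vspace_C]]]
      show "0 \<in> T" using sub carrier_zero[OF vN] by (simp add: T_def emb_zero)
      show "x + y \<in> T" if "x \<in> T" "y \<in> T" for x y
        using that sub SC carrier_add[OF vN] by (auto simp: T_def emb_add subset_iff)
      show "smul C a x \<in> T" if "x \<in> T" for a x
        using that sub SC carrier_smul[OF vN, of "emb C x" a] by (auto simp: T_def emb_smul subset_iff smulN)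
      fix f x assume f: "f \<in> carrier (dual C)" and x: "x \<in> T"
      have "contr N f (coact N (emb C x)) = contr ?M f (coact ?M (emb C x))"
        using right_comodule_hom_contr[OF vspace_C N'(1) M N'(3) dual_functional[OF f], of "emb C x"] x
        by (simp add: T_def)
      also have "\<dots> = emb C (act f x)"
        using contr_emb_coact[OF S(1) f] x by (simp add: T_def)
      finally have "emb C (act f x) \<in> carrier N"
        using contr_carrier[OF vN tensor_lin_map_carrier[OF entries], of "emb C x" f] x by (simp add: T_def)
      then show "act f x \<in> T" using sub f x by (simp add: T_def)
    qed
    then have "T = {0} \<or> T = S" by (rule min) (auto simp: T_def)
    then show ?thesis using T by (auto simp: emb_zero)
  qed
  then show ?thesis
    using M S(2) zero[OF order_refl] by (simp add: simple_comodule_def)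
qed

lemma left_rat_cop_iff:
  "f \<in> left_rat (cop C) \<longleftrightarrow> f \<in> carrier (dual C) \<and> finite {b \<in> basis C. conv C f (coord C b) \<noteq> 0}"
  by (simp add: left_rat_def conv_cop)

text \<open>
  For \<open>f = p \<circ> g\<close>, viewed as a functional on \<open>C\<close>, one has \<open>(f * b\<^sup>*)(x) = f(b\<^sup>*\<rightharpoonup>x) = p(b\<^sup>* \<cdot> g(x))\<close>.  This vanishes unless
  \<open>b\<close> occurs in the coaction of one of the finitely many vectors that span \<open>E\<close>.
\<close>

lemma comodule_map_left_rat:
  assumes E: "right_comodule C E" "finite_dim E"
    and g: "right_comodule_hom C (emb_comodule C (carrier C)) E g"
    and p: "functional E p"
  shows "(\<lambda>x. if x \<in> carrier C then p (g (emb C x)) else 0) \<in> left_rat (cop C)" (is "?f \<in> _")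
proof -
  have CC: "dual_submodule C (carrier C)"
    using act_carrier vspace_subspace[OF vspace_C] by (simp add: dual_submodule_def)
  note M = emb_right_comodule[OF CC]
  have vE: "is_vspace E" and \<rho>: "tensor_lin_map E E C (coact E)"
    using E(1) by (auto simp: right_comodule_def)
  interpret E: vector_space "smul E" by (rule vspace_vector_space[OF vE])
  have lin: "g (emb C x) \<in> carrier E" "g (emb C (x + y)) = g (emb C x) + g (emb C y)"
    "g (emb C (smul C a x)) = smul E a (g (emb C x))"
    if "x \<in> carrier C" "y \<in> carrier C" for x y a
    using g that by (auto simp: right_comodule_hom_def lin_map_def emb_add emb_smul)
  have "functional C (\<lambda>x. p (g (emb C x)))"
    unfolding functional_def using lin functional_add[OF p] functional_smul[OF p] by simp
  then have f: "?f \<in> carrier (dual C)"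
    by (rule functional_restrict[OF vspace_C])
  obtain B where B: "finite B" "carrier E = E.span B"
    using E(2) by (auto simp: finite_dim_def)
  have BE: "B \<subseteq> carrier E" using B(2) E.span_superset by simp
  let ?F = "\<Union>e\<in>B. \<Union>(v, w)\<in>set_mset (coact E e). {b. coord C b w \<noteq> 0}"
  have zero: "contr E (coord C b) (coact E e) = 0" if "b \<notin> ?F" "e \<in> carrier E" for b e
  proof -
    have sub: "E.subspace {e \<in> carrier E. contr E (coord C b) (coact E e) = 0}"
      unfolding E.subspace_def
      using contr_smul[OF vE vE coord_functional[OF vspace_C] \<rho> carrier_zero[OF vE], of _ 0]
      by (auto simp: carrier_zero[OF vE] carrier_add[OF vE] carrier_smul[OF vE] smul_simps[OF vE]
          contr_add[OF vE vE coord_functional[OF vspace_C] \<rho>] contr_smul[OF vE vE coord_functional[OF vspace_C] \<rho>])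
    have "contr E (coord C b) (coact E e) = 0" if "e \<in> B" for e
    proof -
      have "contr E (coord C b) (coact E e) = contr E (\<lambda>_. 0) (coact E e)"
        using \<open>b \<notin> ?F\<close> that by (intro contr_cong) auto
      then show ?thesis by (simp add: contr_def)
    qed
    then have "E.span B \<subseteq> {e \<in> carrier E. contr E (coord C b) (coact E e) = 0}"
      using BE by (intro E.span_minimal sub) auto
    then show ?thesis using that(2) B(2) by auto
  qed
  have "{b \<in> basis C. conv C ?f (coord C b) \<noteq> 0} \<subseteq> ?F"
  proof (rule subsetI, rule ccontr)
    fix b assume b: "b \<in> {b \<in> basis C. conv C ?f (coord C b) \<noteq> 0}" "b \<notin> ?F"
    have "conv C ?f (coord C b) x = 0" for x
    proof (cases "x \<in> carrier C")
      case True
      have "g (emb C (act (coord C b) x)) = contr E (coord C b) (coact E (g (emb C x)))"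
        using right_comodule_hom_contr[OF vspace_C M E(1) g coord_functional[OF vspace_C], of "emb C x" b]
          contr_emb_coact[OF CC coord_dual[OF vspace_C] True] True by simp
      also have "\<dots> = 0" using b(2) lin(1) True by (intro zero) auto
      finally show ?thesis
        using functional_zero[OF vE p] True
        by (simp add: conv_left_act[OF vspace_C comult_C f True] act_carrier[OF True])
    qed (simp add: conv_outside)
    with b(1) show False by (auto simp: fun_eq_iff)
  qed
  moreover have "finite ?F" using B(1) coord_finite[OF vspace_C] by auto
  ultimately show ?thesis
    using f by (auto simp: left_rat_cop_iff intro: finite_subset)
qed

text \<open>
  A simple subcomodule of the common kernel \<open>J\<close> of all these functionals would have a finite
  dimensional injective envelope \<open>E\<close>.  Its embedding into \<open>E\<close> extends to \<open>C\<close>, and composing the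
  extension with functionals on \<open>E\<close> yields rational functionals that do not all vanish on \<open>J\<close>.
\<close>

lemma left_semiperfect_separates:
  assumes sp: "left_semiperfect C"
  shows "separates (left_rat (cop C)) (carrier C)"
proof -
  note cop = coalgebra_cop[OF coalgebra]
  define J where "J = {x \<in> carrier C. \<forall>r\<in>left_rat (cop C). r x = 0}"
  have lin: "functional C r" if "r \<in> left_rat (cop C)" for r
    using that dual_functional by (auto simp: left_rat_def)
  \<comment> \<open>\<open>J\<close> is stable under the action because \<open>r(f\<rightharpoonup>x) = (r * f)(x)\<close>, and \<open>r * f\<close> is rational again.\<close>
  have "r (act f x) = 0" if "f \<in> carrier (dual C)" "x \<in> J" "r \<in> left_rat (cop C)" for f x r
  proof -
    have "r \<in> carrier (dual C)" "x \<in> carrier C" using that by (auto simp: left_rat_def J_def)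
    then have "r (act f x) = conv (cop C) f r x"
      by (simp add: conv_left_act[OF vspace_C comult_C] conv_cop)
    then show ?thesis
      using left_rat_conv_left[OF cop that(3), of f] that by (auto simp: J_def)
  qed
  then have J: "dual_submodule C J"
    unfolding dual_submodule_def module.subspace_def[OF vspace_module[OF vspace_C]]
    by (auto simp: J_def carrier_zero[OF vspace_C] carrier_add[OF vspace_C] carrier_smul[OF vspace_C] act_carrier
        functional_zero[OF vspace_C lin] functional_add[OF lin] functional_smul[OF lin])
  have "J = {0}"
  proof (rule ccontr)
    assume "J \<noteq> {0}"
    then obtain S where S: "dual_submodule C S" "S \<subseteq> J" "S \<noteq> {0}"
      and min: "\<And>N. dual_submodule C N \<Longrightarrow> N \<subseteq> S \<Longrightarrow> N = {0} \<or> N = S"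
      using exists_simple_submodule[OF J] by metis
    let ?S = "emb_comodule C S" and ?C = "emb_comodule C (carrier C)"
    obtain E j where env: "injective_envelope (right_comodule C) (right_comodule_hom C) ?S E j"
      and fin: "finite_dim E"
      using sp emb_simple_comodule[OF S(1,3) min] unfolding left_semiperfect_def by blast
    have j: "right_comodule_hom C ?S E j" "inj_on j (emb C ` S)" and E: "right_comodule C E"
      using env by (auto simp: injective_envelope_def injective_comodule_def)
    have CC: "dual_submodule C (carrier C)"
      using act_carrier vspace_subspace[OF vspace_C] by (simp add: dual_submodule_def)
    have SC: "S \<subseteq> carrier C" using S(1) by (simp add: dual_submodule_def)
    have "right_comodule_hom C ?S ?C (\<lambda>x. x)"
      using SC by (auto simp: right_comodule_hom_def lin_map_def id_def[symmetric] map_prod.id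
          intro: tensor_eq.refl)
    then obtain g where g: "right_comodule_hom C ?C E g" "\<And>y. y \<in> emb C ` S \<Longrightarrow> g y = j y"
      using env emb_right_comodule[OF S(1)] emb_right_comodule[OF CC] j(1)
      unfolding injective_envelope_def injective_comodule_def by force
    have vE: "is_vspace E" using E by (simp add: right_comodule_def)
    have S0: "0 \<in> S" using S(1) by (simp add: dual_submodule_def module.subspace_0[OF vspace_module[OF vspace_C]])
    then obtain x where x: "x \<in> S" "x \<noteq> 0" using S(3) by auto
    have j_lin: "lin_map ?S E j" using j(1) by (simp add: right_comodule_hom_def)
    have "emb C 0 \<in> carrier ?S" using S0 by simp
    then have "j (smul ?S 0 (emb C 0)) = smul E 0 (j (emb C 0))"
      using j_lin unfolding lin_map_def by blast
    then have "j (emb C 0) = 0"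
      by (simp add: smul_simps[OF vE] emb_zero zero_fun_def)
    moreover have "emb C x \<noteq> emb C 0"
      using inj_onD[OF emb_inj, of x 0] x SC carrier_zero[OF vspace_C] by auto
    ultimately have "j (emb C x) \<noteq> 0"
      using inj_onD[OF j(2), of "emb C x" "emb C 0"] x S0 by auto
    moreover have "j (emb C x) \<in> carrier E"
      using j_lin x by (auto simp: lin_map_def)
    ultimately obtain p where p: "p \<in> carrier (dual E)" "p (j (emb C x)) \<noteq> 0"
      using coord_separates[OF vE _ carrier_zero[OF vE], of "j (emb C x)"]
        functional_zero[OF vE dual_functional] by metis
    have "(\<lambda>x. if x \<in> carrier C then p (g (emb C x)) else 0) \<in> left_rat (cop C)"
      by (rule comodule_map_left_rat[OF E fin g(1) dual_functional[OF p(1)]])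
    then have "p (g (emb C x)) = 0"
      using x(1) S(2) SC by (force simp: J_def)
    then show False
      using p(2) g(2) x(1) by simp
  qed
  then show ?thesis
    by (auto simp: separates_def J_def)
qed

end

text \<open>
  \<open>comod_swap\<close> is a bijection between right comodules over \<open>cop C\<close> and left comodules over \<open>C\<close> that
  respects morphisms, hence also simple and injective comodules and injective envelopes.
\<close>

lemma left_semiperfect_cop:
  fixes C :: "('k::field, 'c::ab_group_add) coalg"
  assumes C: "coalgebra C" and sp: "right_semiperfect C"
  shows "left_semiperfect (cop C)"
proof -
  have ob: "left_comodule C (comod_swap M) = right_comodule (cop C) M"
    for M :: "('k, 'c \<times> nat \<Rightarrow> 'k, ('c \<times> nat \<Rightarrow> 'k) \<times> 'c) comod"
    by (simp add: left_comodule_cop[OF C])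
  have hom: "left_comodule_hom C (comod_swap M) (comod_swap N) f = right_comodule_hom (cop C) M N f"
    if "right_comodule (cop C) N"
    for M N :: "('k, 'c \<times> nat \<Rightarrow> 'k, ('c \<times> nat \<Rightarrow> 'k) \<times> 'c) comod" and f
    using that left_comodule_hom_cop[OF coalgebra_vspace[OF C], of "comod_swap N" "comod_swap M" f]
    by (simp add: right_comodule_def)
  have all: "(\<forall>N. P N) \<longleftrightarrow> (\<forall>N. P (comod_swap N))"
    for P :: "('k, 'c \<times> nat \<Rightarrow> 'k, 'c \<times> ('c \<times> nat \<Rightarrow> 'k)) comod \<Rightarrow> bool"
    by (metis comod_swap_swap)
  have all2: "(\<forall>X Y. P X Y) \<longleftrightarrow> (\<forall>X Y. P (comod_swap X) (comod_swap Y))"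
    for P :: "('k, 'c \<times> nat \<Rightarrow> 'k, 'c \<times> ('c \<times> nat \<Rightarrow> 'k)) comod \<Rightarrow>
              ('k, 'c \<times> nat \<Rightarrow> 'k, 'c \<times> ('c \<times> nat \<Rightarrow> 'k)) comod \<Rightarrow> bool"
    by (metis comod_swap_swap)
  have sub: "subcomodule (left_comodule C) (left_comodule_hom C) (comod_swap N) (comod_swap M) =
      subcomodule (right_comodule (cop C)) (right_comodule_hom (cop C)) N M"
    for M N :: "('k, 'c \<times> nat \<Rightarrow> 'k, ('c \<times> nat \<Rightarrow> 'k) \<times> 'c) comod"
    by (auto simp: subcomodule_def ob hom)
  have simple: "simple_comodule (left_comodule C) (left_comodule_hom C) (comod_swap M) =
      simple_comodule (right_comodule (cop C)) (right_comodule_hom (cop C)) M"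
    for M :: "('k, 'c \<times> nat \<Rightarrow> 'k, ('c \<times> nat \<Rightarrow> 'k) \<times> 'c) comod"
    unfolding simple_comodule_def by (subst all) (simp add: ob sub)
  have inj: "injective_comodule (left_comodule C) (left_comodule_hom C) (comod_swap E) =
      injective_comodule (right_comodule (cop C)) (right_comodule_hom (cop C)) E"
    for E :: "('k, 'c \<times> nat \<Rightarrow> 'k, ('c \<times> nat \<Rightarrow> 'k) \<times> 'c) comod"
    unfolding injective_comodule_def
    by (subst all2) (simp add: ob hom cong: conj_cong)
  have env: "injective_envelope (left_comodule C) (left_comodule_hom C) (comod_swap S) (comod_swap E) j =
      injective_envelope (right_comodule (cop C)) (right_comodule_hom (cop C)) S E j"
    for S E :: "('k, 'c \<times> nat \<Rightarrow> 'k, ('c \<times> nat \<Rightarrow> 'k) \<times> 'c) comod" and j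
  proof (cases "right_comodule (cop C) E")
    case True
    then show ?thesis
      unfolding injective_envelope_def by (subst all) (simp add: ob sub inj hom)
  next
    case False
    then have "\<not> injective_comodule (right_comodule (cop C)) (right_comodule_hom (cop C)) E"
      by (simp add: injective_comodule_def)
    then show ?thesis
      by (simp add: injective_envelope_def inj)
  qed
  show ?thesis
    unfolding left_semiperfect_def
  proof (intro allI impI)
    fix S :: "('k, 'c \<times> nat \<Rightarrow> 'k, ('c \<times> nat \<Rightarrow> 'k) \<times> 'c) comod"
    assume "simple_comodule (right_comodule (cop C)) (right_comodule_hom (cop C)) S"
    then obtain E j where E: "injective_envelope (left_comodule C) (left_comodule_hom C) (comod_swap S) E j"
      "finite_dim E"
      using sp simple unfolding right_semiperfect_def by blast
    have "injective_envelope (right_comodule (cop C)) (right_comodule_hom (cop C)) S (comod_swap E) j"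
      using env[of S "comod_swap E"] E(1) by simp
    moreover have "finite_dim (comod_swap E)"
      using E(2) by (simp add: finite_dim_def)
    ultimately show "\<exists>E j. injective_envelope (right_comodule (cop C)) (right_comodule_hom (cop C)) S E j \<and> finite_dim E"
      by blast
  qed
qed

lemma semiperfect_left_rat:
  assumes C: "coalgebra C" and sp: "semiperfect C"
  shows "left_rat (cop C) = left_rat C" and "separates (left_rat C) (carrier C)"
proof -
  note cop = coalgebra_cop[OF C]
  have sep: "separates (left_rat (cop C)) (carrier C)" "separates (left_rat C) (carrier C)"
    using left_semiperfect_separates[OF C] left_semiperfect_separates[OF cop]
      left_semiperfect_cop[OF C] sp by (auto simp: semiperfect_def)
  then show "separates (left_rat C) (carrier C)" by blast
  show "left_rat (cop C) = left_rat C"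
    using left_rat_subset_cop[OF C] left_rat_subset_cop[OF cop] sep by auto
qed

section \<open>The bicomodule of rational functionals\<close>

text \<open>
  Pairing with \<open>g \<otimes> h \<otimes> f\<close> turns the compatibility of the two coactions into
  \<open>f \<cdot> (m \<cdot> g) = (f \<cdot> m) \<cdot> g\<close>.
\<close>

lemma bicomodule_compat_iff:
  fixes M :: "('k::field, 'm::ab_group_add, 'y) vspace_scheme" and C :: "('k, 'c::ab_group_add) coalg"
  assumes C: "is_vspace C" and M: "is_vspace M"
    and l: "tensor_lin_map M C M l" and r: "tensor_lin_map M M C r"
  defines "l' \<equiv> \<lambda>m. image_mset prod.swap (l m)"
  shows "(\<forall>m\<in>carrier M. tensor3_eq C M C
           (\<Sum>(m\<^sub>1, m\<^sub>0)\<in>#l m. image_mset (\<lambda>(u, v). (m\<^sub>1, u, v)) (r m\<^sub>0))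
           (\<Sum>(m\<^sub>0, m\<^sub>1)\<in>#r m. image_mset (\<lambda>(u, v). (u, v, m\<^sub>1)) (l m\<^sub>0))) \<longleftrightarrow>
         (\<forall>f\<in>carrier (dual C). \<forall>g\<in>carrier (dual C). \<forall>m\<in>carrier M.
           contr M f (r (contr M g (l' m))) = contr M g (l' (contr M f (r m))))"
    (is "(\<forall>m\<in>_. tensor3_eq C M C (?s m) (?t m)) \<longleftrightarrow> (\<forall>f\<in>_. \<forall>g\<in>_. \<forall>m\<in>_. ?p f g m = ?q f g m)")
proof -
  have l': "tensor_lin_map M M C l'"
    unfolding l'_def using l by (simp add: tensor_lin_map_swap M C)
  note l_carrier = tensor_lin_map_carrier[OF l]
  note l'_carrier = tensor_lin_map_carrier[OF l']
  note r_carrier = tensor_lin_map_carrier[OF r]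
  note contr_l = contr_carrier[OF M l'_carrier] and contr_r = contr_carrier[OF M r_carrier]
  have swap: "pair2 f e (l m) = pair2 e f (l' m)" for e f m
    by (simp add: l'_def pair2_swap)
  have s: "pair3 g h f (?s m) = h (?p f g m)"
    if "h \<in> carrier (dual M)" "f \<in> carrier (dual C)" "g \<in> carrier (dual C)" "m \<in> carrier M" for f g h m
  proof -
    have lin: "functional M (\<lambda>m. pair2 h f (r m))"
      using r that by (simp add: tensor_lin_map_iff M C)
    have "pair3 g h f (?s m) = pair2 g (\<lambda>m. pair2 h f (r m)) (l m)"
      unfolding pair3_right by (rule sum_mset_pair2) simp
    also have "\<dots> = pair2 h f (r (contr M g (l' m)))"
      unfolding swap by (rule functional_contr[OF M lin l'_carrier[OF that(4)], symmetric])
    also have "\<dots> = h (?p f g m)"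
      by (rule functional_contr[OF M dual_functional[OF that(1)] r_carrier, symmetric])
         (rule contr_l[OF that(4)])
    finally show ?thesis .
  qed
  have t: "pair3 g h f (?t m) = h (?q f g m)"
    if "h \<in> carrier (dual M)" "f \<in> carrier (dual C)" "g \<in> carrier (dual C)" "m \<in> carrier M" for f g h m
  proof -
    have lin: "functional M (\<lambda>m. pair2 h g (l' m))"
      using l' that by (simp add: tensor_lin_map_iff M C)
    have "pair3 g h f (?t m) = pair2 (\<lambda>m. pair2 h g (l' m)) f (r m)"
      unfolding pair3_left by (rule sum_mset_pair2) (simp add: swap)
    also have "\<dots> = pair2 h g (l' (contr M f (r m)))"
      by (rule functional_contr[OF M lin r_carrier[OF that(4)], symmetric])
    also have "\<dots> = h (?q f g m)"
      by (rule functional_contr[OF M dual_functional[OF that(1)] l'_carrier, symmetric])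
         (rule contr_r[OF that(4)])
    finally show ?thesis .
  qed
  have carrier: "set_mset (?s m) \<subseteq> carrier C \<times> carrier M \<times> carrier C"
    "set_mset (?t m) \<subseteq> carrier C \<times> carrier M \<times> carrier C" if "m \<in> carrier M" for m
    by - (rule iterate_left_carrier iterate_right_carrier, (rule l_carrier r_carrier, (rule that | assumption))+)+
  show ?thesis
  proof (intro iffI ballI)
    fix f g m assume *: "\<forall>m\<in>carrier M. tensor3_eq C M C (?s m) (?t m)"
      "f \<in> carrier (dual C)" "g \<in> carrier (dual C)" "m \<in> carrier M"
    show "?p f g m = ?q f g m"
    proof (rule coord_separates[OF M])
      fix h assume h: "h \<in> carrier (dual M)"
      have "pair3 g h f (?s m) = pair3 g h f (?t m)"
        using * h by (intro tensor3_eq_pair3[OF C]) (auto intro: dual_functional)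
      then show "h (?p f g m) = h (?q f g m)"
        using s t * h by simp
    qed (use * contr_r contr_l in auto)
  next
    fix m assume *: "\<forall>f\<in>carrier (dual C). \<forall>g\<in>carrier (dual C). \<forall>m\<in>carrier M. ?p f g m = ?q f g m"
      "m \<in> carrier M"
    show "tensor3_eq C M C (?s m) (?t m)"
      using * s t by (intro tensor3_eqI[OF C M C] carrier) auto
  qed
qed

lemma contr_cong_smul: "smul V = smul W \<Longrightarrow> contr V = contr W"
  by (simp add: contr_def fun_eq_iff)

definition lact :: "('k, 'm::ab_group_add, 'c) bicomod \<Rightarrow> ('c \<Rightarrow> 'k) \<Rightarrow> 'm \<Rightarrow> 'm" where
  "lact M f m = contr M f (rcoact M m)"

definition ract :: "('k, 'm::ab_group_add, 'c) bicomod \<Rightarrow> 'm \<Rightarrow> ('c \<Rightarrow> 'k) \<Rightarrow> 'm" where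
  "ract M m f = contr M f (image_mset prod.swap (lcoact M m))"

text \<open>
  A bicomodule is a bimodule over the dual algebra whose two actions come from linear coactions.
\<close>

lemma bicomodule_iff:
  fixes C :: "('k::field, 'c::ab_group_add) coalg" and M :: "('k, 'm::ab_group_add, 'c) bicomod"
  assumes C: "coalgebra C"
  shows "bicomodule C M \<longleftrightarrow> is_vspace M \<and>
     tensor_lin_map M C M (lcoact M) \<and> tensor_lin_map M M C (rcoact M) \<and>
     (\<forall>f\<in>carrier (dual C). \<forall>g\<in>carrier (dual C). \<forall>m\<in>carrier M.
        lact M (conv C f g) m = lact M f (lact M g m) \<and>
        ract M m (conv C f g) = ract M (ract M m f) g \<and>
        lact M f (ract M m g) = ract M (lact M f m) g) \<and>
     (\<forall>m\<in>carrier M. lact M (counit C) m = m \<and> ract M m (counit C) = m)"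
proof (cases "is_vspace M")
  case M: True
  note V = coalgebra_vspace[OF C]
  let ?L = "\<lparr>carrier = carrier M, smul = smul M, coact = lcoact M\<rparr>"
  let ?R = "\<lparr>carrier = carrier M, smul = smul M, coact = rcoact M\<rparr>"
  have LR: "is_vspace ?L" "is_vspace ?R" "(contr ?L :: ('c \<Rightarrow> 'k) \<Rightarrow> _) = contr M" "(contr ?R :: ('c \<Rightarrow> 'k) \<Rightarrow> _) = contr M"
    using M is_vspace_cong[of ?L M] is_vspace_cong[of ?R M]
    by (auto intro!: contr_cong_smul)
  have tlm: "tensor_lin_map ?L C ?L (lcoact M) = tensor_lin_map M C M (lcoact M)"
    "tensor_lin_map ?R ?R C (rcoact M) = tensor_lin_map M M C (rcoact M)"
    using tensor_lin_map_cong[OF M V M, of ?L C ?L] tensor_lin_map_cong[OF M M V, of ?R ?R C]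
    by simp_all
  show ?thesis
    unfolding bicomodule_def left_comodule_iff[OF C] right_comodule_iff[OF C] lact_def ract_def
    using LR tlm M bicomodule_compat_iff[OF V M, of "lcoact M" "rcoact M"]
    by (simp cong: conj_cong) blast
next
  case False
  then show ?thesis
    using is_vspace_cong[of M "\<lparr>carrier = carrier M, smul = smul M, coact = rcoact M\<rparr>"]
    by (auto simp: bicomodule_def right_comodule_def)
qed

lemma rat_bicomodule_iff:
  "rat_bicomodule C M \<longleftrightarrow> bicomodule C M \<and>
     carrier M = left_rat_dual C \<and> carrier M = right_rat_dual C \<and> smul M = smul (dual C) \<and>
     (\<forall>f\<in>carrier (dual C). \<forall>m\<in>carrier M. lact M f m = conv C f m \<and> ract M m f = conv C m f)"
  unfolding rat_bicomodule_def lact_def ract_def contr_swap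
  unfolding contr_def by (auto simp: eq_commute)

text \<open>
  Both coactions are the ones forced by convolution; the left one is a right coaction over \<open>cop C\<close>
  with its components swapped, which is where the two rational parts have to coincide.
\<close>

lemma rat_bicomodule_exists:
  fixes C :: "('k::field, 'c::ab_group_add) coalg"
  assumes C: "coalgebra C" and rat: "left_rat (cop C) = left_rat C"
  shows "\<exists>M. rat_bicomodule C M"
proof -
  note V = coalgebra_vspace[OF C] and cop = coalgebra_cop[OF C]
  define M :: "('k, 'c \<Rightarrow> 'k, 'c) bicomod" where
    "M = \<lparr>carrier = left_rat C, smul = smul (dual C),
          lcoact = (\<lambda>m. image_mset prod.swap (rational_coact (cop C) (conv (cop C)) m)),
          rcoact = rational_coact C (conv C)\<rparr>"
  have M [simp]: "carrier M = left_rat C" "smul M = smul (dual C)"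
    "rcoact M = rational_coact C (conv C)"
    "lcoact M = (\<lambda>m. image_mset prod.swap (rational_coact (cop C) (conv (cop C)) m))"
    by (simp_all add: M_def)
  have contr_M: "contr M = contr (dual C)"
    by (rule contr_cong_smul) simp
  have lact: "lact M f m = conv C f m" and ract: "ract M m f = conv C m f"
    if "f \<in> carrier (dual C)" "m \<in> left_rat C" for f m
    using left_rat_coact[OF C that] left_rat_coact[OF cop, of f m] that rat
    by (simp_all add: lact_def ract_def contr_M conv_cop)
  have vM: "is_vspace M"
    using left_rat_vspace[OF C] by (simp add: is_vspace_def)
  let ?R = "\<lparr>carrier = left_rat C, smul = smul (dual C), coact = rcoact M\<rparr>"
  let ?L = "\<lparr>carrier = left_rat C, smul = smul (dual C), coact = lcoact M\<rparr>"
  have R: "right_comodule C ?R"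
    using left_rat_comodule[OF C] by simp
  have L: "left_comodule C ?L"
    using left_rat_comodule[OF cop] rat unfolding left_comodule_cop[OF C]
    by (simp add: comod_swap_def)
  have tlm: "tensor_lin_map M C M (lcoact M)" "tensor_lin_map M M C (rcoact M)"
    using L R tensor_lin_map_cong[OF vM V vM, of ?L C ?L] tensor_lin_map_cong[OF vM vM V, of ?R ?R C]
    by (simp_all add: left_comodule_def right_comodule_def)
  have tlm_swap: "tensor_lin_map M M C (\<lambda>m. image_mset prod.swap (lcoact M m))"
    using tlm(1) tensor_lin_map_swap[OF vM V vM] by blast
  have "lact M (counit C) m = m" "ract M m (counit C) = m" if m: "m \<in> left_rat C" for m
  proof -
    have "set_mset (rcoact M m) \<subseteq> left_rat C \<times> carrier C"
      "set_mset (image_mset prod.swap (lcoact M m)) \<subseteq> left_rat C \<times> carrier C"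
      using tensor_lin_map_carrier[OF tlm(2), of m] tensor_lin_map_carrier[OF tlm_swap, of m] m by simp_all
    from this[THEN contr_eps[OF C], of M] show "lact M (counit C) m = m" "ract M m (counit C) = m"
      using lact[OF eps_dual[OF C] m] ract[OF eps_dual[OF C] m] conv_eps_left[OF C] conv_eps_right[OF C]
        left_rat_dual_carrier[OF C m]
      by (simp_all add: lact_def ract_def)
  qed
  then have "bicomodule C M"
    unfolding bicomodule_iff[OF C]
    using vM tlm left_rat_conv_left[OF C] left_rat_conv_left[OF cop] rat
    by (auto simp: lact ract conv_closed[OF C] conv_cop conv_assoc[OF C] left_rat_dual_carrier[OF C])
  then have "rat_bicomodule C M"
    using lact ract left_rat_dual_eq[OF C] right_rat_dual_eq[OF C] rat
    by (simp add: rat_bicomodule_iff)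
  then show ?thesis by blast
qed

section \<open>Trivial coextensions\<close>

lemma trivial_coextension_simps [simp]:
  "carrier (trivial_coextension C M) = carrier C \<times> carrier M"
  "smul (trivial_coextension C M) a (c, m) = (smul C a c, smul M a m)"
  "counit (trivial_coextension C M) (c, m) = counit C c"
  by (simp_all add: trivial_coextension_def)

lemma comult_trivial_coextension:
  "comult (trivial_coextension C M) (c, m) =
     image_mset (\<lambda>(c\<^sub>1, c\<^sub>2). ((c\<^sub>1, 0), (c\<^sub>2, 0))) (comult C c) +
     image_mset (\<lambda>(m\<^sub>1, m\<^sub>0). ((m\<^sub>1, 0), (0, m\<^sub>0))) (lcoact M m) +
     image_mset (\<lambda>(m\<^sub>0, m\<^sub>1). ((0, m\<^sub>0), (m\<^sub>1, 0))) (rcoact M m)"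
  by (simp add: trivial_coextension_def)

lemma vspace_trivial_coextension:
  assumes C: "is_vspace C" and M: "is_vspace M"
  shows "is_vspace (trivial_coextension C M)" (is "is_vspace ?D")
proof -
  have sm: "smul ?D = (\<lambda>a x. (smul C a (fst x), smul M a (snd x)))"
    by (auto simp: fun_eq_iff)
  have vs: "vector_space (smul ?D)"
    unfolding sm
    by unfold_locales (auto simp: smul_simps[OF C] smul_simps[OF M])
  then have "module.subspace (smul ?D) (carrier ?D)"
    unfolding module.subspace_def[OF vs[folded module_iff_vector_space]]
    by (auto simp: zero_prod_def carrier_zero[OF C] carrier_zero[OF M] carrier_add[OF C] carrier_add[OF M]
        carrier_smul[OF C] carrier_smul[OF M])
  with vs show ?thesis by (simp add: is_vspace_def)
qed

lemma functional_trivial_coextension: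
  assumes C: "is_vspace C" and M: "is_vspace M"
  shows "functional (trivial_coextension C M) F \<longleftrightarrow>
    functional C (\<lambda>c. F (c, 0)) \<and> functional M (\<lambda>m. F (0, m)) \<and>
    (\<forall>c\<in>carrier C. \<forall>m\<in>carrier M. F (c, m) = F (c, 0) + F (0, m))" (is "?L \<longleftrightarrow> ?R")
proof
  assume L: ?L
  then have add: "F ((c, m) + (c', m')) = F (c, m) + F (c', m')"
    and sm: "F (smul C a c, smul M a m) = a * F (c, m)"
    if "c \<in> carrier C" "m \<in> carrier M" "c' \<in> carrier C" "m' \<in> carrier M" for c m c' m' a
    using that functional_add[OF L, of "(c, m)" "(c', m')"] functional_smul[OF L, of "(c, m)"] by auto
  show ?R
    unfolding functional_def
  proof (intro conjI ballI allI)
    note zero = carrier_zero[OF C] carrier_zero[OF M]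
    show "F (c + c', 0) = F (c, 0) + F (c', 0)" if "c \<in> carrier C" "c' \<in> carrier C" for c c'
      using add[OF that(1) zero(2) that(2) zero(2)] by simp
    show "F (smul C a c, 0) = a * F (c, 0)" if "c \<in> carrier C" for a c
      using sm[OF that zero(2) that zero(2)] by (simp add: smul_simps[OF M])
    show "F (0, m + m') = F (0, m) + F (0, m')" if "m \<in> carrier M" "m' \<in> carrier M" for m m'
      using add[OF zero(1) that(1) zero(1) that(2)] by simp
    show "F (0, smul M a m) = a * F (0, m)" if "m \<in> carrier M" for a m
      using sm[OF zero(1) that zero(1) that] by (simp add: smul_simps[OF C])
    show "F (c, m) = F (c, 0) + F (0, m)" if "c \<in> carrier C" "m \<in> carrier M" for c m
      using add[OF that(1) zero(2) zero(1) that(2)] by simp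
  qed
next
  assume R: ?R
  then have add: "F (c + c', 0) = F (c, 0) + F (c', 0)" "F (smul C a c, 0) = a * F (c, 0)"
    if "c \<in> carrier C" "c' \<in> carrier C" for c c' a
    using that functional_add[of C "\<lambda>c. F (c, 0)"] functional_smul[of C "\<lambda>c. F (c, 0)"] by auto
  have add': "F (0, m + m') = F (0, m) + F (0, m')" "F (0, smul M a m) = a * F (0, m)"
    if "m \<in> carrier M" "m' \<in> carrier M" for m m' a
    using R that functional_add[of M "\<lambda>m. F (0, m)"] functional_smul[of M "\<lambda>m. F (0, m)"] by auto
  have split: "F (c, m) = F (c, 0) + F (0, m)" if "c \<in> carrier C" "m \<in> carrier M" for c m
    using R that by blast
  show ?L
    unfolding functional_def
    by (auto simp: split[OF carrier_add[OF C] carrier_add[OF M]]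
        split[OF carrier_smul[OF C] carrier_smul[OF M]] add add' algebra_simps) (simp_all add: split algebra_simps)
qed

lemma dual_trivial_coextension:
  assumes C: "is_vspace C" and M: "is_vspace M" and F: "F \<in> carrier (dual (trivial_coextension C M))"
  shows "(\<lambda>c. F (c, 0)) \<in> carrier (dual C)" "(\<lambda>m. F (0, m)) \<in> carrier (dual M)"
    and "c \<in> carrier C \<Longrightarrow> m \<in> carrier M \<Longrightarrow> F (c, m) = F (c, 0) + F (0, m)"
  using F by (auto simp: dual_iff functional_trivial_coextension[OF C M])

lemma contr_comult_trivial_coextension:
  assumes C: "is_vspace C" and M: "is_vspace M"
  shows "contr (trivial_coextension C M) F (comult (trivial_coextension C M) (c, m)) =
    (contr C (\<lambda>c. F (c, 0)) (comult C c) + contr C (\<lambda>m. F (0, m)) (lcoact M m),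
     lact M (\<lambda>c. F (c, 0)) m)"
    and "contr (trivial_coextension C M) F (image_mset prod.swap (comult (trivial_coextension C M) (c, m))) =
    (contr C (\<lambda>c. F (c, 0)) (image_mset prod.swap (comult C c)) +
       contr C (\<lambda>m. F (0, m)) (image_mset prod.swap (rcoact M m)),
     ract M m (\<lambda>c. F (c, 0)))"
proof -
  let ?D = "trivial_coextension C M"
  have a: "contr ?D F (image_mset (\<lambda>(c\<^sub>1, c\<^sub>2). ((c\<^sub>1, 0), (c\<^sub>2, 0))) s) = (contr C (\<lambda>c. F (c, 0)) s, 0)"
    "contr ?D F (image_mset prod.swap (image_mset (\<lambda>(c\<^sub>1, c\<^sub>2). ((c\<^sub>1, 0), (c\<^sub>2, 0))) s)) =
      (contr C (\<lambda>c. F (c, 0)) (image_mset prod.swap s), 0)" for s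
    by (induction s) (auto simp: zero_prod_def smul_simps[OF M])
  have b: "contr ?D F (image_mset (\<lambda>(m\<^sub>1, m\<^sub>0). ((m\<^sub>1, 0), (0, m\<^sub>0))) s) = (contr C (\<lambda>m. F (0, m)) s, 0)"
    "contr ?D F (image_mset prod.swap (image_mset (\<lambda>(m\<^sub>1, m\<^sub>0). ((m\<^sub>1, 0), (0, m\<^sub>0))) s)) =
      (0, contr M (\<lambda>c. F (c, 0)) (image_mset prod.swap s))" for s
    by (induction s) (auto simp: zero_prod_def smul_simps[OF M] smul_simps[OF C])
  have c: "contr ?D F (image_mset (\<lambda>(m\<^sub>0, m\<^sub>1). ((0, m\<^sub>0), (m\<^sub>1, 0))) s) = (0, contr M (\<lambda>c. F (c, 0)) s)"
    "contr ?D F (image_mset prod.swap (image_mset (\<lambda>(m\<^sub>0, m\<^sub>1). ((0, m\<^sub>0), (m\<^sub>1, 0))) s)) =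
      (contr C (\<lambda>m. F (0, m)) (image_mset prod.swap s), 0)" for s
    by (induction s) (auto simp: zero_prod_def smul_simps[OF M] smul_simps[OF C])
  show "contr ?D F (comult ?D (c, m)) =
    (contr C (\<lambda>c. F (c, 0)) (comult C c) + contr C (\<lambda>m. F (0, m)) (lcoact M m), lact M (\<lambda>c. F (c, 0)) m)"
    by (simp add: comult_trivial_coextension a b c lact_def)
  show "contr ?D F (image_mset prod.swap (comult ?D (c, m))) =
    (contr C (\<lambda>c. F (c, 0)) (image_mset prod.swap (comult C c)) +
       contr C (\<lambda>m. F (0, m)) (image_mset prod.swap (rcoact M m)), ract M m (\<lambda>c. F (c, 0)))"
    unfolding comult_trivial_coextension image_mset_union contr_plus a b c ract_def by simp
qed

lemma pair2_comult_trivial_coextension: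
  "pair2 F G (comult (trivial_coextension C M) (c, m)) =
     pair2 (\<lambda>c. F (c, 0)) (\<lambda>c. G (c, 0)) (comult C c) +
     pair2 (\<lambda>c. F (c, 0)) (\<lambda>m. G (0, m)) (lcoact M m) +
     pair2 (\<lambda>m. F (0, m)) (\<lambda>c. G (c, 0)) (rcoact M m)"
  by (simp add: comult_trivial_coextension pair2_def image_mset.compositionality comp_def case_prod_beta')

context
  fixes C :: "('k::field, 'c::ab_group_add) coalg" and M :: "('k, 'm::ab_group_add, 'c) bicomod"
  assumes coalgebra: "coalgebra C" and bicomodule: "bicomodule C M"
begin

abbreviation (input) "coext \<equiv> trivial_coextension C M"

lemma bicomod_vspace: "is_vspace M"
  and bicomod_left: "tensor_lin_map M C M (lcoact M)"
  and bicomod_right: "tensor_lin_map M M C (rcoact M)"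
  and lact_conv: "f \<in> carrier (dual C) \<Longrightarrow> g \<in> carrier (dual C) \<Longrightarrow> m \<in> carrier M \<Longrightarrow>
        lact M (conv C f g) m = lact M f (lact M g m)"
  and ract_conv: "f \<in> carrier (dual C) \<Longrightarrow> g \<in> carrier (dual C) \<Longrightarrow> m \<in> carrier M \<Longrightarrow>
        ract M m (conv C f g) = ract M (ract M m f) g"
  and lact_ract: "f \<in> carrier (dual C) \<Longrightarrow> g \<in> carrier (dual C) \<Longrightarrow> m \<in> carrier M \<Longrightarrow>
        lact M f (ract M m g) = ract M (lact M f m) g"
  and lact_counit: "m \<in> carrier M \<Longrightarrow> lact M (counit C) m = m"
  and ract_counit: "m \<in> carrier M \<Longrightarrow> ract M m (counit C) = m"
  using bicomodule by (simp_all add: bicomodule_iff[OF coalgebra])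

lemma bicomod_left_swap: "tensor_lin_map M M C (\<lambda>m. image_mset prod.swap (lcoact M m))"
  using bicomod_left by (simp add: tensor_lin_map_swap bicomod_vspace coalgebra_vspace[OF coalgebra])

lemma lact_carrier: "m \<in> carrier M \<Longrightarrow> lact M f m \<in> carrier M"
  unfolding lact_def by (rule contr_carrier[OF bicomod_vspace tensor_lin_map_carrier[OF bicomod_right]])

lemma ract_carrier: "m \<in> carrier M \<Longrightarrow> ract M m f \<in> carrier M"
  unfolding ract_def by (rule contr_carrier[OF bicomod_vspace tensor_lin_map_carrier[OF bicomod_left_swap]])

lemma lact_zero: "f \<in> carrier (dual C) \<Longrightarrow> lact M f 0 = 0"
  using contr_smul[OF bicomod_vspace bicomod_vspace dual_functional bicomod_right, of f 0 0]
  by (simp add: lact_def carrier_zero[OF bicomod_vspace] smul_simps[OF bicomod_vspace])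

lemma ract_zero: "f \<in> carrier (dual C) \<Longrightarrow> ract M 0 f = 0"
  using contr_smul[OF bicomod_vspace bicomod_vspace dual_functional bicomod_left_swap, of f 0 0]
  by (simp add: ract_def carrier_zero[OF bicomod_vspace] smul_simps[OF bicomod_vspace])

lemma conv_zero_arg: "f \<in> carrier (dual C) \<Longrightarrow> g \<in> carrier (dual C) \<Longrightarrow> conv C f g 0 = 0"
  by (rule functional_zero[OF coalgebra_vspace[OF coalgebra] dual_functional[OF conv_closed[OF coalgebra]]])

lemma pair2_lcoact:
  assumes "e \<in> carrier (dual M)" "m \<in> carrier M"
  shows "pair2 f e (lcoact M m) = e (ract M m f)"
  using functional_contr[OF bicomod_vspace dual_functional[OF assms(1)]
      tensor_lin_map_carrier[OF bicomod_left_swap assms(2)], of f]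
  by (simp add: ract_def pair2_swap)

lemma pair2_rcoact:
  assumes "e \<in> carrier (dual M)" "m \<in> carrier M"
  shows "pair2 e f (rcoact M m) = e (lact M f m)"
  using functional_contr[OF bicomod_vspace dual_functional[OF assms(1)]
      tensor_lin_map_carrier[OF bicomod_right assms(2)], of f]
  by (simp add: lact_def)

text \<open>
  The dual algebra of the coextension: the components on \<open>C\<close> multiply as in \<open>C\<^sup>*\<close>, and on \<open>M\<close> they
  act on the components in \<open>M\<^sup>*\<close>.
\<close>

lemma conv_trivial_coextension:
  assumes F: "F \<in> carrier (dual coext)" and G: "G \<in> carrier (dual coext)"
    and cm: "c \<in> carrier C" "m \<in> carrier M"
  shows "conv coext F G (c, m) = conv C (\<lambda>c. F (c, 0)) (\<lambda>c. G (c, 0)) c +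
     G (0, ract M m (\<lambda>c. F (c, 0))) + F (0, lact M (\<lambda>c. G (c, 0)) m)"
  using cm dual_trivial_coextension[OF coalgebra_vspace[OF coalgebra] bicomod_vspace F] dual_trivial_coextension[OF coalgebra_vspace[OF coalgebra] bicomod_vspace G]
  by (simp add: conv_pair2 pair2_comult_trivial_coextension pair2_lcoact pair2_rcoact)

lemma tensor_lin_map_trivial_coextension: "tensor_lin_map coext coext coext (comult coext)"
proof -
  note D = vspace_trivial_coextension[OF coalgebra_vspace[OF coalgebra] bicomod_vspace]
  note zero = carrier_zero[OF coalgebra_vspace[OF coalgebra]] carrier_zero[OF bicomod_vspace]
  show ?thesis
    unfolding tensor_lin_map_iff[OF D D D]
  proof (intro conjI ballI)
    fix x assume "x \<in> carrier coext"
    then obtain c m where x: "x = (c, m)" "c \<in> carrier C" "m \<in> carrier M" by auto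
    show "set_mset (comult coext x) \<subseteq> carrier coext \<times> carrier coext"
      using tensor_lin_map_carrier[OF coalgebra_comult[OF coalgebra] x(2)] zero
        tensor_lin_map_carrier[OF bicomod_left x(3)] tensor_lin_map_carrier[OF bicomod_right x(3)]
      by (auto simp: x(1) comult_trivial_coextension)
  next
    fix F G assume F: "F \<in> carrier (dual coext)" and G: "G \<in> carrier (dual coext)"
    note FG = dual_trivial_coextension(1,2)[OF coalgebra_vspace[OF coalgebra] bicomod_vspace F]
      dual_trivial_coextension(1,2)[OF coalgebra_vspace[OF coalgebra] bicomod_vspace G]
    have lin: "functional C (\<lambda>c. pair2 (\<lambda>c. F (c, 0)) (\<lambda>c. G (c, 0)) (comult C c))"
      "functional M (\<lambda>m. pair2 (\<lambda>c. F (c, 0)) (\<lambda>m. G (0, m)) (lcoact M m))"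
      "functional M (\<lambda>m. pair2 (\<lambda>m. F (0, m)) (\<lambda>c. G (c, 0)) (rcoact M m))"
      using FG coalgebra_comult[OF coalgebra] bicomod_left bicomod_right
      by (simp_all add: tensor_lin_map_iff coalgebra_vspace[OF coalgebra] bicomod_vspace)
    show "functional coext (\<lambda>x. pair2 F G (comult coext x))"
      unfolding functional_def
      using functional_add[OF lin(1)] functional_add[OF lin(2)] functional_add[OF lin(3)]
        functional_smul[OF lin(1)] functional_smul[OF lin(2)] functional_smul[OF lin(3)]
      by (auto simp: pair2_comult_trivial_coextension algebra_simps)
  qed
qed

text \<open>
  Coassociativity is the associativity of the product just computed, which reduces to that of \<open>C\<^sup>*\<close>
  and to the bimodule laws of \<open>M\<close>.
\<close>

lemma coalgebra_trivial_coextension: "coalgebra coext"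
proof -
  note M = bicomod_vspace and C = coalgebra_vspace[OF coalgebra]
  note D = vspace_trivial_coextension[OF C M]
  note tlm = tensor_lin_map_trivial_coextension
  note zero = carrier_zero[OF C] carrier_zero[OF M]
  have counit0: "counit C 0 = 0"
    by (rule functional_zero[OF C coalgebra_counit[OF coalgebra]])
  have "functional coext (counit coext)"
    using coalgebra_counit[OF coalgebra] counit0
    by (auto simp: functional_trivial_coextension[OF C M] functional_def)
  moreover have "conv coext (conv coext F G) H = conv coext F (conv coext G H)"
    if FGH: "F \<in> carrier (dual coext)" "G \<in> carrier (dual coext)" "H \<in> carrier (dual coext)" for F G H
  proof -
    have parts: "(\<lambda>c. conv coext F G (c, 0)) = conv C (\<lambda>c. F (c, 0)) (\<lambda>c. G (c, 0))"
      "\<And>m. m \<in> carrier M \<Longrightarrow> conv coext F G (0, m) =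
         G (0, ract M m (\<lambda>c. F (c, 0))) + F (0, lact M (\<lambda>c. G (c, 0)) m)"
      if F: "F \<in> carrier (dual coext)" and G: "G \<in> carrier (dual coext)" for F G
    proof -
      note FG = dual_trivial_coextension(1,2)[OF C M F] dual_trivial_coextension(1,2)[OF C M G]
      have zero_val: "F (0, 0) = 0" "G (0, 0) = 0"
        using functional_zero[OF C dual_functional[OF FG(1)]] functional_zero[OF C dual_functional[OF FG(3)]] .
      show "(\<lambda>c. conv coext F G (c, 0)) = conv C (\<lambda>c. F (c, 0)) (\<lambda>c. G (c, 0))"
      proof
        fix c show "conv coext F G (c, 0) = conv C (\<lambda>c. F (c, 0)) (\<lambda>c. G (c, 0)) c"
        proof (cases "c \<in> carrier C")
          case True
          show ?thesis
            using conv_trivial_coextension[OF F G True zero(2)]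
            by (simp add: lact_zero[OF FG(3)] ract_zero[OF FG(1)] zero_val)
        qed (simp add: conv_outside)
      qed
      show "conv coext F G (0, m) = G (0, ract M m (\<lambda>c. F (c, 0))) + F (0, lact M (\<lambda>c. G (c, 0)) m)"
        if "m \<in> carrier M" for m
        using conv_trivial_coextension[OF F G zero(1) that] conv_zero_arg[OF FG(1,3)] by simp
    qed
    note closed = conv_dual[OF D tlm]
    note F = dual_trivial_coextension(1,2)[OF C M FGH(1)]
      and G = dual_trivial_coextension(1,2)[OF C M FGH(2)]
      and H = dual_trivial_coextension(1,2)[OF C M FGH(3)]
    have "conv coext (conv coext F G) H (c, m) = conv coext F (conv coext G H) (c, m)" for c m
    proof (cases "c \<in> carrier C \<and> m \<in> carrier M")
      case True
      then have cm: "c \<in> carrier C" "m \<in> carrier M" by auto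
      show ?thesis
        unfolding conv_trivial_coextension[OF closed[OF FGH(1,2)] FGH(3) cm]
          conv_trivial_coextension[OF FGH(1) closed[OF FGH(2,3)] cm]
          parts(1)[OF FGH(1,2)] parts(1)[OF FGH(2,3)]
          parts(2)[OF FGH(1,2) lact_carrier[OF cm(2)]] parts(2)[OF FGH(2,3) ract_carrier[OF cm(2)]]
        using F G H cm by (simp add: conv_assoc[OF coalgebra] lact_conv ract_conv lact_ract)
    qed (auto simp: conv_outside)
    then show ?thesis by (auto simp: fun_eq_iff)
  qed
  moreover have "contr coext (counit coext) (image_mset prod.swap (comult coext x)) = x"
    "contr coext (counit coext) (comult coext x) = x" if "x \<in> carrier coext" for x
  proof -
    obtain c m where x: "x = (c, m)" "c \<in> carrier C" "m \<in> carrier M" using \<open>x \<in> carrier coext\<close> by auto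
    have "contr C (\<lambda>_. 0) s = 0" for s :: "('c \<times> 'x) multiset"
      by (simp add: contr_def smul_simps[OF C])
    then show "contr coext (counit coext) (image_mset prod.swap (comult coext x)) = x"
      "contr coext (counit coext) (comult coext x) = x"
      using coalgebra x(2) lact_counit[OF x(3)] ract_counit[OF x(3)]
      unfolding x(1) contr_comult_trivial_coextension[OF C M]
      by (simp_all add: counit0 coalgebra_iff)
  qed
  ultimately show ?thesis
    using D tlm by (simp add: coalgebra_iff)
qed

end

definition coext_form ::
  "('k::field, 'c::ab_group_add) coalg \<Rightarrow> ('k, 'c \<Rightarrow> 'k, 'c) bicomod
    \<Rightarrow> 'c \<times> ('c \<Rightarrow> 'k) \<Rightarrow> 'c \<times> ('c \<Rightarrow> 'k) \<Rightarrow> 'k" where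
  "coext_form C M x y =
     (if y \<in> carrier C \<times> carrier M then snd y (fst x) + snd x (fst y) else 0)"

text \<open>
  Write \<open>F \<in> D\<^sup>*\<close> as \<open>(f, \<phi>)\<close> with \<open>f \<in> C\<^sup>*\<close> and \<open>\<phi> \<in> M\<^sup>*\<close>.  Evaluated at \<open>(c', m')\<close>, both \<open>\<Phi>(F\<rightharpoonup>(c, m))\<close> and
  \<open>F * \<Phi>(c, m)\<close> are \<open>(f * m)(c') + (m' * f)(c) + \<phi>(m * m')\<close>, and similarly on the other side.
  Injectivity: the values at \<open>(0, m')\<close> determine \<open>c\<close> by separation, those at \<open>(c', 0)\<close> determine \<open>m\<close>.
\<close>

lemma symmetric_trivial_coextension:
  fixes C :: "('k::field, 'c::ab_group_add) coalg"
  assumes C: "coalgebra C" and rat: "rat_bicomodule C M" and sep: "separates (left_rat C) (carrier C)"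
  shows "symmetric_coalgebra (trivial_coextension C M)"
proof -
  let ?D = "trivial_coextension C M" and ?\<Phi> = "coext_form C M"
  have bi: "bicomodule C M" and M: "carrier M = left_rat C" "smul M = smul (dual C)"
    and acts: "\<And>f m. f \<in> carrier (dual C) \<Longrightarrow> m \<in> carrier M \<Longrightarrow> lact M f m = conv C f m"
      "\<And>f m. f \<in> carrier (dual C) \<Longrightarrow> m \<in> carrier M \<Longrightarrow> ract M m f = conv C m f"
    using rat left_rat_dual_eq[OF C]
    by (auto simp: rat_bicomodule_iff)
  have M_dual: "m \<in> carrier (dual C)" if "m \<in> carrier M" for m
    using that M by (simp add: left_rat_dual_carrier[OF C])
  note vC = coalgebra_vspace[OF C] and vM = bicomod_vspace[OF C bi]
  note vD = vspace_trivial_coextension[OF vC vM]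
  note zero = carrier_zero[OF vC] carrier_zero[OF vM]
  have ev: "m c = 0" if "m \<in> carrier M" "c \<notin> carrier C" for m c
    using M_dual[OF that(1)] that(2) by (simp add: dual_iff)
  have M_lin: "functional C m" if "m \<in> carrier M" for m
    using M_dual[OF that] by (rule dual_functional)
  have M_zero: "m 0 = 0" if "m \<in> carrier M" for m
    by (rule functional_zero[OF vC M_lin[OF that]])
  have form: "?\<Phi> (c, m) (c', m') = m' c + m c'" if "c' \<in> carrier C" "m' \<in> carrier M" for c m c' m'
    using that by (simp add: coext_form_def)
  have dual: "?\<Phi> (c, m) \<in> carrier (dual ?D)" if "c \<in> carrier C" "m \<in> carrier M" for c m
  proof -
    have "functional ?D (?\<Phi> (c, m))"
      unfolding functional_def using M_lin[OF that(2)] 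
      by (auto simp: form carrier_add[OF vC] carrier_add[OF vM] carrier_smul[OF vC]
          carrier_smul[OF vM, unfolded M(2)] functional_add functional_smul M(2) smul_dual algebra_simps)
    then show ?thesis by (simp add: dual_iff coext_form_def)
  qed
  have "lin_map ?D (dual ?D) ?\<Phi>"
    unfolding lin_map_def
  proof (intro conjI ballI allI)
    show "?\<Phi> ` carrier ?D \<subseteq> carrier (dual ?D)" using dual by auto
  next
    fix x y assume "x \<in> carrier ?D" "y \<in> carrier ?D"
    then show "?\<Phi> (x + y) = ?\<Phi> x + ?\<Phi> y"
      by (auto simp: fun_eq_iff coext_form_def functional_add[OF M_lin])
  next
    fix a x assume "x \<in> carrier ?D"
    then show "?\<Phi> (smul ?D a x) = smul (dual ?D) a (?\<Phi> x)"
      by (auto simp: fun_eq_iff coext_form_def functional_smul[OF M_lin] smul_dual M(2) algebra_simps)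
  qed
  moreover have "inj_on ?\<Phi> (carrier ?D)"
  proof (rule inj_onI, clarsimp)
    fix c m d n assume cm: "c \<in> carrier C" "m \<in> carrier M" "d \<in> carrier C" "n \<in> carrier M"
      and eq: "?\<Phi> (c, m) = ?\<Phi> (d, n)"
    have eq': "m' c + m c' = m' d + n c'" if "c' \<in> carrier C" "m' \<in> carrier M" for c' m'
      using fun_cong[OF eq, of "(c', m')"] that by (simp add: form)
    have "m' (c - d) = 0" if "m' \<in> left_rat C" for m'
      using eq'[OF zero(1), of m'] M_zero[OF cm(2)] M_zero[OF cm(4)] that
        functional_diff[OF vC M_lin cm(1,3), of m'] by (simp add: M(1))
    then have "c - d = 0"
      using sep carrier_diff[OF vC cm(1,3)] by (auto simp: separates_def)
    moreover have "m c' = n c'" for c'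
      using eq'[OF _ zero(2), of c'] ev[OF cm(2)] ev[OF cm(4)] by (cases "c' \<in> carrier C") auto
    ultimately show "c = d \<and> m = n" by (auto simp: fun_eq_iff)
  qed
  moreover have "?\<Phi> (dual_act_left ?D F x) = conv ?D F (?\<Phi> x) \<and> ?\<Phi> (dual_act_right ?D x F) = conv ?D (?\<Phi> x) F"
    if F: "F \<in> carrier (dual ?D)" and x: "x \<in> carrier ?D" for F x
  proof -
    obtain c m where cm: "x = (c, m)" "c \<in> carrier C" "m \<in> carrier M" using x by auto
    let ?f = "\<lambda>c. F (c, 0)" and ?\<phi> = "\<lambda>m. F (0, m)"
    note f = dual_trivial_coextension(1,2)[OF vC vM F]
    note m = M_dual[OF cm(3)]
    have \<Phi>C: "(\<lambda>c'. ?\<Phi> (c, m) (c', 0)) = m"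
      using ev[OF cm(3)] zero by (auto simp: coext_form_def fun_eq_iff)
    have \<Phi>M: "?\<Phi> (c, m) (0, n) = n c" if "n \<in> carrier M" for n
      using that M_zero[OF cm(3)] zero by (simp add: form)
    have "?\<Phi> (dual_act_left ?D F x) (c', m') = conv ?D F (?\<Phi> x) (c', m')" 
      "?\<Phi> (dual_act_right ?D x F) (c', m') = conv ?D (?\<Phi> x) F (c', m')" for c' m'
    proof -
      show "?\<Phi> (dual_act_left ?D F x) (c', m') = conv ?D F (?\<Phi> x) (c', m')"
      proof (cases "c' \<in> carrier C \<and> m' \<in> carrier M")
        case True
        then have c': "c' \<in> carrier C" "m' \<in> carrier M" by auto
        note m' = M_dual[OF c'(2)]
        have "dual_act_left ?D F x = contr ?D F (comult ?D (c, m))"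
          by (simp add: dual_act_left_def contr_def cm(1))
        then have act: "dual_act_left ?D F x =
            (contr C ?f (comult C c) + contr C ?\<phi> (lcoact M m), conv C ?f m)"
          using contr_comult_trivial_coextension(1)[OF vC vM] acts(1)[OF f(1) cm(3)] by simp
        have "m' (contr C ?\<phi> (lcoact M m)) = pair2 m' ?\<phi> (lcoact M m)"
          by (rule functional_contr[OF vC M_lin[OF c'(2)] tensor_lin_map_carrier[OF bicomod_left[OF C bi] cm(3)]])
        also have "\<dots> = F (0, conv C m m')"
          using pair2_lcoact[OF C bi f(2) cm(3)] acts(2)[OF m' cm(3)] by simp
        finally have "m' (fst (dual_act_left ?D F x)) = conv C m' ?f c + F (0, conv C m m')"
          using conv_left_act[OF vC coalgebra_comult[OF C] m' cm(2), of ?f] M_lin[OF c'(2)]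
            contr_carrier[OF vC tensor_lin_map_carrier[OF coalgebra_comult[OF C] cm(2)]]
            contr_carrier[OF vC tensor_lin_map_carrier[OF bicomod_left[OF C bi] cm(3)]]
          by (simp add: act functional_add)
        moreover have "conv ?D F (?\<Phi> x) (c', m') = conv C ?f m c' + conv C m' ?f c + F (0, conv C m m')"
          using conv_trivial_coextension[OF C bi F dual[OF cm(2,3)] c'] \<Phi>C \<Phi>M[OF ract_carrier[OF C bi c'(2), of ?f]]
            acts(1)[OF m c'(2)] acts(2)[OF f(1) c'(2)]
          by (simp add: cm(1))
        ultimately show ?thesis
          using c' by (simp add: coext_form_def act)
      qed (auto simp: coext_form_def conv_outside)
      show "?\<Phi> (dual_act_right ?D x F) (c', m') = conv ?D (?\<Phi> x) F (c', m')"
      proof (cases "c' \<in> carrier C \<and> m' \<in> carrier M")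
        case True
        then have c': "c' \<in> carrier C" "m' \<in> carrier M" by auto
        note m' = M_dual[OF c'(2)]
        have swap_carrier: "set_mset (image_mset prod.swap (comult C c)) \<subseteq> carrier C \<times> carrier C"
          "set_mset (image_mset prod.swap (rcoact M m)) \<subseteq> carrier C \<times> carrier M"
          using tensor_lin_map_carrier[OF coalgebra_comult[OF C] cm(2)]
            tensor_lin_map_carrier[OF bicomod_right[OF C bi] cm(3)] by auto
        have "dual_act_right ?D x F = contr ?D F (image_mset prod.swap (comult ?D (c, m)))"
          by (simp add: dual_act_right_def contr_swap cm(1))
        then have act: "dual_act_right ?D x F =
            (contr C ?f (image_mset prod.swap (comult C c)) +
             contr C ?\<phi> (image_mset prod.swap (rcoact M m)), conv C m ?f)"
          using contr_comult_trivial_coextension(2)[OF vC vM] acts(2)[OF f(1) cm(3)] by simp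
        have "m' (contr C ?\<phi> (image_mset prod.swap (rcoact M m))) = pair2 ?\<phi> m' (rcoact M m)"
          using functional_contr[OF vC M_lin[OF c'(2)] swap_carrier(2), of ?\<phi>] by (simp add: pair2_swap)
        also have "\<dots> = F (0, conv C m' m)"
          using pair2_rcoact[OF C bi f(2) cm(3)] acts(1)[OF m' cm(3)] by simp
        finally have "m' (fst (dual_act_right ?D x F)) = conv C ?f m' c + F (0, conv C m' m)"
          using conv_right_act[OF vC coalgebra_comult[OF C] m' cm(2), of ?f] M_lin[OF c'(2)]
            contr_carrier[OF vC swap_carrier(1)] contr_carrier[OF vC swap_carrier(2)]
          by (simp add: act functional_add)
        moreover have "conv ?D (?\<Phi> x) F (c', m') = conv C m ?f c' + F (0, conv C m' m) + conv C ?f m' c"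
          using conv_trivial_coextension[OF C bi dual[OF cm(2,3)] F c'] \<Phi>C \<Phi>M[OF lact_carrier[OF C bi c'(2), of ?f]]
            acts(2)[OF m c'(2)] acts(1)[OF f(1) c'(2)]
          by (simp add: cm(1))
        ultimately show ?thesis
          using c' by (simp add: coext_form_def act)
      qed (auto simp: coext_form_def conv_outside)
    qed
    then show ?thesis by (auto simp: fun_eq_iff)
  qed
  ultimately show ?thesis
    using coalgebra_trivial_coextension[OF C bi] unfolding symmetric_coalgebra_def by blast
qed

text \<open>
  The copy of \<open>C\<close> inside \<open>C \<oplus> M\<close> is taken as the trivial coextension by zero.  It cannot simply
  inherit the representatives of \<open>\<Delta>\<close>: those of the coactions at \<open>0 \<in> M\<close> represent the zero tensor,
  but their entries may be nonzero elements of \<open>M\<close>.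
\<close>

definition zero_bicomodule :: "('k, 'm::zero, 'c) bicomod \<Rightarrow> ('k, 'm, 'c) bicomod" where
  "zero_bicomodule M = \<lparr>carrier = {0}, smul = smul M, lcoact = (\<lambda>_. {#}), rcoact = (\<lambda>_. {#})\<rparr>"

lemma zero_bicomodule:
  fixes C :: "('k::field, 'c::ab_group_add) coalg" and M :: "('k, 'm::ab_group_add, 'c) bicomod"
  assumes C: "coalgebra C" and M: "is_vspace M"
  shows "bicomodule C (zero_bicomodule M)"
proof -
  let ?Z = "zero_bicomodule M"
  have Z: "is_vspace ?Z"
    using M module.subspace_single_0[OF vspace_module[OF M]] by (simp add: is_vspace_def zero_bicomodule_def)
  show ?thesis
    unfolding bicomodule_iff[OF C] tensor_lin_map_iff[OF Z coalgebra_vspace[OF C] Z]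
      tensor_lin_map_iff[OF Z Z coalgebra_vspace[OF C]]
    using Z by (simp add: zero_bicomodule_def functional_def pair2_def lact_def ract_def)
qed

lemma trivial_coextension_embedding:
  fixes C :: "('k::field, 'c::ab_group_add) coalg" and M :: "('k, 'm::ab_group_add, 'c) bicomod"
  assumes C: "coalgebra C" and M: "bicomodule C M"
  defines "B \<equiv> trivial_coextension C (zero_bicomodule M)"
  shows "subcoalgebra B (trivial_coextension C M)"
    and "coalgebra_iso C B (\<lambda>c. (c, 0))"
proof -
  let ?D = "trivial_coextension C M" and ?\<iota> = "\<lambda>c. (c, 0 :: 'm)"
  note vC = coalgebra_vspace[OF C] and vM = bicomod_vspace[OF C M]
  have zero: "carrier (zero_bicomodule M) = {0}" "smul (zero_bicomodule M) = smul M"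
    "lcoact (zero_bicomodule M) m = {#}" "rcoact (zero_bicomodule M) m = {#}" for m
    by (simp_all add: zero_bicomodule_def)
  have coB: "coalgebra B" and coD: "coalgebra ?D"
    unfolding B_def
    using coalgebra_trivial_coextension[OF C zero_bicomodule[OF C vM]]
      coalgebra_trivial_coextension[OF C M] by auto
  note vD = vspace_trivial_coextension[OF vC vM]
  have B: "carrier B = carrier C \<times> {0}" "smul B = smul ?D"
    by (auto simp: B_def zero trivial_coextension_def fun_eq_iff)
  have comult_B: "comult B (c, m) = image_mset (map_prod ?\<iota> ?\<iota>) (comult C c)" for c m
    by (simp add: B_def comult_trivial_coextension zero map_prod_def)
  have counit: "counit B x = counit ?D x" for x
    by (cases x) (simp add: B_def)
  show "subcoalgebra B ?D"
    unfolding subcoalgebra_def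
  proof (intro conjI ballI coB coD)
    show "carrier B \<subseteq> carrier ?D" using carrier_zero[OF vM] by (auto simp: B)
    fix x assume "x \<in> carrier B"
    then obtain c where x: "x = (c, 0)" "c \<in> carrier C" by (auto simp: B)
    show "tensor_eq ?D ?D (comult B x) (comult ?D x)"
    proof (rule tensor_eqI_pair2[OF vD vD])
      show "set_mset (comult B x) \<subseteq> carrier ?D \<times> carrier ?D"
        using tensor_lin_map_carrier[OF coalgebra_comult[OF C] x(2)] carrier_zero[OF vM]
        by (auto simp: x(1) comult_B)
      show "set_mset (comult ?D x) \<subseteq> carrier ?D \<times> carrier ?D"
        using tensor_lin_map_carrier[OF coalgebra_comult[OF coD], of x] x carrier_zero[OF vM] by simp
      fix F G assume F: "F \<in> carrier (dual ?D)" and G: "G \<in> carrier (dual ?D)"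
      note f = dual_trivial_coextension(1,2)[OF vC vM F] and g = dual_trivial_coextension(1,2)[OF vC vM G]
      have "pair2 F G (comult ?D x) = pair2 (\<lambda>c. F (c, 0)) (\<lambda>c. G (c, 0)) (comult C c)"
        using functional_zero[OF vM dual_functional[OF f(2)]] functional_zero[OF vM dual_functional[OF g(2)]]
        by (simp add: x(1) pair2_comult_trivial_coextension carrier_zero[OF vM] pair2_lcoact[OF C M g(2)]
            pair2_rcoact[OF C M f(2)] ract_zero[OF C M f(1)] lact_zero[OF C M g(1)])
      then show "pair2 F G (comult B x) = pair2 F G (comult ?D x)"
        by (simp add: x(1) comult_B pair2_def image_mset.compositionality comp_def case_prod_beta')
    qed
  qed (use B counit in auto)
  have "lin_map C B ?\<iota>"
    by (auto simp: lin_map_def B smul_simps[OF vM])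
  moreover have "bij_betw ?\<iota> (carrier C) (carrier B)"
    by (auto simp: bij_betw_def inj_on_def B)
  ultimately show "coalgebra_iso C B ?\<iota>"
    unfolding coalgebra_iso_def coalgebra_hom_def comult_B counit
    by (auto intro: tensor_eq.refl)
qed

theorem theorem5p2:
  fixes C :: "('k::field, 'c::ab_group_add) coalg"
  assumes "coalgebra C"
    and "semiperfect C"
  shows "(\<exists>M. rat_bicomodule C M) \<and>
         (\<forall>M. rat_bicomodule C M \<longrightarrow> symmetric_coalgebra (trivial_coextension C M)) \<and>
         (\<exists>(D :: ('k, 'c \<times> ('c \<Rightarrow> 'k)) coalg) B f.
            symmetric_coalgebra D \<and> subcoalgebra B D \<and> coalgebra_iso C B f)"
proof -
  note rat = semiperfect_left_rat[OF assms]
  have symmetric: "symmetric_coalgebra (trivial_coextension C M)" if "rat_bicomodule C M" for M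
    by (rule symmetric_trivial_coextension[OF assms(1) that rat(2)])
  obtain M where M: "rat_bicomodule C M"
    using rat_bicomodule_exists[OF assms(1) rat(1)] by blast
  then have "bicomodule C M"
    by (simp add: rat_bicomodule_def)
  then show ?thesis
    using M symmetric trivial_coextension_embedding[OF assms(1)] by blast
qed

end
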